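(* Let $Q$ satisfy (Q1)–(Q4), $M>0$, and let $f_0\in\mathcal F_M$ be a minimizer of $\mathcal H_C$ over $\mathcal F_M$, so that $f_0(x,v)=\phi(E(x,v))$ with $\phi(E)=(Q')^{-1}(E_0-E)$ for $E<E_0$ and $\phi(E)=0$ for $E\ge E_0$, where $E=\frac12|v|^2+U_0(x)$, $U_0=U_{f_0}$, and $E_0=\frac1M\iint(Q'(f_0)+E)f_0\,dv\,dx$. Assume there are constants $C_1',C_2'>0$ such that $\phi(E)\le C_1'(E_0-E)^{k_1}$ for all sufficiently negative $E$ (as $E\to-\infty$), and $\phi(E)\ge C_2'(E_0-E)^{k_2}$ for all $E<E_0$ sufficiently close to $E_0$. Then $E_0<0$, $\rho_{f_0}\in C^1_c(\mathbb R^3)$ (continuously differentiable with compact support), $U_0\in C^2_b(\mathbb R^3)$ (with bounded derivatives up to order 2) with $\lim_{|x|\to\infty}U_0(x)=0$, and $f_0$ (equivalently $\rho_{f_0}$ and $U_0$) is spherically symmetric with respect to some point of $\mathbb R^3$.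
   Context: Standing assumptions on $Q$: $Q\in C^1([0,\infty))\cap C^2((0,\infty))$, $Q\ge0$, and there are constants $C_1,C_2>0$, $F_0>0$, $0<k_1,k_2,k_3<3/2$ with: (Q1) $Q(f)\ge C_1f^{1+1/k_1}$ for $f\ge F_0$; (Q2) $Q(f)\le C_2 f^{1+1/k_2}$ for $0\le f\le F_0$; (Q3) $Q(\lambda f)\ge\lambda^{1+1/k_3}Q(f)$ for $f\ge0$, $0\le\lambda\le1$; (Q4) $Q''(f)>0$ for $f>0$ and $Q'(0)=0$. For measurable $f=f(x,v)\ge0$ on $\mathbb R^3\times\mathbb R^3$: $\rho_f(x)=\int f(x,v)\,dv$, $U_f=-\rho_f*\frac1{|\cdot|}$, $E_{kin}(f)=\frac12\iint|v|^2f\,dv\,dx$, $E_{pot}(f)=-\frac1{8\pi}\int|\nabla U_f|^2dx$, $\mathcal C(f)=\iint Q(f)\,dv\,dx$, $\mathcal P(f)=\mathcal C(f)+E_{kin}(f)$, $\mathcal H_C(f)=\mathcal P(f)+E_{pot}(f)$. For $M>0$, $\mathcal F_M=\{f\in L^1(\mathbb R^6): f\ge0,\ \iint f=M,\ \mathcal P(f)<\infty\}$. *)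

theory Defs
  imports "HOL-Analysis.Analysis"
begin

type_synonym R3 = "real ^ 3"

definition rho :: "(R3 \<Rightarrow> R3 \<Rightarrow> real) \<Rightarrow> R3 \<Rightarrow> real" where
  "rho f x = (\<integral> v. f x v \<partial>lborel)"

definition Upot :: "(R3 \<Rightarrow> R3 \<Rightarrow> real) \<Rightarrow> R3 \<Rightarrow> real" where
  "Upot f x = - (\<integral> y. rho f y / norm (x - y) \<partial>lborel)"

text \<open>The (weak) gradient of U_f, i.e. rho_f convolved with the gradient of -1/|.|,
  which is x/|x|^3.\<close>
definition gradU :: "(R3 \<Rightarrow> R3 \<Rightarrow> real) \<Rightarrow> R3 \<Rightarrow> R3" where
  "gradU f x = (\<integral> y. (rho f y / norm (x - y) ^ 3) *\<^sub>R (x - y) \<partial>lborel)"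

definition Ekin :: "(R3 \<Rightarrow> R3 \<Rightarrow> real) \<Rightarrow> ennreal" where
  "Ekin f = (\<integral>\<^sup>+ z. ennreal (norm (snd z) ^ 2 / 2 * f (fst z) (snd z)) \<partial>(lborel :: (R3 \<times> R3) measure))"

definition Epot :: "(R3 \<Rightarrow> R3 \<Rightarrow> real) \<Rightarrow> real" where
  "Epot f = - (1 / (8 * pi)) * enn2real (\<integral>\<^sup>+ x. ennreal (norm (gradU f x) ^ 2) \<partial>lborel)"

definition Ccal :: "(real \<Rightarrow> real) \<Rightarrow> (R3 \<Rightarrow> R3 \<Rightarrow> real) \<Rightarrow> ennreal" where
  "Ccal Q f = (\<integral>\<^sup>+ z. ennreal (Q (f (fst z) (snd z))) \<partial>(lborel :: (R3 \<times> R3) measure))"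

definition Pcal :: "(real \<Rightarrow> real) \<Rightarrow> (R3 \<Rightarrow> R3 \<Rightarrow> real) \<Rightarrow> ennreal" where
  "Pcal Q f = Ccal Q f + Ekin f"

text \<open>H_C is only evaluated on F_M, where P(f) is finite.\<close>
definition HC :: "(real \<Rightarrow> real) \<Rightarrow> (R3 \<Rightarrow> R3 \<Rightarrow> real) \<Rightarrow> real" where
  "HC Q f = enn2real (Pcal Q f) + Epot f"

definition FM :: "(real \<Rightarrow> real) \<Rightarrow> real \<Rightarrow> (R3 \<Rightarrow> R3 \<Rightarrow> real) set" where
  "FM Q M = {f. integrable (lborel :: (R3 \<times> R3) measure) (\<lambda>z. f (fst z) (snd z))
              \<and> (\<forall>x v. 0 \<le> f x v)
              \<and> (\<integral> z. f (fst z) (snd z) \<partial>(lborel :: (R3 \<times> R3) measure)) = M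
              \<and> Pcal Q f < \<infinity>}"

definition standing_Q ::
  "(real \<Rightarrow> real) \<Rightarrow> (real \<Rightarrow> real) \<Rightarrow> (real \<Rightarrow> real) \<Rightarrow> real \<Rightarrow> real \<Rightarrow> bool" where
  "standing_Q Q Q' Q'' k1 k2 \<longleftrightarrow>
     (\<forall>s\<ge>0. (Q has_real_derivative Q' s) (at s within {0..})) \<and> continuous_on {0..} Q' \<and>
     (\<forall>s>0. (Q' has_real_derivative Q'' s) (at s)) \<and> continuous_on {0<..} Q'' \<and>
     (\<forall>s\<ge>0. 0 \<le> Q s) \<and>
     0 < k1 \<and> k1 < 3/2 \<and> 0 < k2 \<and> k2 < 3/2 \<and>
     (\<exists>C1 C2 F0 k3. C1 > 0 \<and> C2 > 0 \<and> F0 > 0 \<and> 0 < k3 \<and> k3 < 3/2 \<and>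
        (\<forall>s\<ge>F0. Q s \<ge> C1 * s powr (1 + 1 / k1)) \<and>
        (\<forall>s. 0 \<le> s \<and> s \<le> F0 \<longrightarrow> Q s \<le> C2 * s powr (1 + 1 / k2)) \<and>
        (\<forall>s\<ge>0. \<forall>t. 0 \<le> t \<and> t \<le> 1 \<longrightarrow> Q (t * s) \<ge> t powr (1 + 1 / k3) * Q s)) \<and>
     (\<forall>s>0. Q'' s > 0) \<and> Q' 0 = 0"

definition phi :: "(real \<Rightarrow> real) \<Rightarrow> real \<Rightarrow> real \<Rightarrow> real" where
  "phi Q' E0 E = (if E < E0 then inv_into {0..} Q' (E0 - E) else 0)"

definition cutoff_energy :: "(real \<Rightarrow> real) \<Rightarrow> real \<Rightarrow> (R3 \<Rightarrow> R3 \<Rightarrow> real) \<Rightarrow> real" where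
  "cutoff_energy Q' M f = (1 / M) *
     (\<integral> z. (Q' (f (fst z) (snd z)) + (norm (snd z) ^ 2 / 2 + Upot f (fst z))) * f (fst z) (snd z)
       \<partial>(lborel :: (R3 \<times> R3) measure))"

end

theory Submission
  imports Defs
begin

text \<open>
  Write \<open>V = - U\<^sub>0\<close> and \<open>s = E\<^sub>0 + V\<close>. Integrating \<open>f\<^sub>0 = \<phi> (E)\<close> over velocities gives \<open>\<rho> = g (s)\<close> with an
  increasing \<open>C\<^sup>1\<close> function \<open>g\<close> vanishing on \<open>s \<le> 0\<close>, and the growth bound on \<open>\<phi>\<close> gives \<open>\<rho>\<^sup>1\<^sup>/\<^sup>3 \<le> C (1 + V)\<close>. On the
  support, \<open>s f\<^sub>0 = Q' (f\<^sub>0) f\<^sub>0 + |v|\<^sup>2 f\<^sub>0 / 2\<close> is dominated by \<open>Q (f\<^sub>0) + |v|\<^sup>2 f\<^sub>0\<close> because of (Q3), so \<open>s \<rho>\<close> and hence \<open>\<rho>\<^sup>4\<^sup>/\<^sup>3\<close>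
  are integrable. This is enough to bound \<open>V\<close>, and then \<open>\<rho>\<close>. Now \<open>V\<close> vanishes at infinity; if
  \<open>E\<^sub>0 \<ge> 0\<close>, then \<open>s \<ge> c / (1 + |x|)\<close>, and the lower bound on \<open>\<phi>\<close> forces \<open>\<rho> \<ge> c' (1 + |x|)\<^sup>-\<^sup>3\<close>, which is not
  integrable. So \<open>E\<^sub>0 < 0\<close> and \<open>\<rho>\<close> has compact support; regularity follows from \<open>\<rho> = g (s)\<close> and the potential estimates.

  For the symmetry, polarize \<open>f\<^sub>0\<close> in \<open>x\<close> with respect to a plane through the centre of mass. This
  keeps the mass, the Casimir functional and the kinetic energy, and it strictly lowers the potential
  energy unless \<open>\<rho> - \<rho> \<circ> \<sigma>\<close> has constant sign on each side of the plane. For a minimizer the latter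
  holds, and since the first moment about the plane vanishes, \<open>\<rho> = \<rho> \<circ> \<sigma>\<close>. Reflections in planes through
  the centre of mass act transitively on spheres around it.
\<close>

section \<open>Lebesgue measure in polar coordinates and under similarities\<close>

lemma distr_norm_lborel:
  "distr (lborel :: 'a::euclidean_space measure) borel norm =
    density lborel (\<lambda>r. ennreal (DIM('a) * unit_ball_vol (DIM('a)) * r ^ (DIM('a) - 1)) * indicator {0..} r)"
    (is "?M = ?N")
proof (rule measure_eqI_generator_eq[where E = "range (\<lambda>a::real. {..a})" and \<Omega> = UNIV
      and A = "\<lambda>i. {..real i}"])
  let ?n = "DIM('a)" and ?c = "unit_ball_vol (DIM('a))"
  show "Int_stable (range (\<lambda>a::real. {..a}))"
    by (auto simp: Int_stable_def)
  have eqM: "emeasure ?M {..a} = (if a < 0 then 0 else ennreal (?c * a ^ ?n))" for a :: real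
  proof -
    have "emeasure ?M {..a} = emeasure lborel (norm -` {..a} \<inter> space (lborel :: 'a measure))"
      by (rule emeasure_distr) auto
    also have "norm -` {..a} \<inter> space (lborel :: 'a measure) = cball (0::'a) a"
      by auto
    also have "emeasure lborel (cball (0::'a) a) = (if a < 0 then 0 else ennreal (?c * a ^ ?n))"
      by (auto simp: emeasure_cball)
    finally show ?thesis .
  qed
  have eqN: "emeasure ?N {..a} = (if a < 0 then 0 else ennreal (?c * a ^ ?n))" for a :: real
  proof (cases "a < 0")
    case True
    then show ?thesis
      by (subst emeasure_density) (auto intro!: nn_integral_0_iff_AE[THEN iffD2] AE_I2 split: split_indicator)
  next
    case False
    have "((\<lambda>r. ?n * ?c * r ^ (?n - 1)) has_integral (?c * a ^ ?n - ?c * 0 ^ ?n)) {0..a}"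
      using False
      by (intro fundamental_theorem_of_calculus)
        (auto simp: has_real_derivative_iff_has_vector_derivative[symmetric]
          intro!: derivative_eq_intros)
    moreover have "(0::real) ^ ?n = 0" by simp
    ultimately have "((\<lambda>r. ?n * ?c * r ^ (?n - 1)) has_integral (?c * a ^ ?n)) {0..a}"
      by (simp only: mult_zero_right diff_zero)
    then have "integral\<^sup>N lborel (\<lambda>r. ennreal (?n * ?c * r ^ (?n - 1)) * indicator {0..a} r)
        = ennreal (?c * a ^ ?n)"
      by (intro nn_integral_has_integral_lebesgue') auto
    moreover have "emeasure ?N {..a} =
        integral\<^sup>N lborel (\<lambda>r. ennreal (?n * ?c * r ^ (?n - 1)) * indicator {0..a} r)"
      by (subst emeasure_density) (auto intro!: nn_integral_cong split: split_indicator)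
    ultimately show ?thesis using False by simp
  qed
  show "emeasure ?M X = emeasure ?N X" if "X \<in> range (\<lambda>a::real. {..a})" for X
    using that eqM eqN by auto
  show "sets ?M = sigma_sets UNIV (range (\<lambda>a::real. {..a}))"
    "sets ?N = sigma_sets UNIV (range (\<lambda>a::real. {..a}))"
    by (simp_all add: borel_eq_atMost[where 'a=real])
  show "(\<Union>i. {..real i}) = UNIV"
    by (auto intro: real_arch_simple)
  show "emeasure ?M {..real i} \<noteq> \<infinity>" for i
    by (simp add: eqM)
qed auto

lemma nn_integral_norm_radial:
  assumes [measurable]: "F \<in> borel_measurable borel"
  shows "(\<integral>\<^sup>+x. F (norm (x :: 'a::euclidean_space)) \<partial>lborel) =
    (\<integral>\<^sup>+r. ennreal (DIM('a) * unit_ball_vol (DIM('a)) * r ^ (DIM('a) - 1)) * indicator {0..} r * F r \<partial>lborel)"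
proof -
  have "(\<integral>\<^sup>+x. F (norm (x :: 'a)) \<partial>lborel) = integral\<^sup>N (distr (lborel :: 'a measure) borel norm) F"
    by (subst nn_integral_distr) auto
  then show ?thesis
    unfolding distr_norm_lborel by (simp add: nn_integral_density)
qed

lemma orthogonal_transformation_measurable:
  fixes A :: "'a::euclidean_space \<Rightarrow> 'a"
  assumes "orthogonal_transformation A"
  shows "A \<in> borel_measurable borel"
  using orthogonal_transformation_linear[OF assms]
  by (intro borel_measurable_continuous_onI linear_continuous_on) (simp add: linear_conv_bounded_linear)

lemma lborel_orthogonal_transformation:
  fixes A :: "R3 \<Rightarrow> R3"
  assumes A: "orthogonal_transformation A"
  shows "distr lborel borel A = lborel"
proof -
  define B where "B = inv A"
  have bij: "bij A" using A by (rule orthogonal_transformation_bij)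
  have oB: "orthogonal_transformation B"
    unfolding B_def using A by (rule orthogonal_transformation_inv)
  note [measurable] = orthogonal_transformation_measurable[OF A]
  have "lborel = distr lborel borel A"
  proof (rule lborel_eqI)
    fix l u :: R3 assume lu: "\<And>b. b \<in> Basis \<Longrightarrow> l \<bullet> b \<le> u \<bullet> b"
    have pre: "A -` box l u = B ` box l u"
      unfolding B_def using bij by (metis bij_vimage_eq_inv_image)
    have m: "B ` box l u \<in> lmeasurable" "measure lebesgue (B ` box l u) = measure lebesgue (box l u)"
      by (rule measurable_orthogonal_image[OF oB], simp, rule measure_orthogonal_image[OF oB], simp)
    have "emeasure (distr lborel borel A) (box l u) = emeasure lborel (A -` box l u)"
      by (subst emeasure_distr) auto
    also have "\<dots> = emeasure lebesgue (A -` box l u)"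
      using measurable_sets[of A borel borel "box l u"] by simp
    also have "\<dots> = emeasure lebesgue (box l u)"
      unfolding pre using m
      by (metis emeasure_eq_measure2 lmeasurable_box)
    also have "\<dots> = (\<Prod>b\<in>Basis. (u - l) \<bullet> b)"
      using lu by (simp add: emeasure_lborel_box_eq)
    finally show "emeasure (distr lborel borel A) (box l u) = (\<Prod>b\<in>Basis. (u - l) \<bullet> b)" .
  qed simp
  then show ?thesis by simp
qed

lemma lborel_similarity:
  fixes A :: "R3 \<Rightarrow> R3" and t :: real
  assumes A: "orthogonal_transformation A" and t: "t > 0"
  shows "lborel = density (distr lborel borel (\<lambda>x. p + t *\<^sub>R A x)) (\<lambda>_. ennreal (t ^ 3))"
proof -
  note [measurable] = orthogonal_transformation_measurable[OF A]
  have "lborel = density (distr lborel borel (\<lambda>x. p + t *\<^sub>R x)) (\<lambda>_. ennreal (\<bar>t\<bar> ^ DIM(R3)))"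
    using t by (intro lborel_affine) auto
  also have "distr lborel borel (\<lambda>x. p + t *\<^sub>R x) =
      distr (distr lborel borel A) borel (\<lambda>x. p + t *\<^sub>R x)"
    unfolding lborel_orthogonal_transformation[OF A] ..
  also have "\<dots> = distr lborel borel (\<lambda>x. p + t *\<^sub>R A x)"
    by (subst distr_distr) (auto simp: comp_def)
  finally show ?thesis using t by simp
qed

lemma nn_integral_similarity:
  fixes A :: "R3 \<Rightarrow> R3" and t :: real
  assumes A: "orthogonal_transformation A" and t: "t > 0"
    and F: "F \<in> borel_measurable borel"
  shows "(\<integral>\<^sup>+x. F x \<partial>lborel) = ennreal (t ^ 3) * (\<integral>\<^sup>+x. F (p + t *\<^sub>R A x) \<partial>lborel)"
proof -
  note [measurable] = orthogonal_transformation_measurable[OF A]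
  note [measurable] = F
  show ?thesis
    by (subst lborel_similarity[OF A t, of p])
      (simp add: nn_integral_density nn_integral_distr nn_integral_cmult)
qed

lemma lebesgue_integral_similarity:
  fixes A :: "R3 \<Rightarrow> R3" and t :: real and F :: "R3 \<Rightarrow> real"
  assumes A: "orthogonal_transformation A" and t: "t > 0"
    and F: "F \<in> borel_measurable borel"
  shows "(\<integral>x. F x \<partial>lborel) = t ^ 3 * (\<integral>x. F (p + t *\<^sub>R A x) \<partial>lborel)"
proof -
  note [measurable] = orthogonal_transformation_measurable[OF A]
  note [measurable] = F
  show ?thesis
    using t by (subst lborel_similarity[OF A t, of p])
      (simp add: integral_density integral_distr)
qed

lemma integrable_similarity:
  fixes A :: "R3 \<Rightarrow> R3" and t :: real and F :: "R3 \<Rightarrow> real"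
  assumes A: "orthogonal_transformation A" and t: "t > 0" and F: "integrable lborel F"
  shows "integrable lborel (\<lambda>x. F (p + t *\<^sub>R A x))"
proof -
  note [measurable] = orthogonal_transformation_measurable[OF A]
  have [measurable]: "F \<in> borel_measurable borel" using F by auto
  have "integrable (density (distr lborel borel (\<lambda>x. p + t *\<^sub>R A x)) (\<lambda>_. ennreal (t ^ 3))) F"
    using F lborel_similarity[OF A t, of p] by simp
  then have "integrable lborel (\<lambda>x. t^3 * F (p + t *\<^sub>R A x))"
    using t by (simp add: integrable_density integrable_distr_eq)
  then show ?thesis using t by simp
qed

lemma orthogonal_transformation_minus_id: "orthogonal_transformation (\<lambda>x::R3. - x)"
  by (simp add: orthogonal_transformation_neg orthogonal_transformation_id)

lemma nn_integral_reflect_translate: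
  fixes F :: "R3 \<Rightarrow> ennreal"
  assumes F: "F \<in> borel_measurable borel"
  shows "(\<integral>\<^sup>+y. F (x - y) \<partial>lborel) = (\<integral>\<^sup>+y. F y \<partial>lborel)"
  using nn_integral_similarity[OF orthogonal_transformation_minus_id zero_less_one F, of x]
  by (simp only: power_one ennreal_1 mult_1 scaleR_one add_uminus_conv_diff)

definition ball_const :: real where "ball_const = 3 * unit_ball_vol 3"

lemma ball_const_pos: "ball_const > 0"
  unfolding ball_const_def by (intro mult_pos_pos unit_ball_vol_pos) auto

lemma power2_mult_powr:
  fixes r a :: real
  assumes "r > 0"
  shows "r\<^sup>2 * r powr (-a) = r powr (2 - a)"
  using assms powr_add[of r 2 "-a"] by simp

lemma nn_integral_powr_radial:
  assumes [measurable]: "S \<in> sets borel"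
  shows "(\<integral>\<^sup>+w. ennreal (norm w powr (-a)) * indicator {w. norm w \<in> S} (w::R3) \<partial>lborel)
    = (\<integral>\<^sup>+r. ennreal (ball_const * r powr (2 - a)) * indicator (S \<inter> {0..}) r \<partial>lborel)"
proof -
  let ?G = "\<lambda>r. ennreal (DIM(R3) * unit_ball_vol (DIM(R3)) * r ^ (DIM(R3) - 1)) * indicator {0..} r
      * (ennreal (r powr (-a)) * indicator S r)"
  have "(\<integral>\<^sup>+w. ennreal (norm w powr (-a)) * indicator {w. norm w \<in> S} (w::R3) \<partial>lborel)
     = (\<integral>\<^sup>+w. (\<lambda>r. ennreal (r powr (-a)) * indicator S r) (norm (w::R3)) \<partial>lborel)"
    by (intro nn_integral_cong) (auto split: split_indicator)
  also have "\<dots> = (\<integral>\<^sup>+r. ?G r \<partial>lborel)"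
    by (rule nn_integral_norm_radial) simp
  also have "\<dots> = (\<integral>\<^sup>+r. ennreal (ball_const * r powr (2 - a)) * indicator (S \<inter> {0..}) r \<partial>lborel)"
  proof (rule nn_integral_cong_AE, rule AE_mp[OF AE_lborel_singleton[of 0]], intro AE_I2 impI)
    fix r :: real assume "r \<noteq> 0"
    show "?G r = ennreal (ball_const * r powr (2 - a)) * indicator (S \<inter> {0..}) r"
    proof (cases "0 < r \<and> r \<in> S")
      case True
      have "r\<^sup>2 * r powr (-a) = r powr (2 - a)"
        by (rule power2_mult_powr) (use True in auto)
      then show ?thesis using True ball_const_pos
        by (simp add: ball_const_def ennreal_mult'[symmetric] mult.assoc)
    qed (use \<open>r \<noteq> 0\<close> in \<open>auto split: split_indicator\<close>)
  qed
  finally show ?thesis .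
qed

lemma nn_integral_powr_ball:
  assumes a: "a < 3" and R: "R \<ge> 0"
  shows "(\<integral>\<^sup>+w. ennreal (norm w powr (-a)) * indicator {w. norm w \<le> R} (w::R3) \<partial>lborel)
    = ennreal (ball_const * R powr (3 - a) / (3 - a))"
proof -
  have "(\<integral>\<^sup>+r. ennreal (ball_const * r powr (2 - a)) * indicator {0..R} r \<partial>lborel)
    = ennreal (ball_const * (R powr (2 - a + 1) / (2 - a + 1)))"
    using a R ball_const_pos
    by (intro nn_integral_has_integral_lebesgue' has_integral_mult_right has_integral_powr_from_0) auto
  moreover have "{..R} \<inter> {0..} = {0..R}" by auto
  ultimately show ?thesis using nn_integral_powr_radial[of "{..R}" a] by (simp add: algebra_simps)
qed

lemma nn_integral_powr_outside_ball:
  assumes a: "a > 3" and R: "R > 0"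
  shows "(\<integral>\<^sup>+w. ennreal (norm w powr (-a)) * indicator {w. norm w \<ge> R} (w::R3) \<partial>lborel)
    = ennreal (ball_const * R powr (3 - a) / (a - 3))"
proof -
  have "(\<integral>\<^sup>+r. ennreal (ball_const * r powr (2 - a)) * indicator {R..} r \<partial>lborel)
    = ennreal (ball_const * (-(R powr (2 - a + 1)) / (2 - a + 1)))"
    using a R ball_const_pos
    by (intro nn_integral_has_integral_lebesgue' has_integral_mult_right has_integral_powr_to_inf) auto
  also have "ball_const * (-(R powr (2 - a + 1)) / (2 - a + 1)) = ball_const * R powr (3 - a) / (a - 3)"
    using a by (simp add: field_simps)
  finally have "(\<integral>\<^sup>+r. ennreal (ball_const * r powr (2 - a)) * indicator {R..} r \<partial>lborel)
    = ennreal (ball_const * R powr (3 - a) / (a - 3))" .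
  moreover have "{R..} \<inter> {0..} = {R..}" using R by auto
  ultimately show ?thesis using nn_integral_powr_radial[of "{R..}" a] by simp
qed

section \<open>Riesz kernels and boundedness of the potential\<close>

lemma powr_neg_le_one: "1 \<le> r \<Longrightarrow> 0 \<le> a \<Longrightarrow> r powr (-a) \<le> 1" for r a :: real
  using powr_mono[of "-a" 0 r] by simp

lemma nn_integral_powr_ball_shift:
  assumes "a < 3" "R \<ge> 0"
  shows "(\<integral>\<^sup>+y. ennreal (norm (x - y) powr (-a)) * indicator {y. norm (x - y) \<le> R} (y::R3) \<partial>lborel)
    = ennreal (ball_const * R powr (3 - a) / (3 - a))"
  using nn_integral_reflect_translate[of "\<lambda>w. ennreal (norm w powr (-a)) * indicator {w. norm w \<le> R} w" x]
    nn_integral_powr_ball[OF assms]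
  by (simp add: indicator_def)

lemma nn_integral_powr_outside_ball_shift:
  assumes "a > 3" "R > 0"
  shows "(\<integral>\<^sup>+y. ennreal (norm (x - y) powr (-a)) * indicator {y. norm (x - y) \<ge> R} (y::R3) \<partial>lborel)
    = ennreal (ball_const * R powr (3 - a) / (a - 3))"
  using nn_integral_reflect_translate[of "\<lambda>w. ennreal (norm w powr (-a)) * indicator {w. norm w \<ge> R} w" x]
    nn_integral_powr_outside_ball[OF assms]
  by (simp add: indicator_def)

lemma nn_riesz_bound:
  fixes q :: "R3 \<Rightarrow> real"
  assumes q[measurable]: "q \<in> borel_measurable borel" and B: "\<And>y. \<bar>q y\<bar> \<le> B" and a: "0 \<le> a" "a < 3"
  shows "(\<integral>\<^sup>+y. ennreal (\<bar>q y\<bar> * norm (x - y) powr (-a)) \<partial>lborel)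
    \<le> ennreal (B * ball_const / (3 - a)) + (\<integral>\<^sup>+y. ennreal \<bar>q y\<bar> \<partial>lborel)"
proof -
  have B0: "B \<ge> 0" using B[of 0] by simp
  have "(\<integral>\<^sup>+y. ennreal (\<bar>q y\<bar> * norm (x - y) powr (-a)) \<partial>lborel)
    \<le> (\<integral>\<^sup>+y. ennreal B * (ennreal (norm (x - y) powr (-a)) * indicator {y. norm (x - y) \<le> 1} y) + ennreal \<bar>q y\<bar> \<partial>lborel)"
  proof (intro nn_integral_mono)
    fix y
    show "ennreal (\<bar>q y\<bar> * norm (x - y) powr (-a)) \<le>
      ennreal B * (ennreal (norm (x - y) powr (-a)) * indicator {y. norm (x - y) \<le> 1} y) + ennreal \<bar>q y\<bar>"
    proof (cases "norm (x - y) \<le> 1")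
      case True
      have "\<bar>q y\<bar> * norm (x - y) powr (-a) \<le> B * norm (x - y) powr (-a)"
        using B[of y] by (intro mult_right_mono) auto
      then have "ennreal (\<bar>q y\<bar> * norm (x - y) powr (-a)) \<le> ennreal B * ennreal (norm (x - y) powr (-a))"
        using B0 by (simp add: ennreal_mult'[symmetric] ennreal_leI)
      then show ?thesis using True by (simp add: add_increasing2)
    next
      case False
      then have "norm (x - y) powr (-a) \<le> 1" using a by (intro powr_neg_le_one) auto
      then have "\<bar>q y\<bar> * norm (x - y) powr (-a) \<le> \<bar>q y\<bar>" by (simp add: mult_left_le)
      then show ?thesis using False by (simp add: ennreal_leI)
    qed
  qed
  also have "\<dots> = ennreal B * ennreal (ball_const * 1 powr (3 - a) / (3 - a)) + (\<integral>\<^sup>+y. ennreal \<bar>q y\<bar> \<partial>lborel)"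
    using a by (subst nn_integral_add, measurable, subst nn_integral_cmult, measurable, subst nn_integral_powr_ball_shift, auto)
  also have "\<dots> = ennreal (B * ball_const / (3 - a)) + (\<integral>\<^sup>+y. ennreal \<bar>q y\<bar> \<partial>lborel)"
    using B0 ball_const_pos a by (simp add: ennreal_mult'[symmetric])
  finally show ?thesis .
qed

lemma
  fixes q :: "R3 \<Rightarrow> real"
  assumes q: "integrable lborel q" and B: "\<And>y. \<bar>q y\<bar> \<le> B" and a: "0 \<le> a" "a < 3"
  shows riesz_integrable: "integrable lborel (\<lambda>y. q y * norm (x - y) powr (-a))"
    and riesz_bound: "(\<integral>y. \<bar>q y\<bar> * norm (x - y) powr (-a) \<partial>lborel)
      \<le> B * ball_const / (3 - a) + (\<integral>y. \<bar>q y\<bar> \<partial>lborel)"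
proof -
  have qm[measurable]: "q \<in> borel_measurable borel" using q by auto
  have B0: "B \<ge> 0" using B[of 0] by simp
  have eq: "(\<integral>\<^sup>+y. ennreal \<bar>q y\<bar> \<partial>lborel) = ennreal (\<integral>y. \<bar>q y\<bar> \<partial>lborel)"
    using q by (intro nn_integral_eq_integral) auto
  have C: "0 \<le> B * ball_const / (3 - a)" using B0 ball_const_pos a by simp
  have le: "(\<integral>\<^sup>+y. ennreal (\<bar>q y\<bar> * norm (x - y) powr (-a)) \<partial>lborel)
     \<le> ennreal (B * ball_const / (3 - a) + (\<integral>y. \<bar>q y\<bar> \<partial>lborel))"
    using nn_riesz_bound[of q B a x, OF qm B a] C unfolding eq by (simp add: ennreal_plus)
  show int: "integrable lborel (\<lambda>y. q y * norm (x - y) powr (-a))"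
  proof (rule integrableI_bounded)
    have "(\<integral>\<^sup>+y. ennreal (norm (q y * norm (x - y) powr (-a))) \<partial>lborel)
       = (\<integral>\<^sup>+y. ennreal (\<bar>q y\<bar> * norm (x - y) powr (-a)) \<partial>lborel)"
      by (simp add: abs_mult)
    also have "\<dots> < \<infinity>" using le by (auto simp: top_unique less_top[symmetric])
    finally show "(\<integral>\<^sup>+y. ennreal (norm (q y * norm (x - y) powr (-a))) \<partial>lborel) < \<infinity>" .
  qed simp
  have "integrable lborel (\<lambda>y. \<bar>q y\<bar> * norm (x - y) powr (-a))"
    using integrable_abs[OF int] by (simp add: abs_mult)
  then have "ennreal (\<integral>y. \<bar>q y\<bar> * norm (x - y) powr (-a) \<partial>lborel) =
      (\<integral>\<^sup>+y. ennreal (\<bar>q y\<bar> * norm (x - y) powr (-a)) \<partial>lborel)"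
    by (intro nn_integral_eq_integral[symmetric]) auto
  moreover have "0 \<le> B * ball_const / (3 - a) + (\<integral>y. \<bar>q y\<bar> \<partial>lborel)"
    using C by (simp add: add_nonneg_nonneg)
  moreover note le
  ultimately show "(\<integral>y. \<bar>q y\<bar> * norm (x - y) powr (-a) \<partial>lborel)
      \<le> B * ball_const / (3 - a) + (\<integral>y. \<bar>q y\<bar> \<partial>lborel)"
    by - (rule ennreal_le_iff[THEN iffD1], assumption, erule ssubst, assumption)
qed

lemma kernel_convolution_bound:
  fixes x z :: R3
  assumes "x \<noteq> z"
  shows "(\<integral>\<^sup>+y. ennreal (norm (x - y) powr (-2) * norm (z - y) powr (-2)) \<partial>lborel)
    \<le> ennreal (8 * ball_const / norm (x - z))"
proof -
  define d where "d = norm (x - z)"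
  have d: "d > 0" using assms by (simp add: d_def)
  define N where "N = (\<lambda>u y. ennreal (norm (u - y :: R3) powr (-2)) * indicator {y. norm (u - y) \<le> d/2} y)"
  define F where "F = (\<lambda>u y. ennreal (norm (u - y :: R3) powr (-4)) * indicator {y. norm (u - y) \<ge> d/2} y)"
  have mN[measurable]: "N u \<in> borel_measurable borel" for u unfolding N_def by measurable
  have mF[measurable]: "F u \<in> borel_measurable borel" for u unfolding F_def by measurable
  have IN: "(\<integral>\<^sup>+y. N u y \<partial>lborel) = ennreal (ball_const * (d/2))" for u
    unfolding N_def using d by (subst nn_integral_powr_ball_shift) auto
  have IF: "(\<integral>\<^sup>+y. F u y \<partial>lborel) = ennreal (ball_const * (2/d))" for u
    unfolding F_def using d by (subst nn_integral_powr_outside_ball_shift) (auto simp: powr_minus divide_simps)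
  have "(\<integral>\<^sup>+y. ennreal (norm (x - y) powr (-2) * norm (z - y) powr (-2)) \<partial>lborel)
    \<le> (\<integral>\<^sup>+y. ennreal (4 / d\<^sup>2) * (N x y + N z y) + (F x y + F z y) \<partial>lborel)"
  proof (intro nn_integral_mono)
    fix y
    define a b where "a = norm (x - y)" and "b = norm (z - y)"
    have ab: "a \<ge> 0" "b \<ge> 0" "d \<le> a + b"
      unfolding a_def b_def d_def using norm_triangle_ineq4[of "x - y" "z - y"] by auto
    have small: "s powr (-2) * t powr (-2) \<le> 4 / d\<^sup>2 * s powr (-2)" if "t \<ge> d/2" for s t :: real
    proof -
      have "t powr (-2) \<le> (d/2) powr (-2)" using that d by (intro powr_mono2') auto
      also have "\<dots> = 4 / d\<^sup>2" using d by (simp add: powr_minus powr_numeral power2_eq_square divide_simps)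
      finally show ?thesis by (subst mult.commute, intro mult_right_mono) auto
    qed
    have sq: "s powr (-4) = (s powr (-2))\<^sup>2" for s :: real
      by (simp add: powr_def exp_of_nat_mult[symmetric] algebra_simps flip: exp_double)
    consider "a \<le> d/2" | "b \<le> d/2" | "a \<ge> d/2" "b \<ge> d/2" by linarith
    then show "ennreal (norm (x - y) powr (-2) * norm (z - y) powr (-2)) \<le>
      ennreal (4 / d\<^sup>2) * (N x y + N z y) + (F x y + F z y)"
    proof cases
      case 1
      then have "b \<ge> d/2" using ab by simp
      then have "ennreal (a powr (-2) * b powr (-2)) \<le> ennreal (4 / d\<^sup>2) * ennreal (a powr (-2))"
        using small[of b a] by (simp add: ennreal_mult'[symmetric] ennreal_leI)
      also have "\<dots> = ennreal (4 / d\<^sup>2) * N x y" using 1 by (simp add: N_def a_def)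
      finally show ?thesis
        unfolding a_def b_def by (rule order_trans) (auto simp: distrib_left intro!: add_increasing2)
    next
      case 2
      then have "a \<ge> d/2" using ab by simp
      then have "ennreal (b powr (-2) * a powr (-2)) \<le> ennreal (4 / d\<^sup>2) * ennreal (b powr (-2))"
        using small[of a b] by (simp add: ennreal_mult'[symmetric] ennreal_leI)
      also have "\<dots> = ennreal (4 / d\<^sup>2) * N z y" using 2 by (simp add: N_def b_def)
      also have "ennreal (b powr (-2) * a powr (-2)) = ennreal (norm (x - y) powr (-2) * norm (z - y) powr (-2))"
        unfolding a_def b_def by (simp add: mult.commute)
      finally show ?thesis
        by (rule order_trans) (auto simp: distrib_left intro!: add_increasing2 add_increasing)
    next
      case 3
      have "a powr (-2) * b powr (-2) \<le> a powr (-4) + b powr (-4)"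
        unfolding sq using sum_squares_bound[of "a powr (-2)" "b powr (-2)"]
          mult_nonneg_nonneg[of "a powr (-2)" "b powr (-2)"] by (simp del: mult_nonneg_nonneg)
      then have "ennreal (a powr (-2) * b powr (-2)) \<le> ennreal (a powr (-4)) + ennreal (b powr (-4))"
        by (simp add: ennreal_leI flip: ennreal_plus)
      also have "\<dots> = (F x y + F z y)" using 3 by (simp add: F_def a_def b_def)
      finally show ?thesis
        unfolding a_def b_def by (rule order_trans) (auto intro!: add_increasing)
    qed
  qed
  also have "\<dots> = ennreal (4 / d\<^sup>2) * (ennreal (ball_const * (d/2)) + ennreal (ball_const * (d/2)))
      + (ennreal (ball_const * (2/d)) + ennreal (ball_const * (2/d)))"
    by (subst nn_integral_add, measurable, subst nn_integral_cmult, measurable)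
      (simp add: nn_integral_add IN IF)
  also have "\<dots> = ennreal (4 / d\<^sup>2 * (ball_const * (d/2) + ball_const * (d/2))
      + (ball_const * (2/d) + ball_const * (2/d)))"
    using d ball_const_pos by (simp add: ennreal_mult'[symmetric] flip: ennreal_plus)
  also have "4 / d\<^sup>2 * (ball_const * (d/2) + ball_const * (d/2))
      + (ball_const * (2/d) + ball_const * (2/d)) = 8 * ball_const / d"
    using d by (simp add: field_simps power2_eq_square)
  finally show ?thesis unfolding d_def .
qed

lemma weighted_am_gm:
  fixes u v t :: real
  assumes "u \<ge> 0" "v \<ge> 0" "t > 0"
  shows "u * v \<le> t * u\<^sup>2 + v\<^sup>2 / t"
proof -
  have "0 \<le> (t * u - v)\<^sup>2" by simp
  then have "2 * (t * u * v) \<le> t\<^sup>2 * u\<^sup>2 + v\<^sup>2" by (simp add: power2_diff power_mult_distrib)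
  moreover have "0 \<le> t * u * v" using assms by simp
  ultimately have "t * u * v \<le> t\<^sup>2 * u\<^sup>2 + v\<^sup>2" by linarith
  then show ?thesis using assms by (simp add: field_simps power2_eq_square)
qed

lemma cube_mult_le: "u ^ 3 * w \<le> u ^ 4 + w ^ 4" if "u \<ge> 0" "w \<ge> 0" for u w :: real
proof (cases "w \<le> u")
  case True
  then have "u ^ 3 * w \<le> u ^ 3 * u" using that by (intro mult_left_mono) auto
  also have "\<dots> = u ^ 4" by (simp add: eval_nat_numeral)
  finally show ?thesis using that by (simp add: add_increasing2)
next
  case False
  then have "u ^ 3 * w \<le> w ^ 3 * w" using that by (intro mult_right_mono power_mono) auto
  also have "\<dots> = w ^ 4" by (simp add: eval_nat_numeral)
  finally show ?thesis using that by (simp add: add_increasing)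
qed

lemma powr_minus_one_sq: "(s powr (-1))\<^sup>2 = s powr (-2)" for s :: real
  by (simp add: powr_def power2_eq_square exp_add[symmetric])

lemma powr_third:
  fixes r :: real
  assumes "r \<ge> 0"
  shows "(r powr (1/3)) ^ 3 = r" "(r powr (1/3))\<^sup>2 = r powr (2/3)" "(r powr (1/3)) ^ 4 = r powr (4/3)"
    "(r powr (2/3))\<^sup>2 = r powr (4/3)" "r powr (2/3) * r powr (1/3) = r"
proof -
  show "(r powr (1/3)) ^ 3 = r" "(r powr (1/3))\<^sup>2 = r powr (2/3)" "(r powr (1/3)) ^ 4 = r powr (4/3)"
    "(r powr (2/3))\<^sup>2 = r powr (4/3)"
    using assms by (cases "r = 0"; simp add: powr_power)+
  show "r powr (2/3) * r powr (1/3) = r"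
    using assms by (cases "r = 0") (simp_all add: powr_add[symmetric])
qed

text \<open>The mass, the integral of \<open>\<rho>\<^sup>4\<^sup>/\<^sup>3\<close> and the pointwise bound
  \<open>\<rho>\<^sup>1\<^sup>/\<^sup>3 \<le> C (1 + V)\<close> are subcritical: inserting the bound once into \<open>V\<close> and
  exchanging the order of integration replaces the kernel \<open>1/|\<cdot>|\<close> by \<open>|\<cdot>|\<^sup>-\<^sup>1\<^sup>/\<^sup>2\<close>,
  against which \<open>\<rho> \<in> L\<^sup>4\<^sup>/\<^sup>3\<close> integrates to a bounded function.\<close>
lemma newton_potential_bounded:
  fixes \<rho> :: "R3 \<Rightarrow> real" and C :: real
  defines "V \<equiv> \<lambda>x. \<integral>\<^sup>+y. ennreal (\<rho> y * norm (x - y) powr (-1)) \<partial>lborel"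
  assumes m[measurable]: "\<rho> \<in> borel_measurable borel" and nn: "\<And>y. 0 \<le> \<rho> y"
    and M: "(\<integral>\<^sup>+y. ennreal (\<rho> y) \<partial>lborel) < \<infinity>"
    and A: "(\<integral>\<^sup>+y. ennreal (\<rho> y powr (4/3)) \<partial>lborel) < \<infinity>"
    and C: "C \<ge> 0" "\<And>y. ennreal (\<rho> y powr (1/3)) \<le> ennreal C * (1 + V y)"
  shows "\<exists>B\<ge>0. \<forall>x. V x \<le> ennreal B"
proof -
  define Mm where "Mm = (\<integral>\<^sup>+y. ennreal (\<rho> y) \<partial>lborel)"
  define Aa where "Aa = (\<integral>\<^sup>+y. ennreal (\<rho> y powr (4/3)) \<partial>lborel)"
  define near where "near = (\<lambda>(x::R3) y. indicator {y. norm (x - y) \<le> 1} y :: ennreal)"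
  have [measurable]: "near x \<in> borel_measurable borel" for x unfolding near_def by measurable
  have Vm[measurable]: "V \<in> borel_measurable borel" unfolding V_def by measurable
  have inear2: "(\<integral>\<^sup>+y. ennreal (norm (x - y) powr (-2)) * near x y \<partial>lborel) = ennreal ball_const" for x
    unfolding near_def by (subst nn_integral_powr_ball_shift) auto
  define T where "T = (\<lambda>x. \<integral>\<^sup>+y. ennreal (\<rho> y powr (2/3) * norm (x - y) powr (-1)) * V y \<partial>lborel)"
  have half: "(\<integral>\<^sup>+z. ennreal (\<rho> z * norm (x - z) powr (-1/2)) \<partial>lborel) \<le> Mm + (Aa + ennreal ball_const)" for x
  proof -
    have "(\<integral>\<^sup>+z. ennreal (\<rho> z * norm (x - z) powr (-1/2)) \<partial>lborel)
      \<le> (\<integral>\<^sup>+z. ennreal (\<rho> z) + (ennreal (\<rho> z powr (4/3)) + ennreal (norm (x - z) powr (-2)) * near x z) \<partial>lborel)"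
    proof (intro nn_integral_mono)
      fix z
      show "ennreal (\<rho> z * norm (x - z) powr (-1/2)) \<le>
        ennreal (\<rho> z) + (ennreal (\<rho> z powr (4/3)) + ennreal (norm (x - z) powr (-2)) * near x z)"
      proof (cases "norm (x - z) \<le> 1")
        case True
        have w: "(norm (x - z) powr (-1/2)) ^ 4 = norm (x - z) powr (-2)"
          by (cases "norm (x - z) = 0") (simp_all add: powr_power)
        have "\<rho> z * norm (x - z) powr (-1/2) \<le> \<rho> z powr (4/3) + norm (x - z) powr (-2)"
          using cube_mult_le[of "\<rho> z powr (1/3)" "norm (x - z) powr (-1/2)"]
          unfolding powr_third(1)[OF nn] powr_third(3)[OF nn] w by simp
        then show ?thesis using True
          by - (rule add_increasing, simp_all add: near_def ennreal_leI flip: ennreal_plus)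
      next
        case False
        then have "norm (x - z) powr (-(1/2)) \<le> 1" by (intro powr_neg_le_one) auto
        then have "\<rho> z * norm (x - z) powr (-1/2) \<le> \<rho> z" using nn[of z] by (simp add: mult_left_le)
        then show ?thesis by - (rule add_increasing2, simp_all add: ennreal_leI)
      qed
    qed
    also have "\<dots> = Mm + (Aa + ennreal ball_const)"
      unfolding Mm_def Aa_def inear2[of x, symmetric]
      by (subst nn_integral_add, measurable, subst nn_integral_add, measurable)
    finally show ?thesis .
  qed
  have T: "T x \<le> (Aa + ennreal (8 * ball_const)) * (Mm + (Aa + ennreal ball_const))" for x
  proof -
    let ?J = "\<lambda>y z. ennreal (\<rho> y powr (2/3) * norm (x - y) powr (-1)) * ennreal (\<rho> z * norm (y - z) powr (-1))"
    let ?L = "\<lambda>y z. ennreal (\<rho> y powr (2/3) * (norm (x - y) powr (-1) * norm (y - z) powr (-1)))"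
    have "T x = (\<integral>\<^sup>+y. (\<integral>\<^sup>+z. ?J y z \<partial>lborel) \<partial>lborel)"
      unfolding T_def V_def by (simp add: nn_integral_cmult)
    also have "\<dots> = (\<integral>\<^sup>+z. (\<integral>\<^sup>+y. ?J y z \<partial>lborel) \<partial>lborel)"
      by (rule lborel_pair.Fubini') measurable
    also have "\<dots> \<le> (\<integral>\<^sup>+z. (Aa + ennreal (8 * ball_const)) * ennreal (\<rho> z * norm (x - z) powr (-1/2)) \<partial>lborel)"
    proof (rule nn_integral_mono_AE, rule AE_mp[OF AE_lborel_singleton[of x]], intro AE_I2 impI)
      fix z assume zx: "z \<noteq> x"
      define d where "d = norm (x - z)"
      have d: "d > 0" using zx by (simp add: d_def)
      define t where "t = d powr (-1/2)"
      have t: "t > 0" "1 / t = d powr (1/2)" using d by (simp_all add: t_def powr_minus divide_simps)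
      have "(\<integral>\<^sup>+y. ?L y z \<partial>lborel)
        \<le> (\<integral>\<^sup>+y. ennreal t * ennreal (\<rho> y powr (4/3)) + ennreal (1/t) * ennreal (norm (x - y) powr (-2) * norm (z - y) powr (-2)) \<partial>lborel)"
      proof (intro nn_integral_mono)
        fix y
        have "\<rho> y powr (2/3) * (norm (x - y) powr (-1) * norm (y - z) powr (-1))
          \<le> t * (\<rho> y powr (2/3))\<^sup>2 + (norm (x - y) powr (-1) * norm (y - z) powr (-1))\<^sup>2 / t"
          using t by (intro weighted_am_gm) auto
        also have "\<dots> = t * \<rho> y powr (4/3) + (1/t) * (norm (x - y) powr (-2) * norm (z - y) powr (-2))"
          unfolding power_mult_distrib powr_minus_one_sq powr_third(4)[OF nn] by (simp add: norm_minus_commute)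
        finally show "?L y z \<le>
          ennreal t * ennreal (\<rho> y powr (4/3)) + ennreal (1/t) * ennreal (norm (x - y) powr (-2) * norm (z - y) powr (-2))"
          using t by (simp add: ennreal_mult[symmetric] ennreal_leI flip: ennreal_plus)
      qed
      also have "\<dots> = ennreal t * Aa + ennreal (1/t) * (\<integral>\<^sup>+y. ennreal (norm (x - y) powr (-2) * norm (z - y) powr (-2)) \<partial>lborel)"
        unfolding Aa_def by (subst nn_integral_add, measurable, subst nn_integral_cmult, measurable, subst nn_integral_cmult, measurable)
      also have "\<dots> \<le> ennreal t * Aa + ennreal (1/t) * ennreal (8 * ball_const / d)"
        unfolding d_def using zx by (intro add_left_mono mult_left_mono kernel_convolution_bound) auto
      also have "ennreal (1/t) * ennreal (8 * ball_const / d) = ennreal t * ennreal (8 * ball_const)"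
      proof -
        have "d powr (1/2) / d = d powr (-1/2)" using d powr_diff[of d "1/2" 1] by simp
        moreover have "1/t * (8 * ball_const / d) = (d powr (1/2) / d) * (8 * ball_const)"
          unfolding t(2) by simp
        ultimately have "1/t * (8 * ball_const / d) = t * (8 * ball_const)"
          by (simp only: t_def)
        then show ?thesis using t ball_const_pos d by (simp add: ennreal_mult'[symmetric])
      qed
      finally have in1: "(\<integral>\<^sup>+y. ?L y z \<partial>lborel)
        \<le> ennreal t * (Aa + ennreal (8 * ball_const))"
        by (simp add: distrib_left)
      have "(\<integral>\<^sup>+y. ?J y z \<partial>lborel)
        = (\<integral>\<^sup>+y. ennreal (\<rho> z) * ?L y z \<partial>lborel)"
        using nn by (intro nn_integral_cong) (simp add: ennreal_mult[symmetric] mult_ac)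
      also have "\<dots> = ennreal (\<rho> z) * (\<integral>\<^sup>+y. ?L y z \<partial>lborel)"
        by (rule nn_integral_cmult) measurable
      also have "\<dots> \<le> ennreal (\<rho> z) * (ennreal t * (Aa + ennreal (8 * ball_const)))"
        by (intro mult_left_mono in1) auto
      also have "\<dots> = (Aa + ennreal (8 * ball_const)) * ennreal (\<rho> z * norm (x - z) powr (-1/2))"
        using nn t by (simp add: ennreal_mult t_def d_def mult_ac)
      finally show "(\<integral>\<^sup>+y. ?J y z \<partial>lborel)
        \<le> (Aa + ennreal (8 * ball_const)) * ennreal (\<rho> z * norm (x - z) powr (-1/2))" .
    qed
    also have "\<dots> = (Aa + ennreal (8 * ball_const)) * (\<integral>\<^sup>+z. ennreal (\<rho> z * norm (x - z) powr (-1/2)) \<partial>lborel)"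
      by (rule nn_integral_cmult) measurable
    also have "\<dots> \<le> (Aa + ennreal (8 * ball_const)) * (Mm + (Aa + ennreal ball_const))"
      by (intro mult_left_mono half) auto
    finally show ?thesis .
  qed
  define K where "K = Mm + ennreal C * ((Aa + ennreal ball_const) + (Aa + ennreal (8 * ball_const)) * (Mm + (Aa + ennreal ball_const)))"
  have "V x \<le> K" for x
  proof -
    let ?G = "\<lambda>y. ennreal (\<rho> y) + ennreal C * ((ennreal (\<rho> y powr (4/3)) + ennreal (norm (x - y) powr (-2)) * near x y)
         + ennreal (\<rho> y powr (2/3) * norm (x - y) powr (-1)) * V y)"
    have "V x = (\<integral>\<^sup>+y. ennreal (\<rho> y * norm (x - y) powr (-1)) \<partial>lborel)"
      by (simp only: V_def)
    also have "\<dots> \<le> (\<integral>\<^sup>+y. ?G y \<partial>lborel)"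
    proof (intro nn_integral_mono)
      fix y
      show "ennreal (\<rho> y * norm (x - y) powr (-1)) \<le> ?G y"
      proof (cases "norm (x - y) \<le> 1")
        case True
        define s where "s = \<rho> y powr (2/3) * norm (x - y) powr (-1)"
        have "s \<le> \<rho> y powr (4/3) + norm (x - y) powr (-2)"
          using weighted_am_gm[of "\<rho> y powr (2/3)" "norm (x - y) powr (-1)" 1]
          unfolding s_def powr_minus_one_sq powr_third(4)[OF nn] by simp
        then have s1: "ennreal s \<le> ennreal (\<rho> y powr (4/3)) + ennreal (norm (x - y) powr (-2)) * near x y"
          using True by (simp add: near_def ennreal_leI flip: ennreal_plus)
        have "ennreal (\<rho> y * norm (x - y) powr (-1)) = ennreal (\<rho> y powr (1/3)) * ennreal s"
          unfolding s_def using powr_third(5)[OF nn[of y]]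
          by (simp add: ennreal_mult'[symmetric] mult.assoc[symmetric]) (simp add: mult.commute)
        also have "\<dots> \<le> (ennreal C * (1 + V y)) * ennreal s"
          by (intro mult_right_mono C) auto
        also have "\<dots> = ennreal C * (ennreal s + ennreal s * V y)"
          by (simp add: distrib_left distrib_right mult_ac)
        also have "\<dots> \<le> ennreal C * ((ennreal (\<rho> y powr (4/3)) + ennreal (norm (x - y) powr (-2)) * near x y) + ennreal s * V y)"
          by (intro mult_left_mono add_right_mono s1) auto
        finally show ?thesis unfolding s_def by - (rule add_increasing, auto)
      next
        case False
        then have "norm (x - y) powr (-1) \<le> 1" by (intro powr_neg_le_one) auto
        then have "\<rho> y * norm (x - y) powr (-1) \<le> \<rho> y" using nn[of y] by (intro mult_left_le)
        then show ?thesis by - (rule add_increasing2, simp_all add: ennreal_leI)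
      qed
    qed
    also have "\<dots> = Mm + ennreal C * ((Aa + ennreal ball_const) + T x)"
      unfolding Mm_def Aa_def inear2[of x, symmetric] T_def
      by (subst nn_integral_add, measurable, subst nn_integral_cmult, measurable, subst nn_integral_add, measurable,
          subst nn_integral_add, measurable)
    also have "\<dots> \<le> K"
      unfolding K_def by (intro add_left_mono mult_left_mono T) auto
    finally show ?thesis .
  qed
  moreover have "K < \<infinity>"
    using M A unfolding K_def Mm_def Aa_def by (auto simp: ennreal_mult_less_top)
  ultimately have "\<forall>x. V x \<le> ennreal (enn2real K)"
    by simp
  then show ?thesis using enn2real_nonneg by blast
qed

section \<open>Regularity of Newtonian potentials\<close>

definition newt :: "(R3 \<Rightarrow> real) \<Rightarrow> R3 \<Rightarrow> real" where
  "newt q x = (\<integral>y. q y / norm (x - y) \<partial>lborel)"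

definition gnewt :: "(R3 \<Rightarrow> real) \<Rightarrow> R3 \<Rightarrow> R3" where
  "gnewt q x = (\<integral>y. (q y / norm (x - y) ^ 3) *\<^sub>R (x - y) \<partial>lborel)"

lemma powr_minus_five_halves:
  fixes a :: real
  assumes "a > 0"
  shows "a powr (-(5/2)) = 1 / sqrt a ^ 5"
proof -
  have "sqrt a ^ 5 = a powr (5/2)"
    using assms powr_power[of a "1/2" 5] by (simp add: powr_half_sqrt)
  then show ?thesis using assms by (simp add: powr_minus_divide)
qed

lemma newton_kernel_remainder:
  fixes w h :: "'a::real_inner"
  assumes w: "w \<noteq> 0" and wh: "w + h \<noteq> 0"
  shows "\<bar>1 / norm (w + h) - 1 / norm w + (w \<bullet> h) / norm w ^ 3\<bar>
    \<le> 12 * sqrt (norm h) ^ 3 * (norm w powr (-(5/2)) + norm (w + h) powr (-(5/2)))"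
proof -
  define \<alpha> \<beta> \<eta> where "\<alpha> = sqrt (norm w)" and "\<beta> = sqrt (norm (w + h))" and "\<eta> = sqrt (norm h)"
  have a: "norm w = \<alpha>\<^sup>2" and b: "norm (w + h) = \<beta>\<^sup>2" and h: "norm h = \<eta>\<^sup>2"
    by (simp_all add: \<alpha>_def \<beta>_def \<eta>_def)
  have pos: "\<alpha> > 0" "\<beta> > 0" "\<eta> \<ge> 0" using w wh by (simp_all add: \<alpha>_def \<beta>_def \<eta>_def)
  let ?R = "1 / \<beta>\<^sup>2 - 1 / \<alpha>\<^sup>2 + (w \<bullet> h) / (\<alpha>\<^sup>2) ^ 3"
  have tri: "\<beta>\<^sup>2 \<le> \<alpha>\<^sup>2 + \<eta>\<^sup>2" "\<alpha>\<^sup>2 \<le> \<beta>\<^sup>2 + \<eta>\<^sup>2"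
  proof -
    have "norm (w + h) \<le> norm w + norm h" by (rule norm_triangle_ineq)
    then show "\<beta>\<^sup>2 \<le> \<alpha>\<^sup>2 + \<eta>\<^sup>2" unfolding a b h .
    have "norm w \<le> norm (w + h) + norm h" using norm_triangle_ineq4[of "w + h" h] by simp
    then show "\<alpha>\<^sup>2 \<le> \<beta>\<^sup>2 + \<eta>\<^sup>2" unfolding a b h .
  qed
  have cs: "\<bar>w \<bullet> h\<bar> \<le> \<alpha>\<^sup>2 * \<eta>\<^sup>2" using Cauchy_Schwarz_ineq2[of w h] unfolding a h .
  have main: "\<bar>?R\<bar> \<le> 12 * \<eta> ^ 3 * (1 / \<alpha> ^ 5 + 1 / \<beta> ^ 5)"
  proof (cases "\<alpha>\<^sup>2 \<le> 2 * \<eta>\<^sup>2")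
    case True
    have al: "\<alpha> \<le> 3/2 * \<eta>"
    proof (rule power2_le_imp_le)
      have "(3/2 * \<eta>)\<^sup>2 = 9/4 * \<eta>\<^sup>2" by (simp add: power_mult_distrib power2_eq_square)
      then show "\<alpha>\<^sup>2 \<le> (3/2 * \<eta>)\<^sup>2" using True zero_le_power2[of \<eta>] by linarith
    qed (use pos in auto)
    have be: "\<beta> \<le> 2 * \<eta>"
    proof (rule power2_le_imp_le)
      have "(2 * \<eta>)\<^sup>2 = 4 * \<eta>\<^sup>2" by (simp add: power_mult_distrib)
      then show "\<beta>\<^sup>2 \<le> (2 * \<eta>)\<^sup>2" using True tri zero_le_power2[of \<eta>] by linarith
    qed (use pos in auto)
    have "\<alpha> ^ 3 \<le> (3/2 * \<eta>) ^ 3" using al pos by (intro power_mono) auto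
    moreover have "(3/2 * \<eta>) ^ 3 = 27/8 * \<eta> ^ 3" by (simp add: power3_eq_cube)
    moreover have "0 \<le> \<eta> ^ 3" using pos by simp
    ultimately have "\<alpha> ^ 3 \<le> 4 * \<eta> ^ 3" by linarith
    then have t1: "1 / \<alpha>\<^sup>2 \<le> 4 * \<eta> ^ 3 * (1 / \<alpha> ^ 5)"
      using pos by (simp add: field_simps eval_nat_numeral)
    have "\<beta> ^ 3 \<le> (2 * \<eta>) ^ 3" using be pos by (intro power_mono) auto
    then have "\<beta> ^ 3 \<le> 8 * \<eta> ^ 3" by (simp add: power_mult_distrib)
    then have t2: "1 / \<beta>\<^sup>2 \<le> 8 * \<eta> ^ 3 * (1 / \<beta> ^ 5)"
      using pos by (simp add: field_simps eval_nat_numeral)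
    have "\<bar>(w \<bullet> h) / (\<alpha>\<^sup>2) ^ 3\<bar> \<le> \<alpha>\<^sup>2 * \<eta>\<^sup>2 / (\<alpha>\<^sup>2) ^ 3"
      using cs pos by (simp add: abs_divide divide_right_mono)
    also have "\<dots> = \<eta>\<^sup>2 * \<alpha> * (1 / \<alpha> ^ 5)"
      using pos by (simp add: field_simps eval_nat_numeral)
    also have "\<dots> \<le> \<eta>\<^sup>2 * (3/2 * \<eta>) * (1 / \<alpha> ^ 5)"
      using al pos by (intro mult_right_mono mult_left_mono) auto
    also have "\<dots> = 3/2 * \<eta> ^ 3 * (1 / \<alpha> ^ 5)" by (simp add: eval_nat_numeral)
    finally have t3: "\<bar>(w \<bullet> h) / (\<alpha>\<^sup>2) ^ 3\<bar> \<le> 3/2 * \<eta> ^ 3 * (1 / \<alpha> ^ 5)" .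
    have p: "0 \<le> \<eta> ^ 3 * (1 / \<alpha> ^ 5)" "0 \<le> \<eta> ^ 3 * (1 / \<beta> ^ 5)" "0 \<le> 1 / \<alpha>\<^sup>2" "0 \<le> 1 / \<beta>\<^sup>2" using pos by auto
    have "\<bar>?R\<bar> \<le> 1 / \<beta>\<^sup>2 + 1 / \<alpha>\<^sup>2 + \<bar>(w \<bullet> h) / (\<alpha>\<^sup>2) ^ 3\<bar>" using p by linarith
    also have "\<dots> \<le> 12 * (\<eta> ^ 3 * (1 / \<alpha> ^ 5)) + 12 * (\<eta> ^ 3 * (1 / \<beta> ^ 5))"
      using t1 t2 t3 p by linarith
    finally show ?thesis by (simp add: algebra_simps)
  next
    case False
    then have small: "\<eta>\<^sup>2 \<le> \<alpha>\<^sup>2 / 2" by simp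
    have wh2: "w \<bullet> h = ((\<beta>\<^sup>2)\<^sup>2 - (\<alpha>\<^sup>2)\<^sup>2 - (\<eta>\<^sup>2)\<^sup>2) / 2"
      unfolding a[symmetric] b[symmetric] h[symmetric]
      by (simp add: power2_norm_eq_inner inner_add_left inner_add_right inner_commute)
    define A C H where "A = \<alpha>\<^sup>2" and "C = \<beta>\<^sup>2" and "H = \<eta>\<^sup>2"
    have AC: "A > 0" "C > 0" "H \<ge> 0" "C \<ge> A / 2" "H \<le> A / 2" "\<bar>A - C\<bar> \<le> H"
      using pos small tri by (auto simp: A_def C_def H_def)
    have id: "?R = (A - C)\<^sup>2 * (1 / (A\<^sup>2 * C) + 1 / (2 * A ^ 3)) - H\<^sup>2 / (2 * A ^ 3)"
      unfolding wh2 A_def[symmetric] C_def[symmetric] H_def[symmetric]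
      using AC by (simp add: field_simps eval_nat_numeral)
    have c1: "1 / (A\<^sup>2 * C) \<le> 2 / A ^ 3"
      using AC by (simp add: field_simps eval_nat_numeral)
    have sq: "(A - C)\<^sup>2 \<le> H\<^sup>2" using AC(6,3) by (metis abs_le_square_iff abs_of_nonneg)
    have "(A - C)\<^sup>2 * (1 / (A\<^sup>2 * C) + 1 / (2 * A ^ 3)) \<le> H\<^sup>2 * (2 / A ^ 3 + 1 / (2 * A ^ 3))"
      using sq c1 AC by (intro mult_mono add_mono) auto
    moreover have "0 \<le> (A - C)\<^sup>2 * (1 / (A\<^sup>2 * C) + 1 / (2 * A ^ 3))" using AC by simp
    moreover have "0 \<le> H\<^sup>2 / (2 * A ^ 3)" using AC by simp
    moreover have "H\<^sup>2 * (2 / A ^ 3 + 1 / (2 * A ^ 3)) = 5 * (H\<^sup>2 / (2 * A ^ 3))"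
      using AC by (simp add: field_simps)
    ultimately have "\<bar>?R\<bar> \<le> 6 * (H\<^sup>2 / (2 * A ^ 3))" unfolding id by linarith
    also have "\<dots> = 3 * \<eta> ^ 3 * (\<eta> / \<alpha> ^ 6)"
      unfolding A_def H_def using pos by (simp add: field_simps eval_nat_numeral)
    also have "\<dots> \<le> 3 * \<eta> ^ 3 * (1 / \<alpha> ^ 5)"
    proof -
      have "\<eta>\<^sup>2 \<le> \<alpha>\<^sup>2" using small zero_le_power2[of \<alpha>] by linarith
      then have "\<eta> \<le> \<alpha>" using pos by simp
      then show ?thesis using pos by (intro mult_left_mono) (auto simp: field_simps eval_nat_numeral)
    qed
    also have "\<dots> \<le> 12 * \<eta> ^ 3 * (1 / \<alpha> ^ 5 + 1 / \<beta> ^ 5)"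
      using pos by (intro mult_mono) auto
    finally show ?thesis .
  qed
  have "norm w powr (-(5/2)) = 1 / \<alpha> ^ 5" "norm (w + h) powr (-(5/2)) = 1 / \<beta> ^ 5"
    using w wh by (simp_all add: powr_minus_five_halves \<alpha>_def \<beta>_def)
  with main show ?thesis unfolding a b \<eta>_def by simp
qed

locale bounded_density =
  fixes q :: "R3 \<Rightarrow> real" and B :: real
  assumes integrable_q: "integrable lborel q" and bound_q: "\<bar>q y\<bar> \<le> B"
begin

lemma measurable_q[measurable]: "q \<in> borel_measurable borel"
  using integrable_q by auto

lemma B_nonneg: "B \<ge> 0" using bound_q[of 0] by simp

abbreviation mass :: real where "mass \<equiv> \<integral>y. \<bar>q y\<bar> \<partial>lborel"

lemma integrable_newt: "integrable lborel (\<lambda>y. q y / norm (x - y))"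
  using riesz_integrable[OF integrable_q bound_q, of 1 x] by (simp add: powr_minus_divide)

lemma integrable_abs_powr:
  "0 \<le> a \<Longrightarrow> a < 3 \<Longrightarrow> integrable lborel (\<lambda>y. \<bar>q y\<bar> * norm (x - y) powr (-a))"
  using integrable_abs[OF riesz_integrable[OF integrable_q bound_q, of a x]] by (simp add: abs_mult)

lemma norm_gnewt_integrand:
  "norm ((q y / norm (x - y) ^ 3) *\<^sub>R (x - y)) = \<bar>q y\<bar> * norm (x - y) powr (-2)"
  by (cases "x = y") (simp_all add: powr_minus_divide power3_eq_cube power2_eq_square)

lemma integrable_gnewt: "integrable lborel (\<lambda>y. (q y / norm (x - y) ^ 3) *\<^sub>R (x - y))"
  using integrable_abs_powr[of 2 x]
  by (rule Bochner_Integration.integrable_bound) (auto simp: norm_gnewt_integrand simp del: norm_scaleR)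

lemma newt_bound: "\<bar>newt q x\<bar> \<le> B * ball_const / 2 + mass"
proof -
  have "\<bar>newt q x\<bar> \<le> (\<integral>y. \<bar>q y / norm (x - y)\<bar> \<partial>lborel)"
    unfolding newt_def using integral_abs_bound[of lborel "\<lambda>y. q y / norm (x - y)"] by simp
  also have "\<dots> = (\<integral>y. \<bar>q y\<bar> * norm (x - y) powr (-1) \<partial>lborel)"
    by (simp add: powr_minus_divide abs_divide)
  also have "\<dots> \<le> B * ball_const / (3 - 1) + mass"
    by (rule riesz_bound[OF integrable_q bound_q]) auto
  finally show ?thesis by simp
qed

lemma gnewt_bound: "norm (gnewt q x) \<le> B * ball_const + mass"
proof -
  have "norm (gnewt q x) \<le> (\<integral>y. norm ((q y / norm (x - y) ^ 3) *\<^sub>R (x - y)) \<partial>lborel)"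
    unfolding gnewt_def by (rule integral_norm_bound)
  also have "\<dots> = (\<integral>y. \<bar>q y\<bar> * norm (x - y) powr (-2) \<partial>lborel)"
    by (simp only: norm_gnewt_integrand)
  also have "\<dots> \<le> B * ball_const / (3 - 2) + mass"
    by (rule riesz_bound[OF integrable_q bound_q]) auto
  finally show ?thesis by simp
qed

definition newt_rem :: real where "newt_rem = 24 * (2 * B * ball_const + mass)"

lemma newt_rem_nonneg: "newt_rem \<ge> 0"
  unfolding newt_rem_def using B_nonneg ball_const_pos by (simp add: add_nonneg_nonneg)

lemma newt_expansion:
  "\<bar>newt q (x + h) - newt q x + gnewt q x \<bullet> h\<bar> \<le> newt_rem * sqrt (norm h) ^ 3"
proof -
  let ?r = "\<lambda>y. q y / norm (x + h - y) - q y / norm (x - y) + ((q y / norm (x - y) ^ 3) *\<^sub>R (x - y)) \<bullet> h"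
  have int: "integrable lborel ?r"
    by (intro Bochner_Integration.integrable_add Bochner_Integration.integrable_diff
        integrable_newt integrable_inner_left integrable_gnewt)
  have eq: "newt q (x + h) - newt q x + gnewt q x \<bullet> h = (\<integral>y. ?r y \<partial>lborel)"
  proof -
    have "gnewt q x \<bullet> h = (\<integral>y. ((q y / norm (x - y) ^ 3) *\<^sub>R (x - y)) \<bullet> h \<partial>lborel)"
      unfolding gnewt_def by (rule integral_inner_left[symmetric, OF integrable_gnewt])
    then show ?thesis
      unfolding newt_def
      by (subst Bochner_Integration.integral_add[OF Bochner_Integration.integrable_diff[OF integrable_newt integrable_newt]
          integrable_inner_left[OF integrable_gnewt]])
        (subst Bochner_Integration.integral_diff[OF integrable_newt integrable_newt], simp only:)
  qed
  let ?g = "\<lambda>y. 12 * sqrt (norm h) ^ 3 * (\<bar>q y\<bar> * norm (x - y) powr (-(5/2)) + \<bar>q y\<bar> * norm (x + h - y) powr (-(5/2)))"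
  have intg: "integrable lborel ?g"
    using integrable_abs_powr[of "5/2" x] integrable_abs_powr[of "5/2" "x + h"] by auto
  have "\<bar>\<integral>y. ?r y \<partial>lborel\<bar> \<le> (\<integral>y. \<bar>?r y\<bar> \<partial>lborel)"
    using integral_abs_bound[of lborel ?r] by simp
  also have "\<dots> \<le> (\<integral>y. ?g y \<partial>lborel)"
  proof (rule integral_mono_AE[OF integrable_abs[OF int] intg], rule AE_mp[OF AE_lborel_singleton[of x]],
      rule AE_mp[OF AE_lborel_singleton[of "x + h"]], intro AE_I2 impI)
    fix y assume y: "y \<noteq> x + h" "y \<noteq> x"
    have e: "x + h - y = (x - y) + h" by simp
    have "?r y = q y * (1 / norm ((x - y) + h) - 1 / norm (x - y) + ((x - y) \<bullet> h) / norm (x - y) ^ 3)"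
      unfolding e inner_scaleR_left by (simp add: distrib_left right_diff_distrib)
    then have "\<bar>?r y\<bar> = \<bar>q y\<bar> * \<bar>1 / norm ((x - y) + h) - 1 / norm (x - y) + ((x - y) \<bullet> h) / norm (x - y) ^ 3\<bar>"
      by (simp add: abs_mult)
    also have "\<dots> \<le> \<bar>q y\<bar> * (12 * sqrt (norm h) ^ 3 * (norm (x - y) powr (-(5/2)) + norm ((x - y) + h) powr (-(5/2))))"
      using y by (intro mult_left_mono newton_kernel_remainder) (auto simp: algebra_simps)
    also have "\<dots> = ?g y" unfolding e by (simp add: algebra_simps)
    finally show "\<bar>?r y\<bar> \<le> ?g y" .
  qed
  also have "\<dots> = 12 * sqrt (norm h) ^ 3 * ((\<integral>y. \<bar>q y\<bar> * norm (x - y) powr (-(5/2)) \<partial>lborel)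
      + (\<integral>y. \<bar>q y\<bar> * norm (x + h - y) powr (-(5/2)) \<partial>lborel))"
    using integrable_abs_powr[of "5/2" x] integrable_abs_powr[of "5/2" "x + h"] by simp
  also have "\<dots> \<le> 12 * sqrt (norm h) ^ 3 * ((B * ball_const / (3 - 5/2) + mass) + (B * ball_const / (3 - 5/2) + mass))"
    by (intro mult_left_mono add_mono riesz_bound[OF integrable_q bound_q]) auto
  also have "\<dots> = newt_rem * sqrt (norm h) ^ 3"
    by (simp add: newt_rem_def algebra_simps)
  finally show ?thesis unfolding eq .
qed

lemma newt_has_derivative: "(newt q has_derivative (\<lambda>h. - (gnewt q x \<bullet> h))) (at x)"
proof (rule has_derivativeI_sandwich[where e = 1 and H = "\<lambda>y. newt_rem * sqrt (norm (y - x))"])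
  show "bounded_linear (\<lambda>h. - (gnewt q x \<bullet> h))"
    by (intro bounded_linear_minus bounded_linear_inner_right)
  fix y assume "y \<noteq> x"
  then have n: "norm (y - x) > 0" by simp
  have "norm (newt q y - newt q x - - (gnewt q x \<bullet> (y - x))) \<le> newt_rem * sqrt (norm (y - x)) ^ 3"
    using newt_expansion[of x "y - x"] by simp
  also have "\<dots> = newt_rem * sqrt (norm (y - x)) * norm (y - x)"
    by (simp add: power3_eq_cube)
  finally show "norm (newt q y - newt q x - - (gnewt q x \<bullet> (y - x))) / norm (y - x) \<le> newt_rem * sqrt (norm (y - x))"
    using n by (simp add: pos_divide_le_eq)
next
  show "((\<lambda>y. newt_rem * sqrt (norm (y - x))) \<longlongrightarrow> 0) (at x)"
    by (auto intro!: tendsto_eq_intros)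
qed simp

text \<open>Expanding the potential at \<open>x + k + h\<close> in two ways, around \<open>x\<close> and around \<open>x + k\<close>,
  compares the two gradients.\<close>
lemma gnewt_holder: "norm (gnewt q (x + k) - gnewt q x) \<le> 5 * newt_rem * sqrt (norm k)"
proof (cases "gnewt q (x + k) - gnewt q x = 0 \<or> k = 0")
  case True
  then show ?thesis using newt_rem_nonneg by auto
next
  case False
  define D where "D = gnewt q (x + k) - gnewt q x"
  have D: "norm D > 0" "norm k > 0" using False by (auto simp: D_def)
  define h where "h = (norm k / norm D) *\<^sub>R D"
  have h: "norm h = norm k" using D by (simp add: h_def)
  have Dh: "D \<bullet> h = norm k * norm D"
    using D by (simp add: h_def dot_square_norm power2_eq_square)
  define s where "s = sqrt (norm k) ^ 3"
  have s0: "s \<ge> 0" by (simp add: s_def)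
  have "norm (k + h) \<le> 2 * norm k" using norm_triangle_ineq[of k h] h by simp
  then have "sqrt (norm (k + h)) \<le> sqrt 2 * sqrt (norm k)" by (simp flip: real_sqrt_mult)
  then have "sqrt (norm (k + h)) ^ 3 \<le> (sqrt 2 * sqrt (norm k)) ^ 3" by (intro power_mono) auto
  also have "\<dots> = 2 * sqrt 2 * s"
  proof -
    have "sqrt 2 ^ 3 = 2 * sqrt (2::real)" by (simp add: power3_eq_cube)
    then show ?thesis by (simp only: power_mult_distrib s_def)
  qed
  also have "\<dots> \<le> 3 * s"
  proof (intro mult_right_mono s0)
    have "sqrt 2 \<le> 3/2" by (rule real_le_lsqrt) (auto simp: power2_eq_square)
    then show "2 * sqrt 2 \<le> 3" by simp
  qed
  finally have kh: "newt_rem * sqrt (norm (k + h)) ^ 3 \<le> newt_rem * (3 * s)"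
    using newt_rem_nonneg by (intro mult_left_mono)
  have e1: "\<bar>newt q (x + (k + h)) - newt q x + gnewt q x \<bullet> (k + h)\<bar> \<le> newt_rem * (3 * s)"
    using newt_expansion[of x "k + h"] kh by linarith
  have e2: "\<bar>newt q (x + k) - newt q x + gnewt q x \<bullet> k\<bar> \<le> newt_rem * s"
    using newt_expansion[of x k] unfolding s_def .
  have e3: "\<bar>newt q (x + k + h) - newt q (x + k) + gnewt q (x + k) \<bullet> h\<bar> \<le> newt_rem * s"
    using newt_expansion[of "x + k" h] unfolding s_def h .
  have "D \<bullet> h = (newt q (x + k + h) - newt q (x + k) + gnewt q (x + k) \<bullet> h)
     + (newt q (x + k) - newt q x + gnewt q x \<bullet> k)
     - (newt q (x + (k + h)) - newt q x + gnewt q x \<bullet> (k + h))"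
    by (simp add: D_def inner_diff_left inner_add_right add.assoc)
  then have "D \<bullet> h \<le> newt_rem * s + newt_rem * s + newt_rem * (3 * s)"
    using e1 e2 e3 by linarith
  then have "norm k * norm D \<le> 5 * newt_rem * s" unfolding Dh by (simp add: mult_ac)
  also have "s = norm k * sqrt (norm k)" by (simp add: s_def power3_eq_cube)
  finally have "norm k * norm D \<le> norm k * (5 * newt_rem * sqrt (norm k))" by (simp add: mult_ac)
  then show ?thesis using D unfolding D_def by (simp only: mult_le_cancel_left_pos)
qed

lemma gnewt_continuous: "continuous_on UNIV (gnewt q)"
proof (rule continuous_at_imp_continuous_on, intro ballI)
  fix x
  have "((\<lambda>y. gnewt q y - gnewt q x) \<longlongrightarrow> 0) (at x)"
  proof (rule Lim_null_comparison)
    show "\<forall>\<^sub>F y in at x. norm (gnewt q y - gnewt q x) \<le> 5 * newt_rem * sqrt (norm (y - x))"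
      using gnewt_holder[of x "y - x" for y] by simp
    show "((\<lambda>y. 5 * newt_rem * sqrt (norm (y - x))) \<longlongrightarrow> 0) (at x)"
      by (auto intro!: tendsto_eq_intros)
  qed
  then show "isCont (gnewt q) x" by (simp add: isCont_def LIM_zero_iff)
qed

lemma newt_tendsto_0: "(newt q \<longlongrightarrow> 0) at_infinity"
proof (rule tendstoI)
  fix \<epsilon> :: real assume \<epsilon>: "\<epsilon> > 0"
  define \<delta> where "\<delta> = sqrt (\<epsilon> / (2 * (B * ball_const + 1)))"
  have pos: "B * ball_const + 1 > 0" using B_nonneg ball_const_pos by (simp add: add_nonneg_pos)
  have \<delta>: "\<delta> > 0" using \<epsilon> pos by (simp add: \<delta>_def)
  have \<delta>2: "B * ball_const * \<delta>\<^sup>2 \<le> \<epsilon> / 2"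
  proof -
    have "B * ball_const * \<delta>\<^sup>2 \<le> (B * ball_const + 1) * \<delta>\<^sup>2" by (simp add: mult_right_mono)
    also have "\<dots> = \<epsilon> / 2"
    proof -
      have d: "\<delta>\<^sup>2 = \<epsilon> / (2 * (B * ball_const + 1))" using \<epsilon> pos unfolding \<delta>_def by simp
      have "c * (\<epsilon> / (2 * c)) = \<epsilon> / 2" if "c > 0" for c :: real using that by simp
      from this[OF pos] show ?thesis unfolding d .
    qed
    finally show ?thesis .
  qed
  define tail where "tail = (\<lambda>n::nat. \<integral>y. \<bar>q y\<bar> * indicator {y. norm y > real n} y \<partial>lborel)"
  have "tail \<longlonglongrightarrow> integral\<^sup>L lborel (\<lambda>y::R3. 0::real)"
    unfolding tail_def
  proof (rule integral_dominated_convergence[where w = "\<lambda>y. \<bar>q y\<bar>"])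
    show "integrable lborel (\<lambda>y. \<bar>q y\<bar>)" using integrable_q by simp
    show "AE y in lborel. (\<lambda>n. \<bar>q y\<bar> * indicator {y. real n < norm y} y) \<longlonglongrightarrow> 0"
    proof (intro AE_I2)
      fix y :: R3
      obtain N where N: "norm y \<le> real N" using real_arch_simple by blast
      have "\<forall>\<^sub>F n in sequentially. \<bar>q y\<bar> * indicator {y. real n < norm y} y = 0"
        using eventually_ge_at_top[of N] by eventually_elim (use N in \<open>auto split: split_indicator\<close>)
      then show "(\<lambda>n. \<bar>q y\<bar> * indicator {y. real n < norm y} y) \<longlonglongrightarrow> 0"
        by (rule tendsto_eventually)
    qed
    show "AE y in lborel. norm (\<bar>q y\<bar> * indicator {y. real n < norm y} y) \<le> \<bar>q y\<bar>" for n
      by (auto split: split_indicator)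
  qed auto
  then have "\<forall>\<^sub>F n in sequentially. dist (tail n) 0 < \<epsilon> * \<delta> / 8"
    using \<epsilon> \<delta> by (intro tendstoD) auto
  then obtain n where n: "\<bar>tail n\<bar> < \<epsilon> * \<delta> / 8"
    unfolding eventually_sequentially by auto
  have bd: "dist (newt q x) 0 < \<epsilon>" if x: "norm x \<ge> real n + 8 * (mass + 1) / \<epsilon> + \<delta>" for x
  proof -
    have m0: "mass \<ge> 0" by simp
    define L where "L = 8 * (mass + 1) / \<epsilon>"
    have L: "L > 0" using \<epsilon> m0 by (simp add: L_def add_nonneg_pos)
    let ?g = "\<lambda>y. B * (norm (x - y) powr (-1) * indicator {y. norm (x - y) \<le> \<delta>} y)
        + (1/\<delta>) * (\<bar>q y\<bar> * indicator {y. norm y > real n} y) + (1/L) * \<bar>q y\<bar>"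
    have nnear: "(\<integral>\<^sup>+y. ennreal (norm (x - y) powr (-1) * indicator {y. norm (x - y) \<le> \<delta>} y) \<partial>lborel) = ennreal (ball_const * \<delta>\<^sup>2 / 2)"
    proof -
      have "(\<integral>\<^sup>+y. ennreal (norm (x - y) powr (-1) * indicator {y. norm (x - y) \<le> \<delta>} y) \<partial>lborel)
        = (\<integral>\<^sup>+y. ennreal (norm (x - y) powr (-1)) * indicator {y. norm (x - y) \<le> \<delta>} y \<partial>lborel)"
        by (intro nn_integral_cong) (auto split: split_indicator)
      also have "\<dots> = ennreal (ball_const * \<delta> powr (3 - 1) / (3 - 1))"
        by (rule nn_integral_powr_ball_shift) (use \<delta> in auto)
      finally show ?thesis using \<delta> by simp
    qed
    have inear: "integrable lborel (\<lambda>y. norm (x - y) powr (-1) * indicator {y. norm (x - y) \<le> \<delta>} y)"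
      by (rule integrableI_nonneg) (use nnear in \<open>auto simp: less_top[symmetric]\<close>)
    have vnear: "(\<integral>y. norm (x - y) powr (-1) * indicator {y. norm (x - y) \<le> \<delta>} y \<partial>lborel) = ball_const * \<delta>\<^sup>2 / 2"
      using nnear ball_const_pos by (subst integral_eq_nn_integral) auto
    have itail: "integrable lborel (\<lambda>y. \<bar>q y\<bar> * indicator {y. norm y > real n} y)"
      using integrable_q by (intro integrable_real_mult_indicator) auto
    have ig: "integrable lborel ?g"
      by (intro Bochner_Integration.integrable_add integrable_mult_right inear itail integrable_abs[OF integrable_q])
    have ia: "integrable lborel (\<lambda>y. \<bar>q y / norm (x - y)\<bar>)"
      by (rule integrable_abs[OF integrable_newt])
    have "\<bar>newt q x\<bar> \<le> (\<integral>y. \<bar>q y / norm (x - y)\<bar> \<partial>lborel)"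
      unfolding newt_def using integral_abs_bound[of lborel "\<lambda>y. q y / norm (x - y)"] by simp
    also have "\<dots> \<le> (\<integral>y. ?g y \<partial>lborel)"
    proof (rule integral_mono[OF ia ig])
      fix y
      have e: "\<bar>q y / norm (x - y)\<bar> = \<bar>q y\<bar> * norm (x - y) powr (-1)" by (simp add: powr_minus_divide abs_divide)
      have nn: "0 \<le> B * (norm (x - y) powr (-1) * indicator {y. norm (x - y) \<le> \<delta>} y)"
         "0 \<le> (1/\<delta>) * (\<bar>q y\<bar> * indicator {y. norm y > real n} y)" "0 \<le> (1/L) * \<bar>q y\<bar>"
        using B_nonneg \<delta> L by auto
      consider "norm (x - y) \<le> \<delta>" | "norm (x - y) > \<delta>" "norm y > real n" | "norm (x - y) > \<delta>" "norm y \<le> real n"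
        by linarith
      then show "\<bar>q y / norm (x - y)\<bar> \<le> ?g y"
      proof cases
        case 1
        have "\<bar>q y / norm (x - y)\<bar> \<le> B * (norm (x - y) powr (-1) * indicator {y. norm (x - y) \<le> \<delta>} y)"
          unfolding e using 1 bound_q[of y] by (simp add: divide_right_mono)
        then show ?thesis using nn by linarith
      next
        case 2
        have "\<bar>q y / norm (x - y)\<bar> \<le> \<bar>q y\<bar> / \<delta>"
          unfolding abs_divide abs_norm_cancel using 2 \<delta> by (intro divide_left_mono mult_pos_pos) auto
        then have "\<bar>q y / norm (x - y)\<bar> \<le> (1/\<delta>) * (\<bar>q y\<bar> * indicator {y. norm y > real n} y)"
          using 2 by simp
        then show ?thesis using nn by linarith
      next
        case 3
        have "norm (x - y) \<ge> L" using 3 x norm_triangle_ineq2[of x y] \<delta> unfolding L_def by linarith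
        then have "\<bar>q y / norm (x - y)\<bar> \<le> \<bar>q y\<bar> / L"
          unfolding abs_divide abs_norm_cancel using L by (intro divide_left_mono mult_pos_pos) auto
        then show ?thesis using nn by simp
      qed
    qed
    also have "\<dots> = B * (ball_const * \<delta>\<^sup>2 / 2) + (1/\<delta>) * tail n + (1/L) * mass"
      unfolding tail_def vnear[symmetric]
      by (subst Bochner_Integration.integral_add[OF Bochner_Integration.integrable_add[OF integrable_mult_right[OF inear]
            integrable_mult_right[OF itail]] integrable_mult_right[OF integrable_abs[OF integrable_q]]])
        (subst Bochner_Integration.integral_add[OF integrable_mult_right[OF inear] integrable_mult_right[OF itail]],
          simp only: integral_mult_right_zero)
    also have "\<dots> < \<epsilon>"
    proof -
      have "B * (ball_const * \<delta>\<^sup>2 / 2) \<le> \<epsilon> / 4" using \<delta>2 by simp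
      moreover have "(1/\<delta>) * tail n \<le> \<epsilon> / 8" using n \<delta> by (simp add: field_simps)
      moreover have "(1/L) * mass \<le> \<epsilon> / 8"
      proof -
        have "mass \<le> \<epsilon> / 8 * L" unfolding L_def using \<epsilon> by simp
        then show ?thesis using L by (simp add: field_simps)
      qed
      ultimately show ?thesis using \<epsilon> by linarith
    qed
    finally show ?thesis by simp
  qed
  then show "\<forall>\<^sub>F x in at_infinity. dist (newt q x) 0 < \<epsilon>"
    unfolding eventually_at_infinity by blast
qed

end

section \<open>Potentials of continuously differentiable densities and the field energy\<close>

lemma measurable_fst_borel[measurable (raw)]:
  "f \<in> borel_measurable M \<Longrightarrow> (\<lambda>x. fst (f x :: 'a::second_countable_topology \<times> 'b::second_countable_topology)) \<in> borel_measurable M"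
  by (rule measurable_compose[of f M borel]) (auto intro!: borel_measurable_continuous_onI continuous_intros)

lemma measurable_snd_borel[measurable (raw)]:
  "f \<in> borel_measurable M \<Longrightarrow> (\<lambda>x. snd (f x :: 'a::second_countable_topology \<times> 'b::second_countable_topology)) \<in> borel_measurable M"
  by (rule measurable_compose[of f M borel]) (auto intro!: borel_measurable_continuous_onI continuous_intros)

lemma nn_integral_lborel_pair:
  fixes F :: "'a::euclidean_space \<times> 'b::euclidean_space \<Rightarrow> ennreal"
  assumes F: "F \<in> borel_measurable borel"
  shows "(\<integral>\<^sup>+z. F z \<partial>lborel) = (\<integral>\<^sup>+x. \<integral>\<^sup>+y. F (x, y) \<partial>lborel \<partial>lborel)"
    and "(\<integral>\<^sup>+z. F z \<partial>lborel) = (\<integral>\<^sup>+y. \<integral>\<^sup>+x. F (x, y) \<partial>lborel \<partial>lborel)"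
proof -
  have m: "F \<in> borel_measurable (lborel \<Otimes>\<^sub>M lborel)" unfolding lborel_prod using F by simp
  show "(\<integral>\<^sup>+z. F z \<partial>lborel) = (\<integral>\<^sup>+x. \<integral>\<^sup>+y. F (x, y) \<partial>lborel \<partial>lborel)"
    using lborel.nn_integral_fst[OF m] by (simp add: lborel_prod)
  show "(\<integral>\<^sup>+z. F z \<partial>lborel) = (\<integral>\<^sup>+y. \<integral>\<^sup>+x. F (x, y) \<partial>lborel \<partial>lborel)"
    using lborel_pair.nn_integral_snd[OF m] by (simp add: lborel_prod)
qed

lemma integral_lborel_pair:
  fixes f :: "'a::euclidean_space \<times> 'b::euclidean_space \<Rightarrow> real"
  assumes f: "integrable lborel f"
  shows "(\<integral>z. f z \<partial>lborel) = (\<integral>x. \<integral>y. f (x, y) \<partial>lborel \<partial>lborel)"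
    and "(\<integral>z. f z \<partial>lborel) = (\<integral>y. \<integral>x. f (x, y) \<partial>lborel \<partial>lborel)"
    and "integrable lborel (\<lambda>x. \<integral>y. f (x, y) \<partial>lborel)"
proof -
  have i: "integrable (lborel \<Otimes>\<^sub>M lborel) f" unfolding lborel_prod using f .
  show "(\<integral>z. f z \<partial>lborel) = (\<integral>x. \<integral>y. f (x, y) \<partial>lborel \<partial>lborel)"
    using lborel_pair.integral_fst'[OF i] by (simp add: lborel_prod)
  have i': "integrable (lborel \<Otimes>\<^sub>M lborel) (case_prod (\<lambda>x y. f (x, y)))" using i by simp
  show "(\<integral>z. f z \<partial>lborel) = (\<integral>y. \<integral>x. f (x, y) \<partial>lborel \<partial>lborel)"
    using lborel_pair.integral_snd[OF i'] by (simp add: lborel_prod)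
  show "integrable lborel (\<lambda>x. \<integral>y. f (x, y) \<partial>lborel)"
    using lborel_pair.integrable_fst'[OF i] by simp
qed

lemma AE_lborel_pair_neq:
  fixes g :: "R3 \<Rightarrow> R3"
  assumes [measurable]: "g \<in> borel_measurable borel"
  shows "AE p in (lborel :: (R3 \<times> R3) measure). snd p \<noteq> g (fst p)"
proof -
  have "{x \<in> space (lborel \<Otimes>\<^sub>M lborel). snd x \<noteq> g (fst x)} \<in> sets (lborel \<Otimes>\<^sub>M lborel :: (R3 \<times> R3) measure)"
    by measurable
  then have "AE p in (lborel \<Otimes>\<^sub>M lborel :: (R3 \<times> R3) measure). snd p \<noteq> g (fst p)"
    by (rule lborel_pair.AE_pair_measure) (simp add: AE_lborel_singleton)
  then show ?thesis unfolding lborel_prod .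
qed

lemma directional_quotient_LIMSEQ:
  fixes f :: "'a::real_normed_vector \<Rightarrow> real"
  assumes f: "(f has_derivative f') (at x)"
  shows "(\<lambda>n. real (Suc n) * (f (x + (1 / real (Suc n)) *\<^sub>R h) - f x)) \<longlonglongrightarrow> f' h"
proof -
  have lin: "linear f'" using f has_derivative_linear by blast
  have "((\<lambda>t. f (x + t *\<^sub>R h)) has_derivative (\<lambda>t. f' (t *\<^sub>R h))) (at 0)"
    by (rule has_derivative_compose[where f = "\<lambda>t. x + t *\<^sub>R h" and f' = "\<lambda>t. t *\<^sub>R h"])
      (auto intro!: derivative_eq_intros f)
  moreover have "(\<lambda>t. f' (t *\<^sub>R h)) = (*) (f' h)"
    using lin by (auto simp: linear_cmul)
  ultimately have "((\<lambda>t. f (x + t *\<^sub>R h)) has_real_derivative f' h) (at 0)"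
    by (simp add: has_field_derivative_def)
  then have "(\<lambda>t. (f (x + t *\<^sub>R h) - f x) / t) \<midarrow>0\<rightarrow> f' h"
    by (simp add: DERIV_def)
  then have "((\<lambda>t. (f (x + t *\<^sub>R h) - f x) / t) \<circ> (\<lambda>n. 1 / real (Suc n))) \<longlonglongrightarrow> f' h"
    unfolding tendsto_at_iff_sequentially using LIMSEQ_inverse_real_of_nat
    by (auto simp: inverse_eq_divide)
  then show ?thesis by (simp add: o_def mult.commute)
qed

lemma integrable_continuous_bounded_support:
  fixes f :: "R3 \<Rightarrow> real"
  assumes c: "continuous_on UNIV f" and supp: "\<And>y. norm y > R \<Longrightarrow> f y = 0"
  shows "integrable lborel f" and "\<exists>B. \<forall>y. \<bar>f y\<bar> \<le> B"
proof -
  have cc: "continuous_on (cball 0 R) f" using c continuous_on_subset by blast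
  have "integrable lborel (\<lambda>x. indicator (cball 0 R) x *\<^sub>R f x)"
    by (rule borel_integrable_compact) (auto simp: cc)
  moreover have "(\<lambda>x. indicator (cball 0 R) x *\<^sub>R f x) = f"
    using supp by (auto simp: fun_eq_iff indicator_def not_le)
  ultimately show "integrable lborel f" by simp
  have "bounded (f ` cball 0 R)"
    by (intro compact_imp_bounded compact_continuous_image cc) simp
  then obtain B where "\<forall>z \<in> f ` cball 0 R. norm z \<le> B"
    unfolding bounded_iff by blast
  then have B: "\<And>y. y \<in> cball 0 R \<Longrightarrow> \<bar>f y\<bar> \<le> B" by auto
  have "\<bar>f y\<bar> \<le> max B 0" for y
    using B[of y] supp[of y] by (cases "norm y \<le> R") (auto simp: le_max_iff_disj)
  then show "\<exists>B. \<forall>y. \<bar>f y\<bar> \<le> B" by blast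
qed

locale C1_compact_density =
  fixes q :: "R3 \<Rightarrow> real" and Dq :: "R3 \<Rightarrow> R3 \<Rightarrow>\<^sub>L real" and R :: real
  assumes Dq: "\<And>x. (q has_derivative blinfun_apply (Dq x)) (at x)"
    and cont_Dq: "continuous_on UNIV Dq"
    and supp_q: "\<And>y. norm y > R \<Longrightarrow> q y = 0"
begin

lemma supp_Dq: "norm y > R \<Longrightarrow> Dq y = 0"
proof -
  assume y: "norm y > R"
  have "open {y::R3. norm y > R}" by (intro open_Collect_less continuous_intros)
  then have "((\<lambda>y. 0) has_derivative blinfun_apply (Dq y)) (at y)"
    using has_derivative_transform_within_open[OF Dq, of "{y. norm y > R}" y "\<lambda>_. 0"] y supp_q by auto
  then have "blinfun_apply (Dq y) = (\<lambda>_. 0)"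
    using has_derivative_const has_derivative_unique by blast
  then show "Dq y = 0" by (intro blinfun_eqI) simp
qed

lemma cont_q: "continuous_on UNIV q"
  by (intro continuous_at_imp_continuous_on ballI has_derivative_continuous[OF Dq])

lemma cont_Dq_dir: "continuous_on UNIV (\<lambda>y. Dq y h)"
  by (intro continuous_intros cont_Dq)

lemma bounded_density_q: "\<exists>B. bounded_density q B"
  using integrable_continuous_bounded_support[OF cont_q supp_q] by (auto simp: bounded_density_def)

lemma bounded_density_Dq: "\<exists>B. bounded_density (\<lambda>y. Dq y h) B"
  using integrable_continuous_bounded_support[OF cont_Dq_dir, of R h] supp_Dq by (auto simp: bounded_density_def)

lemma Dq_bound: "\<exists>L\<ge>0. \<forall>y. norm (Dq y) \<le> L"
proof -
  have "bounded (Dq ` cball 0 R)"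
    by (intro compact_imp_bounded compact_continuous_image continuous_on_subset[OF cont_Dq]) auto
  then obtain L where "\<forall>z \<in> Dq ` cball 0 R. norm z \<le> L"
    unfolding bounded_iff by blast
  then have L: "\<And>y. y \<in> cball 0 R \<Longrightarrow> norm (Dq y) \<le> L" by blast
  have "norm (Dq y) \<le> max L 0" for y
    using L[of y] supp_Dq[of y] by (cases "norm y \<le> R") (auto simp: le_max_iff_disj)
  then show ?thesis by (intro exI[of _ "max L 0"]) auto
qed

lemma gnewt_inner_eq: "gnewt q x \<bullet> h = - newt (\<lambda>y. Dq y h) x"
proof -
  obtain B where "bounded_density q B" using bounded_density_q by blast
  then interpret bounded_density q B .
  obtain L where L: "L \<ge> 0" "\<And>y. norm (Dq y) \<le> L" using Dq_bound by blast
  have lip: "\<bar>q y - q z\<bar> \<le> L * norm (y - z)" for y z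
    using differentiable_bound[of UNIV q "\<lambda>x. blinfun_apply (Dq x)" L y z] Dq L
    by (auto simp: norm_blinfun.rep_eq[symmetric])
  define t where "t = (\<lambda>n. 1 / real (Suc n))"
  have t: "0 < t n" "t n \<le> 1" "real (Suc n) * t n = 1" for n by (auto simp: t_def)
  have lim1: "(\<lambda>n. real (Suc n) * (newt q (x + t n *\<^sub>R h) - newt q x)) \<longlonglongrightarrow> - (gnewt q x \<bullet> h)"
    unfolding t_def by (rule directional_quotient_LIMSEQ[OF newt_has_derivative])
  have shift: "newt q (x + p) = (\<integral>y. q (p + y) / norm (x - y) \<partial>lborel)" for p
    using lebesgue_integral_similarity[OF orthogonal_transformation_id zero_less_one, of "\<lambda>y. q y / norm (x + p - y)" p]
    by (simp add: newt_def algebra_simps)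
  have ishift: "integrable lborel (\<lambda>y. q (p + y) / norm (x - y))" for p
    using integrable_similarity[OF orthogonal_transformation_id zero_less_one integrable_newt[of "x + p"], of p]
    by (simp add: algebra_simps)
  have eq: "real (Suc n) * (newt q (x + t n *\<^sub>R h) - newt q x)
      = (\<integral>y. (real (Suc n) * (q (y + t n *\<^sub>R h) - q y)) / norm (x - y) \<partial>lborel)" for n
  proof -
    have "newt q (x + t n *\<^sub>R h) - newt q x = (\<integral>y. q (t n *\<^sub>R h + y) / norm (x - y) - q y / norm (x - y) \<partial>lborel)"
      unfolding shift by (subst Bochner_Integration.integral_diff[OF ishift integrable_newt]) (simp add: newt_def)
    then show ?thesis
      by (simp only: integral_mult_right_zero[symmetric]) (simp add: diff_divide_distrib right_diff_distrib add.commute)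
  qed
  define W where "W = (\<lambda>y::R3. L * norm h * indicator (cball 0 (R + norm h)) y :: real)"
  have "bounded_density W (L * norm h)"
  proof
    show "integrable lborel W" unfolding W_def
      by (intro integrable_mult_right integrable_real_indicator) (use emeasure_lborel_cball_finite[of "0::R3" "R + norm h"] in auto)
    show "\<bar>W y\<bar> \<le> L * norm h" for y using L by (auto simp: W_def split: split_indicator)
  qed
  then have iW: "integrable lborel (\<lambda>y. W y / norm (x - y))" by (rule bounded_density.integrable_newt)
  have mq[measurable]: "q \<in> borel_measurable borel" by (rule measurable_q)
  have mD[measurable]: "(\<lambda>y. Dq y h) \<in> borel_measurable borel"
    by (rule borel_measurable_continuous_onI[OF cont_Dq_dir])
  have "(\<lambda>n. \<integral>y. (real (Suc n) * (q (y + t n *\<^sub>R h) - q y)) / norm (x - y) \<partial>lborel) \<longlonglongrightarrow>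
      (\<integral>y. Dq y h / norm (x - y) \<partial>lborel)"
  proof (rule integral_dominated_convergence[OF _ _ iW])
    show "AE y in lborel. (\<lambda>n. (real (Suc n) * (q (y + t n *\<^sub>R h) - q y)) / norm (x - y)) \<longlonglongrightarrow> Dq y h / norm (x - y)"
      unfolding t_def divide_inverse[of _ "norm (x - _)"]
      by (intro AE_I2 tendsto_mult_right directional_quotient_LIMSEQ Dq)
    show "AE y in lborel. norm ((real (Suc n) * (q (y + t n *\<^sub>R h) - q y)) / norm (x - y)) \<le> W y / norm (x - y)" for n
    proof (intro AE_I2)
      fix y
      have "\<bar>real (Suc n) * (q (y + t n *\<^sub>R h) - q y)\<bar> \<le> W y"
      proof (cases "norm y \<le> R + norm h")
        case True
        have "\<bar>real (Suc n) * (q (y + t n *\<^sub>R h) - q y)\<bar> = real (Suc n) * \<bar>q (y + t n *\<^sub>R h) - q y\<bar>"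
          by (simp add: abs_mult)
        also have "\<dots> \<le> real (Suc n) * (L * norm (y + t n *\<^sub>R h - y))"
          by (intro mult_left_mono lip) auto
        also have "\<dots> = (real (Suc n) * t n) * (L * norm h)" using t(1)[of n] by simp
        also have "\<dots> = W y" unfolding t(3) using True by (simp add: W_def)
        finally show ?thesis .
      next
        case False
        have "norm (t n *\<^sub>R h) \<le> norm h" using t[of n] by (simp add: mult_left_le_one_le)
        then have "norm (y + t n *\<^sub>R h) > R" using False norm_triangle_ineq4[of "y + t n *\<^sub>R h" "t n *\<^sub>R h"] by simp
        moreover have "norm y > R" using False norm_ge_zero[of h] by linarith
        ultimately show ?thesis using supp_q L by (simp add: W_def)
      qed
      then show "norm ((real (Suc n) * (q (y + t n *\<^sub>R h) - q y)) / norm (x - y)) \<le> W y / norm (x - y)"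
        by (simp only: real_norm_def abs_divide abs_norm_cancel) (rule divide_right_mono, auto)
    qed
  qed measurable
  then have "(\<lambda>n. real (Suc n) * (newt q (x + t n *\<^sub>R h) - newt q x)) \<longlonglongrightarrow> newt (\<lambda>y. Dq y h) x"
    unfolding eq unfolding newt_def .
  from LIMSEQ_unique[OF lim1 this] show ?thesis by simp
qed

end

definition force_kernel :: "R3 \<Rightarrow> R3 \<Rightarrow> R3" where
  "force_kernel x y = (1 / norm (x - y) ^ 3) *\<^sub>R (x - y)"

lemma measurable_force_kernel[measurable]:
  "(\<lambda>p. force_kernel (f p) (g p)) \<in> borel_measurable M"
  if [measurable]: "f \<in> borel_measurable M" "g \<in> borel_measurable M"
  unfolding force_kernel_def by measurable

lemma norm_force_kernel: "norm (force_kernel x y) = norm (x - y) powr (-2)"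
  by (cases "x = y") (simp_all add: force_kernel_def powr_minus_divide power3_eq_cube power2_eq_square)

lemma inner_force_kernel_bound:
  "\<bar>force_kernel x y \<bullet> force_kernel x z\<bar> \<le> norm (x - y) powr (-2) * norm (x - z) powr (-2)"
  using Cauchy_Schwarz_ineq2[of "force_kernel x y" "force_kernel x z"] by (simp only: norm_force_kernel)

definition energy_const :: real where
  "energy_const = (\<integral>x. force_kernel x 0 \<bullet> force_kernel x (axis 1 1) \<partial>lborel)"

lemma force_kernel_similarity:
  assumes A: "orthogonal_transformation A" and d: "d > 0"
  shows "force_kernel (p + d *\<^sub>R A x) (p + d *\<^sub>R A y) = (1 / d\<^sup>2) *\<^sub>R A (force_kernel x y)"
proof -
  have lin: "linear A" using A by (rule orthogonal_transformation_linear)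
  have "p + d *\<^sub>R A x - (p + d *\<^sub>R A y) = d *\<^sub>R A (x - y)"
    by (simp add: linear_diff[OF lin] scaleR_diff_right)
  moreover have "norm (A (x - y)) = norm (x - y)" using A by (simp add: orthogonal_transformation)
  ultimately show ?thesis
    unfolding force_kernel_def using d
    by (simp add: linear_cmul[OF lin] power_mult_distrib) (simp add: field_simps eval_nat_numeral)
qed

lemma integral_force_kernel:
  assumes "y \<noteq> z"
  shows "(\<integral>x. force_kernel x y \<bullet> force_kernel x z \<partial>lborel) = energy_const / norm (y - z)"
proof -
  define d where "d = norm (z - y)"
  have d: "d > 0" using assms by (simp add: d_def)
  have "norm (axis 1 1 :: R3) = norm ((1/d) *\<^sub>R (z - y))" using d by (simp add: d_def)
  then obtain A where A: "orthogonal_transformation A" "A (axis 1 1 :: R3) = (1/d) *\<^sub>R (z - y)"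
    using orthogonal_transformation_exists by metis
  have lin: "linear A" using A by (simp add: orthogonal_transformation_linear)
  have y: "y + d *\<^sub>R A 0 = y" using linear_0[OF lin] by simp
  have z: "y + d *\<^sub>R A (axis 1 1) = z" using A d by simp
  have "(\<integral>x. force_kernel x y \<bullet> force_kernel x z \<partial>lborel)
     = d ^ 3 * (\<integral>x. force_kernel (y + d *\<^sub>R A x) y \<bullet> force_kernel (y + d *\<^sub>R A x) z \<partial>lborel)"
    by (rule lebesgue_integral_similarity[OF A(1) d]) measurable
  also have "\<dots> = d ^ 3 * (\<integral>x. force_kernel (y + d *\<^sub>R A x) (y + d *\<^sub>R A 0) \<bullet> force_kernel (y + d *\<^sub>R A x) (y + d *\<^sub>R A (axis 1 1)) \<partial>lborel)"
    unfolding y z ..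
  also have "\<dots> = d ^ 3 * (\<integral>x. (1 / d\<^sup>2 * (1 / d\<^sup>2)) * (force_kernel x 0 \<bullet> force_kernel x (axis 1 1)) \<partial>lborel)"
    using A(1) by (simp add: force_kernel_similarity[OF A(1) d] orthogonal_transformation_def mult.assoc)
  also have "\<dots> = d ^ 3 * ((1 / d\<^sup>2 * (1 / d\<^sup>2)) * energy_const)"
    by (simp only: integral_mult_right_zero energy_const_def)
  also have "\<dots> = energy_const / d" using d by (simp add: field_simps eval_nat_numeral)
  finally show ?thesis by (simp add: d_def norm_minus_commute)
qed

definition coulomb :: "(R3 \<Rightarrow> real) \<Rightarrow> real" where
  "coulomb q = (\<integral>p. q (fst p) * q (snd p) / norm (fst p - snd p) \<partial>(lborel :: (R3 \<times> R3) measure))"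

context bounded_density
begin

lemma nn_coulomb_finite:
  "(\<integral>\<^sup>+p. ennreal (\<bar>q (fst p)\<bar> * (\<bar>q (snd p)\<bar> * norm (fst p - snd p) powr (-1))) \<partial>lborel) < \<infinity>"
proof -
  have mass: "(\<integral>\<^sup>+y. ennreal \<bar>q y\<bar> \<partial>lborel) = ennreal mass"
    using integrable_q by (intro nn_integral_eq_integral) auto
  let ?K = "ennreal (B * ball_const / (3 - 1)) + ennreal mass"
  have "(\<integral>\<^sup>+p. ennreal (\<bar>q (fst p)\<bar> * (\<bar>q (snd p)\<bar> * norm (fst p - snd p) powr (-1))) \<partial>lborel)
    = (\<integral>\<^sup>+y. \<integral>\<^sup>+z. ennreal (\<bar>q y\<bar> * (\<bar>q z\<bar> * norm (y - z) powr (-1))) \<partial>lborel \<partial>lborel)"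
    by (subst nn_integral_lborel_pair(1)) auto
  also have "\<dots> = (\<integral>\<^sup>+y. ennreal \<bar>q y\<bar> * (\<integral>\<^sup>+z. ennreal (\<bar>q z\<bar> * norm (y - z) powr (-1)) \<partial>lborel) \<partial>lborel)"
    by (subst nn_integral_cmult[symmetric], measurable, simp only: ennreal_mult' abs_ge_zero)
  also have "\<dots> \<le> (\<integral>\<^sup>+y. ennreal \<bar>q y\<bar> * ?K \<partial>lborel)"
    using nn_riesz_bound[of q B 1, OF measurable_q bound_q] unfolding mass
    by (intro nn_integral_mono mult_left_mono) auto
  also have "\<dots> = ennreal mass * ?K"
    by (subst nn_integral_multc) (auto simp: mass)
  also have "\<dots> < \<infinity>" by (simp add: ennreal_mult_less_top)
  finally show ?thesis .
qed

lemma coulomb_integrable: "integrable lborel (\<lambda>p. q (fst p) * q (snd p) / norm (fst p - snd p))"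
proof (rule integrableI_bounded)
  have "(\<integral>\<^sup>+p. ennreal (norm (q (fst p) * q (snd p) / norm (fst p - snd p))) \<partial>lborel) =
    (\<integral>\<^sup>+p. ennreal (\<bar>q (fst p)\<bar> * (\<bar>q (snd p)\<bar> * norm (fst p - snd p) powr (-1))) \<partial>lborel)"
    by (simp add: abs_mult powr_minus_divide)
  then show "(\<integral>\<^sup>+p. ennreal (norm (q (fst p) * q (snd p) / norm (fst p - snd p))) \<partial>lborel) < \<infinity>"
    using nn_coulomb_finite by simp
qed measurable

lemma gnewt_eq_force: "gnewt q x = (\<integral>y. q y *\<^sub>R force_kernel x y \<partial>lborel)"
  "integrable lborel (\<lambda>y. q y *\<^sub>R force_kernel x y)"
  using integrable_gnewt[of x] by (simp_all add: gnewt_def force_kernel_def)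

lemma square_gnewt_eq:
  "(\<integral>p. q (fst p) * q (snd p) * (force_kernel x (fst p) \<bullet> force_kernel x (snd p)) \<partial>lborel) = (norm (gnewt q x))\<^sup>2"
proof -
  let ?F = "\<lambda>p. q (fst p) * q (snd p) * (force_kernel x (fst p) \<bullet> force_kernel x (snd p))"
  let ?k = "\<lambda>y. \<bar>q y\<bar> * norm (x - y) powr (-2)"
  have "integrable lborel ?F"
  proof (rule integrableI_bounded)
    have "(\<integral>\<^sup>+p. ennreal (norm (?F p)) \<partial>lborel) \<le> (\<integral>\<^sup>+p. ennreal (?k (fst p)) * ennreal (?k (snd p)) \<partial>lborel)"
    proof (intro nn_integral_mono)
      fix p :: "R3 \<times> R3"
      have "norm (?F p) = (\<bar>q (fst p)\<bar> * \<bar>q (snd p)\<bar>) * \<bar>force_kernel x (fst p) \<bullet> force_kernel x (snd p)\<bar>"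
        by (simp add: abs_mult)
      also have "\<dots> \<le> (\<bar>q (fst p)\<bar> * \<bar>q (snd p)\<bar>) * (norm (x - fst p) powr (-2) * norm (x - snd p) powr (-2))"
        by (intro mult_left_mono inner_force_kernel_bound) auto
      also have "\<dots> = ?k (fst p) * ?k (snd p)" by (simp only: mult_ac)
      finally show "ennreal (norm (?F p)) \<le> ennreal (?k (fst p)) * ennreal (?k (snd p))"
        by (subst ennreal_mult'[symmetric]) (auto intro!: ennreal_leI)
    qed
    also have "\<dots> = (\<integral>\<^sup>+y. \<integral>\<^sup>+z. ennreal (?k y) * ennreal (?k z) \<partial>lborel \<partial>lborel)"
      by (subst nn_integral_lborel_pair(1)) auto
    also have "\<dots> = (\<integral>\<^sup>+y. ennreal (?k y) \<partial>lborel) * (\<integral>\<^sup>+z. ennreal (?k z) \<partial>lborel)"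
      by (subst nn_integral_cmult, simp, subst nn_integral_multc, auto)
    also have "\<dots> < \<infinity>"
    proof -
      have "(\<integral>\<^sup>+y. ennreal (?k y) \<partial>lborel) = ennreal (\<integral>y. ?k y \<partial>lborel)"
        using integrable_abs_powr[of 2 x] by (intro nn_integral_eq_integral) auto
      then show ?thesis by (simp add: ennreal_mult_less_top)
    qed
    finally show "(\<integral>\<^sup>+p. ennreal (norm (?F p)) \<partial>lborel) < \<infinity>" .
  qed measurable
  then have "(\<integral>p. ?F p \<partial>lborel) = (\<integral>y. \<integral>z. q y * q z * (force_kernel x y \<bullet> force_kernel x z) \<partial>lborel \<partial>lborel)"
    by (subst integral_lborel_pair(1)) auto
  also have "\<dots> = (\<integral>y. \<integral>z. (q y *\<^sub>R force_kernel x y) \<bullet> (q z *\<^sub>R force_kernel x z) \<partial>lborel \<partial>lborel)"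
    by (simp add: mult_ac)
  also have "\<dots> = (\<integral>y. (q y *\<^sub>R force_kernel x y) \<bullet> gnewt q x \<partial>lborel)"
    unfolding gnewt_eq_force(1) by (subst integral_inner_right[OF gnewt_eq_force(2)]) (rule refl)
  also have "\<dots> = gnewt q x \<bullet> gnewt q x"
    using gnewt_eq_force[of x] integral_inner_left[OF gnewt_eq_force(2), of x "gnewt q x"] by simp
  finally show ?thesis by (simp add: power2_norm_eq_inner)
qed

lemma energy_integrable: "integrable lborel (\<lambda>x. (norm (gnewt q x))\<^sup>2)"
  and energy_identity: "(\<integral>x. (norm (gnewt q x))\<^sup>2 \<partial>lborel) = energy_const * coulomb q"
proof -
  let ?c = "\<lambda>p. ennreal (\<bar>q (fst p)\<bar> * (\<bar>q (snd p)\<bar> * norm (fst p - snd p) powr (-1)))"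
  let ?F = "\<lambda>(x, p). q (fst p) * q (snd p) * (force_kernel x (fst p) \<bullet> force_kernel x (snd p))"
  have AEne: "AE p in (lborel :: (R3 \<times> R3) measure). snd p \<noteq> fst p"
    using AE_lborel_pair_neq[of "\<lambda>x. x"] by simp
  have mF[measurable]: "?F \<in> borel_measurable borel" unfolding split_beta by measurable
  have int: "integrable lborel ?F"
  proof (rule integrableI_bounded)
    have "(\<integral>\<^sup>+z. ennreal (norm (?F z)) \<partial>lborel) = (\<integral>\<^sup>+p. \<integral>\<^sup>+x. ennreal (norm (?F (x, p))) \<partial>lborel \<partial>lborel)"
      by (rule nn_integral_lborel_pair(2)) measurable
    also have "\<dots> \<le> (\<integral>\<^sup>+p. ennreal (8 * ball_const) * ?c p \<partial>lborel)"
    proof (rule nn_integral_mono_AE, rule AE_mp[OF AEne], intro AE_I2 impI)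
      fix p :: "R3 \<times> R3" assume ne: "snd p \<noteq> fst p"
      obtain y z where p: "p = (y, z)" by (cases p)
      have "(\<integral>\<^sup>+x. ennreal (norm (?F (x, p))) \<partial>lborel)
        \<le> (\<integral>\<^sup>+x. ennreal (\<bar>q y\<bar> * \<bar>q z\<bar>) * ennreal (norm (y - x) powr (-2) * norm (z - x) powr (-2)) \<partial>lborel)"
      proof (intro nn_integral_mono)
        fix x
        have "norm (?F (x, p)) = (\<bar>q y\<bar> * \<bar>q z\<bar>) * \<bar>force_kernel x y \<bullet> force_kernel x z\<bar>"
          by (simp add: abs_mult p)
        also have "\<dots> \<le> (\<bar>q y\<bar> * \<bar>q z\<bar>) * (norm (x - y) powr (-2) * norm (x - z) powr (-2))"
          by (intro mult_left_mono inner_force_kernel_bound) auto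
        finally show "ennreal (norm (?F (x, p))) \<le> ennreal (\<bar>q y\<bar> * \<bar>q z\<bar>) * ennreal (norm (y - x) powr (-2) * norm (z - x) powr (-2))"
          unfolding norm_minus_commute[of x]
          by (subst ennreal_mult'[symmetric]) (auto intro!: ennreal_leI)
      qed
      also have "\<dots> = ennreal (\<bar>q y\<bar> * \<bar>q z\<bar>) * (\<integral>\<^sup>+x. ennreal (norm (y - x) powr (-2) * norm (z - x) powr (-2)) \<partial>lborel)"
        by (rule nn_integral_cmult) measurable
      also have "\<dots> \<le> ennreal (\<bar>q y\<bar> * \<bar>q z\<bar>) * ennreal (8 * ball_const / norm (y - z))"
        using ne p by (intro mult_left_mono kernel_convolution_bound) auto
      also have "\<dots> = ennreal (8 * ball_const) * ennreal (\<bar>q y\<bar> * (\<bar>q z\<bar> * norm (y - z) powr (-1)))"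
        using ball_const_pos by (simp add: ennreal_mult'[symmetric] powr_minus_divide mult_ac)
      finally show "(\<integral>\<^sup>+x. ennreal (norm (?F (x, p))) \<partial>lborel) \<le>
        ennreal (8 * ball_const) * ?c p"
        by (simp add: p)
    qed
    also have "\<dots> = ennreal (8 * ball_const) * (\<integral>\<^sup>+p. ?c p \<partial>lborel)"
      by (rule nn_integral_cmult) measurable
    also have "\<dots> < \<infinity>" using nn_coulomb_finite by (simp add: ennreal_mult_less_top)
    finally show "(\<integral>\<^sup>+z. ennreal (norm (?F z)) \<partial>lborel) < \<infinity>" .
  qed (use mF in simp)
  have inner: "(\<integral>p. ?F (x, p) \<partial>lborel) = (norm (gnewt q x))\<^sup>2" for x
    using square_gnewt_eq[of x] by simp
  show "integrable lborel (\<lambda>x. (norm (gnewt q x))\<^sup>2)"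
    using integral_lborel_pair(3)[OF int] unfolding inner .
  have "(\<integral>x. (norm (gnewt q x))\<^sup>2 \<partial>lborel) = (\<integral>z. ?F z \<partial>lborel)"
    using integral_lborel_pair(1)[OF int] unfolding inner by simp
  also have "\<dots> = (\<integral>p. \<integral>x. ?F (x, p) \<partial>lborel \<partial>lborel)"
    by (rule integral_lborel_pair(2)[OF int])
  also have "\<dots> = (\<integral>p. energy_const * (q (fst p) * q (snd p) / norm (fst p - snd p)) \<partial>lborel)"
  proof (rule integral_cong_AE)
    show "AE p in lborel. (\<integral>x. ?F (x, p) \<partial>lborel) = energy_const * (q (fst p) * q (snd p) / norm (fst p - snd p))"
      by (rule AE_mp[OF AEne], intro AE_I2 impI) (auto simp: integral_force_kernel)
  qed measurable
  also have "\<dots> = energy_const * coulomb q" unfolding coulomb_def by (rule integral_mult_right_zero)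
  finally show "(\<integral>x. (norm (gnewt q x))\<^sup>2 \<partial>lborel) = energy_const * coulomb q" .
qed

end

section \<open>Reflections and polarization\<close>

lemma distr_lborel_eqI:
  fixes T :: "'a::euclidean_space \<Rightarrow> 'a"
  assumes [measurable]: "T \<in> borel_measurable borel"
    and eq: "\<And>X. X \<in> sets borel \<Longrightarrow> (\<integral>\<^sup>+z. indicator X (T z) \<partial>lborel) = emeasure lborel X"
  shows "distr lborel borel T = lborel"
proof (rule measure_eqI)
  fix X assume "X \<in> sets (distr lborel borel T)"
  then have [measurable]: "X \<in> sets borel" by simp
  have "emeasure (distr lborel borel T) X = integral\<^sup>N (distr lborel borel T) (indicator X)"
    by simp
  also have "\<dots> = (\<integral>\<^sup>+z. indicator X (T z) \<partial>lborel)"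
    by (rule nn_integral_distr) measurable
  finally show "emeasure (distr lborel borel T) X = emeasure lborel X" using eq by simp
qed simp

lemma distr_lborel_pair:
  fixes \<sigma> :: "'a::euclidean_space \<Rightarrow> 'a"
  assumes m[measurable]: "\<sigma> \<in> borel_measurable borel" and \<sigma>: "distr lborel borel \<sigma> = lborel"
  shows "distr lborel borel (\<lambda>p. (\<sigma> (fst p), snd p :: 'b::euclidean_space)) = lborel"
    and "distr lborel borel (\<lambda>p. (fst p :: 'b, \<sigma> (snd p))) = lborel"
proof -
  have inv: "(\<integral>\<^sup>+x. G (\<sigma> x) \<partial>lborel) = (\<integral>\<^sup>+x. G x \<partial>lborel)" if [measurable]: "G \<in> borel_measurable borel" for G :: "'a \<Rightarrow> ennreal"
  proof -
    have "(\<integral>\<^sup>+x. G x \<partial>lborel) = integral\<^sup>N (distr lborel borel \<sigma>) G" by (simp only: \<sigma>)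
    also have "\<dots> = (\<integral>\<^sup>+x. G (\<sigma> x) \<partial>lborel)" by (rule nn_integral_distr) measurable
    finally show ?thesis by simp
  qed
  show "distr lborel borel (\<lambda>p. (\<sigma> (fst p), snd p :: 'b::euclidean_space)) = lborel"
  proof (rule distr_lborel_eqI)
    fix X :: "('a \<times> 'b) set" assume [measurable]: "X \<in> sets borel"
    have "(\<integral>\<^sup>+z. indicator X (\<sigma> (fst z), snd z) \<partial>lborel) = (\<integral>\<^sup>+y. \<integral>\<^sup>+x. indicator X (\<sigma> x, y) \<partial>lborel \<partial>lborel)"
      by (subst nn_integral_lborel_pair(2)) auto
    also have "\<dots> = (\<integral>\<^sup>+y. \<integral>\<^sup>+x. indicator X (x, y) \<partial>lborel \<partial>lborel)"
      by (intro nn_integral_cong inv) measurable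
    also have "\<dots> = (\<integral>\<^sup>+z. indicator X z \<partial>lborel)"
      by (subst nn_integral_lborel_pair(2)) auto
    finally show "(\<integral>\<^sup>+z. indicator X (\<sigma> (fst z), snd z) \<partial>lborel) = emeasure lborel X" by simp
  qed measurable
  show "distr lborel borel (\<lambda>p. (fst p :: 'b, \<sigma> (snd p))) = lborel"
  proof (rule distr_lborel_eqI)
    fix X :: "('b \<times> 'a) set" assume [measurable]: "X \<in> sets borel"
    have "(\<integral>\<^sup>+z. indicator X (fst z, \<sigma> (snd z)) \<partial>lborel) = (\<integral>\<^sup>+x. \<integral>\<^sup>+y. indicator X (x, \<sigma> y) \<partial>lborel \<partial>lborel)"
      by (subst nn_integral_lborel_pair(1)) auto
    also have "\<dots> = (\<integral>\<^sup>+x. \<integral>\<^sup>+y. indicator X (x, y) \<partial>lborel \<partial>lborel)"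
      by (intro nn_integral_cong inv) measurable
    also have "\<dots> = (\<integral>\<^sup>+z. indicator X z \<partial>lborel)"
      by (subst nn_integral_lborel_pair(1)) auto
    finally show "(\<integral>\<^sup>+z. indicator X (fst z, \<sigma> (snd z)) \<partial>lborel) = emeasure lborel X" by simp
  qed measurable
qed

lemma
  fixes f :: "'a::euclidean_space \<Rightarrow> real"
  assumes T: "distr lborel borel T = lborel" and m[measurable]: "T \<in> borel_measurable borel"
    and f: "integrable lborel f"
  shows integrable_measure_preserving: "integrable lborel (\<lambda>x. f (T x))"
    and integral_measure_preserving: "(\<integral>x. f (T x) \<partial>lborel) = (\<integral>x. f x \<partial>lborel)"
proof -
  have [measurable]: "f \<in> borel_measurable borel" using f by auto
  have "integrable (distr lborel borel T) f" using f by (simp only: T)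
  then show "integrable lborel (\<lambda>x. f (T x))" by (subst (asm) integrable_distr_eq) auto
  have "(\<integral>x. f x \<partial>lborel) = integral\<^sup>L (distr lborel borel T) f" by (simp only: T)
  also have "\<dots> = (\<integral>x. f (T x) \<partial>lborel)" by (rule integral_distr) auto
  finally show "(\<integral>x. f (T x) \<partial>lborel) = (\<integral>x. f x \<partial>lborel)" by simp
qed

locale reflection =
  fixes p n :: R3
  assumes unit_n: "norm n = 1"
begin

definition \<sigma> :: "R3 \<Rightarrow> R3" where "\<sigma> x = x - (2 * ((x - p) \<bullet> n)) *\<^sub>R n"

definition side :: "R3 \<Rightarrow> real" where "side x = (x - p) \<bullet> n"

lemma nn1: "n \<bullet> n = 1" using unit_n by (simp add: dot_square_norm)

lemma \<sigma>_side: "\<sigma> x = x - (2 * side x) *\<^sub>R n"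
  by (simp add: \<sigma>_def side_def)

lemma side_\<sigma>: "side (\<sigma> x) = - side x"
  by (simp add: \<sigma>_def side_def inner_diff_left nn1 algebra_simps)

lemma \<sigma>_\<sigma>: "\<sigma> (\<sigma> x) = x"
  by (simp add: \<sigma>_side[of "\<sigma> x"] side_\<sigma>) (simp add: \<sigma>_side)

lemma \<sigma>_fixed: "side x = 0 \<Longrightarrow> \<sigma> x = x" by (simp add: \<sigma>_side)

lemma dist_sq_\<sigma>: "(norm (y - \<sigma> z))\<^sup>2 = (norm (y - z))\<^sup>2 + 4 * side y * side z"
proof -
  have sq: "(norm (w + t *\<^sub>R n))\<^sup>2 = (norm w)\<^sup>2 + 2 * t * (w \<bullet> n) + t\<^sup>2" for w t
    unfolding power2_norm_eq_inner
    by (simp add: inner_add_left inner_add_right nn1 inner_commute[of n w] power2_eq_square distrib_left)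
  have e: "y - \<sigma> z = (y - z) + (2 * side z) *\<^sub>R n" by (simp add: \<sigma>_side)
  have d: "(y - z) \<bullet> n = side y - side z" by (simp add: side_def inner_diff_left)
  show ?thesis unfolding e sq d by (simp add: algebra_simps power2_eq_square)
qed

lemma norm_\<sigma>_\<sigma>: "norm (\<sigma> y - \<sigma> z) = norm (y - z)"
proof -
  have "(norm (\<sigma> y - \<sigma> z))\<^sup>2 = (norm (\<sigma> y - z))\<^sup>2 + 4 * side (\<sigma> y) * side z" by (rule dist_sq_\<sigma>)
  also have "(norm (\<sigma> y - z))\<^sup>2 = (norm (z - \<sigma> y))\<^sup>2" by (simp add: norm_minus_commute)
  also have "\<dots> = (norm (z - y))\<^sup>2 + 4 * side z * side y" by (rule dist_sq_\<sigma>)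
  finally have "(norm (\<sigma> y - \<sigma> z))\<^sup>2 = (norm (y - z))\<^sup>2"
    by (simp add: side_\<sigma> norm_minus_commute)
  then show ?thesis by (rule power2_eq_imp_eq) auto
qed

lemma norm_\<sigma>_left: "norm (\<sigma> y - z) = norm (y - \<sigma> z)"
  using norm_\<sigma>_\<sigma>[of "\<sigma> y" z] by (simp add: \<sigma>_\<sigma>)

lemma \<sigma>_continuous: "continuous_on S \<sigma>"
  unfolding \<sigma>_def by (intro continuous_intros)

lemma side_continuous: "continuous_on S side"
  unfolding side_def by (intro continuous_intros)

lemma \<sigma>_measurable[measurable]: "\<sigma> \<in> borel_measurable borel"
  by (rule borel_measurable_continuous_onI[OF \<sigma>_continuous])

lemma side_measurable[measurable]: "side \<in> borel_measurable borel"
  by (rule borel_measurable_continuous_onI[OF side_continuous])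

lemma distr_\<sigma>: "distr lborel borel \<sigma> = lborel"
proof -
  define A where "A x = x - (2 * (x \<bullet> n)) *\<^sub>R n" for x
  have l: "linear A" unfolding A_def by (rule linearI) (auto simp: inner_add_left algebra_simps)
  have iso: "A v \<bullet> A w = v \<bullet> w" for v w
    by (simp add: A_def inner_diff_left inner_diff_right nn1 inner_commute[of n w])
  have A: "orthogonal_transformation A"
    unfolding orthogonal_transformation_def by (rule conjI[OF l allI[OF allI[OF iso]]])
  have e: "\<sigma> = (\<lambda>x. (2 * (p \<bullet> n)) *\<^sub>R n + 1 *\<^sub>R A x)"
    by (auto simp: fun_eq_iff \<sigma>_def A_def inner_diff_left algebra_simps)
  show ?thesis
    using lborel_similarity[OF A zero_less_one, of "(2 * (p \<bullet> n)) *\<^sub>R n"] unfolding e[symmetric]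
    by (simp add: density_1)
qed

definition polarize :: "(R3 \<Rightarrow> real) \<Rightarrow> R3 \<Rightarrow> real" where
  "polarize r x = (if side x > 0 then max (r x) (r (\<sigma> x)) else min (r x) (r (\<sigma> x)))"

lemma polarize_measurable[measurable]:
  assumes [measurable]: "r \<in> borel_measurable borel"
  shows "polarize r \<in> borel_measurable borel"
  unfolding polarize_def by measurable

lemma polarize_pair: "side y > 0 \<Longrightarrow> polarize r y = max (r y) (r (\<sigma> y))"
  "side y > 0 \<Longrightarrow> polarize r (\<sigma> y) = min (r y) (r (\<sigma> y))"
  "side y < 0 \<Longrightarrow> polarize r y = min (r y) (r (\<sigma> y))"
  "side y < 0 \<Longrightarrow> polarize r (\<sigma> y) = max (r y) (r (\<sigma> y))"
  "side y = 0 \<Longrightarrow> polarize r y = r y"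
  by (auto simp: polarize_def side_\<sigma> \<sigma>_\<sigma> \<sigma>_fixed min.commute max.commute)

lemma polarize_apply_sum: "F (polarize r y) + F (polarize r (\<sigma> y)) = F (r y) + F (r (\<sigma> y))"
  for F :: "real \<Rightarrow> 'c::ab_semigroup_add"
proof (cases "side y" "0::real" rule: linorder_cases)
  case equal
  then show ?thesis by (simp add: polarize_pair \<sigma>_fixed)
qed (auto simp: polarize_pair max_def min_def add.commute)

lemma polarize_sum: "polarize r y + polarize r (\<sigma> y) = r y + r (\<sigma> y)"
  using polarize_apply_sum[of "\<lambda>t. t"] .

text \<open>After symmetrizing over the reflections of either variable, the gain in Coulomb energy is
  the nonnegative kernel difference times the excess \<open>|\<delta> y| |\<delta> z| - \<delta> y \<delta> z\<close>, where
  \<open>\<delta> = r - r \<circ> \<sigma>\<close>. Without gain the excess vanishes almost everywhere.\<close>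
lemma polarization_rigidity:
  assumes r: "bounded_density r B" and cont: "continuous_on UNIV r"
    and pr: "bounded_density (polarize r) B'"
    and le: "coulomb (polarize r) \<le> coulomb r"
    and y0: "side y0 > 0" and z0: "side z0 > 0"
  shows "0 \<le> (r y0 - r (\<sigma> y0)) * (r z0 - r (\<sigma> z0))"
proof (rule ccontr)
  assume neg: "\<not> ?thesis"
  interpret r: bounded_density r B by (rule r)
  interpret pr: bounded_density "polarize r" B' by (rule pr)
  define R where "R = polarize r"
  define \<delta> where "\<delta> y = r y - r (\<sigma> y)" for y
  define F where "F = (\<lambda>p. (R (fst p) * R (snd p) - r (fst p) * r (snd p)) / norm (fst p - snd p))"
  have iF: "integrable lborel F"
    using Bochner_Integration.integrable_diff[OF pr.coulomb_integrable r.coulomb_integrable]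
    by (simp add: F_def R_def diff_divide_distrib)
  have vF: "(\<integral>p. F p \<partial>lborel) \<le> 0"
    using le Bochner_Integration.integral_diff[OF pr.coulomb_integrable r.coulomb_integrable]
    by (simp add: F_def R_def diff_divide_distrib coulomb_def)
  define T1 T2 where "T1 = (\<lambda>p::R3\<times>R3. (\<sigma> (fst p), snd p))" and "T2 = (\<lambda>p::R3\<times>R3. (fst p, \<sigma> (snd p)))"
  have mT[measurable]: "T1 \<in> borel_measurable borel" "T2 \<in> borel_measurable borel"
    unfolding T1_def T2_def by measurable
  have dT: "distr lborel borel T1 = lborel" "distr lborel borel T2 = lborel"
    unfolding T1_def T2_def using distr_lborel_pair[OF \<sigma>_measurable distr_\<sigma>] by auto
  note iT1 = integrable_measure_preserving[OF dT(1) mT(1)] and vT1 = integral_measure_preserving[OF dT(1) mT(1)]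
  note iT2 = integrable_measure_preserving[OF dT(2) mT(2)] and vT2 = integral_measure_preserving[OF dT(2) mT(2)]
  define G where "G = (\<lambda>p. F p + F (T1 p))"
  define S where "S = (\<lambda>p. G p + G (T2 p))"
  have iG: "integrable lborel G" and vG: "(\<integral>p. G p \<partial>lborel) = 2 * (\<integral>p. F p \<partial>lborel)"
    unfolding G_def using iF iT1[OF iF] vT1[OF iF] by auto
  have iS: "integrable lborel S" and vS: "(\<integral>p. S p \<partial>lborel) = 2 * (\<integral>p. G p \<partial>lborel)"
    unfolding S_def using iG iT2[OF iG] vT2[OF iG] by auto
  define X where "X y z = R y * R z + R (\<sigma> y) * R (\<sigma> z) - r y * r z - r (\<sigma> y) * r (\<sigma> z)" for y z
  have Seq: "S (y, z) = (1 / norm (y - z) - 1 / norm (y - \<sigma> z)) * X y z" for y z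
  proof -
    have prod: "(R y + R (\<sigma> y)) * (R z + R (\<sigma> z)) = (r y + r (\<sigma> y)) * (r z + r (\<sigma> z))"
      unfolding R_def polarize_sum ..
    have "S (y, z) = (R y * R z - r y * r z) / norm (y - z) + (R (\<sigma> y) * R z - r (\<sigma> y) * r z) / norm (y - \<sigma> z)
      + ((R y * R (\<sigma> z) - r y * r (\<sigma> z)) / norm (y - \<sigma> z) + (R (\<sigma> y) * R (\<sigma> z) - r (\<sigma> y) * r (\<sigma> z)) / norm (y - z))"
      by (simp add: S_def G_def F_def T1_def T2_def norm_\<sigma>_\<sigma> norm_\<sigma>_left \<sigma>_\<sigma>)
    also have "\<dots> = (1 / norm (y - z)) * X y z + (1 / norm (y - \<sigma> z)) *
        ((R (\<sigma> y) * R z - r (\<sigma> y) * r z) + (R y * R (\<sigma> z) - r y * r (\<sigma> z)))"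
      unfolding X_def by (simp add: diff_divide_distrib add_divide_distrib)
    also have "(R (\<sigma> y) * R z - r (\<sigma> y) * r z) + (R y * R (\<sigma> z) - r y * r (\<sigma> z)) = - X y z"
      unfolding X_def using prod by (simp add: algebra_simps)
    finally show ?thesis by (simp add: algebra_simps)
  qed
  have mx: "max a b * max c d + min a b * min c d - a * c - b * d = (\<bar>a - b\<bar> * \<bar>c - d\<bar> - (a - b) * (c - d)) / 2"
    "max a b * min c d + min a b * max c d - a * c - b * d = - (\<bar>a - b\<bar> * \<bar>c - d\<bar> + (a - b) * (c - d)) / 2" for a b c d :: real
    by (auto simp: max_def min_def abs_if algebra_simps)
  have Xpp: "X y z = (\<bar>\<delta> y\<bar> * \<bar>\<delta> z\<bar> - \<delta> y * \<delta> z) / 2" if "side y * side z > 0" for y z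
    unfolding X_def R_def \<delta>_def using that mx(1)[of "r y" "r (\<sigma> y)" "r z" "r (\<sigma> z)"]
    by (auto simp: zero_less_mult_iff polarize_pair algebra_simps)
  have Xpm: "X y z = - (\<bar>\<delta> y\<bar> * \<bar>\<delta> z\<bar> + \<delta> y * \<delta> z) / 2" if "side y * side z < 0" for y z
    unfolding X_def R_def \<delta>_def using that mx(2)[of "r y" "r (\<sigma> y)" "r z" "r (\<sigma> z)"]
    by (auto simp: mult_less_0_iff polarize_pair algebra_simps)
  have X0: "X y z = 0" if "side y = 0 \<or> side z = 0" for y z
  proof (cases "side y = 0")
    case True
    then have "X y z = r y * ((R z + R (\<sigma> z)) - (r z + r (\<sigma> z)))"
      unfolding X_def by (simp add: R_def polarize_pair \<sigma>_fixed algebra_simps)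
    then show ?thesis unfolding R_def polarize_sum by simp
  next
    case False
    with that have "side z = 0" by simp
    then have "X y z = ((R y + R (\<sigma> y)) - (r y + r (\<sigma> y))) * r z"
      unfolding X_def by (simp add: R_def polarize_pair \<sigma>_fixed algebra_simps)
    then show ?thesis unfolding R_def polarize_sum by simp
  qed
  have ab: "\<bar>a\<bar> * \<bar>b\<bar> \<ge> a * b" "\<bar>a\<bar> * \<bar>b\<bar> + a * b \<ge> 0" for a b :: real
    using abs_ge_self[of "a * b"] abs_ge_minus_self[of "a * b"] unfolding abs_mult by linarith+
  have Snn: "S (y, z) \<ge> 0" if ne: "z \<noteq> y" "z \<noteq> \<sigma> y" for y z
  proof -
    have ne': "norm (y - z) > 0" "norm (y - \<sigma> z) > 0" using ne \<sigma>_\<sigma>[of z] by auto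
    consider "side y * side z > 0" | "side y * side z < 0" | "side y = 0 \<or> side z = 0"
      by (metis linorder_neqE_linordered_idom mult_eq_0_iff)
    then show ?thesis
    proof cases
      case 1
      then have "(norm (y - z))\<^sup>2 \<le> (norm (y - \<sigma> z))\<^sup>2" unfolding dist_sq_\<sigma> by simp
      then have "norm (y - z) \<le> norm (y - \<sigma> z)" by simp
      then have "1 / norm (y - z) - 1 / norm (y - \<sigma> z) \<ge> 0" using ne' by (simp add: frac_le)
      moreover have "X y z \<ge> 0" using Xpp[OF 1] ab(1)[of "\<delta> y" "\<delta> z"] by simp
      ultimately show ?thesis unfolding Seq by simp
    next
      case 2
      then have "(norm (y - \<sigma> z))\<^sup>2 \<le> (norm (y - z))\<^sup>2" unfolding dist_sq_\<sigma> by simp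
      then have "norm (y - \<sigma> z) \<le> norm (y - z)" by simp
      then have "1 / norm (y - z) - 1 / norm (y - \<sigma> z) \<le> 0" using ne' by (simp add: frac_le)
      moreover have "X y z \<le> 0" using Xpm[OF 2] ab(2)[of "\<delta> y" "\<delta> z"] by simp
      ultimately show ?thesis unfolding Seq by (rule mult_nonpos_nonpos)
    next
      case 3
      then show ?thesis unfolding Seq using X0 by simp
    qed
  qed
  have AE1: "AE p in (lborel :: (R3 \<times> R3) measure). snd p \<noteq> fst p"
    using AE_lborel_pair_neq[of "\<lambda>x. x"] by simp
  have AE2: "AE p in (lborel :: (R3 \<times> R3) measure). snd p \<noteq> \<sigma> (fst p)"
    by (rule AE_lborel_pair_neq) measurable
  have SAE: "AE p in lborel. S p \<ge> 0"
    using AE1 AE2 by eventually_elim (metis Snn prod.collapse)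
  have "(\<integral>p. S p \<partial>lborel) \<le> 0" using vS vG vF by simp
  moreover have "(\<integral>p. S p \<partial>lborel) \<ge> 0" using SAE by (rule integral_nonneg_AE)
  ultimately have S0: "AE p in lborel. S p = 0"
    using integral_nonneg_eq_0_iff_AE[OF iS SAE] by simp
  define W where "W = {p. side (fst p) > 0 \<and> side (snd p) > 0 \<and> \<delta> (fst p) * \<delta> (snd p) < 0}"
  have c\<delta>: "continuous_on UNIV \<delta>"
    unfolding \<delta>_def using cont \<sigma>_continuous by (intro continuous_intros continuous_on_compose2[OF cont]) auto
  have "open W"
    unfolding W_def
    by (intro open_Collect_conj open_Collect_less continuous_intros
        continuous_on_compose2[OF side_continuous[of UNIV]] continuous_on_compose2[OF c\<delta>]) auto
  have "p \<notin> W" if "S p = 0" for p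
  proof
    assume pW: "p \<in> W"
    obtain y z where p: "p = (y, z)" by (cases p)
    have s: "side y > 0" "side z > 0" "\<delta> y * \<delta> z < 0" using pW by (auto simp: W_def p)
    have "y \<noteq> z" using s by (auto simp: mult_less_0_iff)
    then have d: "norm (y - z) > 0" by simp
    have "(norm (y - z))\<^sup>2 < (norm (y - \<sigma> z))\<^sup>2" unfolding dist_sq_\<sigma> using s by simp
    then have "norm (y - z) < norm (y - \<sigma> z)" by (rule power2_less_imp_less) simp
    then have "1 / norm (y - z) - 1 / norm (y - \<sigma> z) > 0" using d by (simp add: frac_less2)
    moreover have "X y z > 0" using Xpp[of y z] s by (simp add: abs_mult[symmetric])
    ultimately have "S p > 0" unfolding p Seq by simp
    then show False using that by simp
  qed
  with S0 have "AE p in lborel. p \<in> - W" by (auto elim: eventually_mono)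
  then have "AE p in lebesgue. p \<in> - W" by (rule AE_completion)
  then have "(y0, z0) \<in> - W" using \<open>open W\<close> by (intro mem_closed_if_AE_lebesgue) auto
  moreover have "(y0, z0) \<in> W" using neg y0 z0 by (auto simp: W_def \<delta>_def)
  ultimately show False by simp
qed

end

section \<open>Velocity averages of isotropic states\<close>

locale velocity_profile =
  fixes \<psi> :: "real \<Rightarrow> real"
  assumes cont_\<psi>: "continuous_on UNIV \<psi>" and zero_\<psi>: "t \<le> 0 \<Longrightarrow> \<psi> t = 0" and mono_\<psi>: "mono \<psi>"
begin

lemma nonneg_\<psi>: "0 \<le> \<psi> t"
  using monoD[OF mono_\<psi>, of "min t 0" t] zero_\<psi>[of "min t 0"] by simp

lemma measurable_\<psi>[measurable]: "\<psi> \<in> borel_measurable borel"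
  by (rule borel_measurable_continuous_onI[OF cont_\<psi>])

definition dens :: "real \<Rightarrow> real" where "dens s = (\<integral>v. \<psi> (s - (norm (v::R3))\<^sup>2 / 2) \<partial>lborel)"

lemma vel_support: "norm v > sqrt (2 * max s 0) \<Longrightarrow> \<psi> (s - (norm (v::R3))\<^sup>2 / 2) = 0"
proof -
  assume "norm v > sqrt (2 * max s 0)"
  then have "(sqrt (2 * max s 0))\<^sup>2 < (norm v)\<^sup>2" by (intro power_strict_mono) auto
  then show ?thesis by (intro zero_\<psi>) auto
qed

lemma vel_integrable: "integrable lborel (\<lambda>v::R3. \<psi> (s - (norm v)\<^sup>2 / 2))"
proof (rule integrable_continuous_bounded_support(1))
  show "continuous_on UNIV (\<lambda>v::R3. \<psi> (s - (norm v)\<^sup>2 / 2))"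
    by (intro continuous_on_compose2[OF cont_\<psi>] continuous_intros) auto
qed (rule vel_support)

lemma dens_nonneg: "0 \<le> dens s"
  unfolding dens_def by (intro integral_nonneg_AE) (simp add: nonneg_\<psi>)

lemma dens_mono: "s \<le> s' \<Longrightarrow> dens s \<le> dens s'"
  unfolding dens_def by (intro integral_mono vel_integrable monoD[OF mono_\<psi>]) simp

lemma dens_zero: "s \<le> 0 \<Longrightarrow> dens s = 0"
proof -
  assume "s \<le> 0"
  then have "s - (norm v)\<^sup>2 / 2 \<le> 0" for v :: R3 using zero_le_power2[of "norm v"] by linarith
  then have "(\<lambda>v::R3. \<psi> (s - (norm v)\<^sup>2 / 2)) = (\<lambda>_. 0)" using zero_\<psi> by blast
  then show ?thesis unfolding dens_def by simp
qed

lemma integral_const_cball: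
  fixes c r :: real
  assumes "r \<ge> 0"
  shows "(\<integral>v. c * indicator (cball 0 r) (v::R3) \<partial>lborel) = c * (unit_ball_vol 3 * r ^ 3)"
    and "integrable lborel (\<lambda>v::R3. c * indicator (cball 0 r) v)"
proof -
  have "measure lborel (cball 0 r :: R3 set) = unit_ball_vol 3 * r ^ 3"
    using content_cball[OF assms, of "0::R3"] by simp
  then show "(\<integral>v. c * indicator (cball 0 r) (v::R3) \<partial>lborel) = c * (unit_ball_vol 3 * r ^ 3)"
    by simp
  show "integrable lborel (\<lambda>v::R3. c * indicator (cball 0 r) v)"
    by (intro integrable_mult_right integrable_real_indicator)
      (use emeasure_lborel_cball_finite[of "0::R3" r] in auto)
qed

lemma dens_upper:
  assumes C: "\<And>t. t \<ge> 0 \<Longrightarrow> \<psi> t \<le> C * sqrt (1 + t) ^ 3" and s: "s \<ge> 0"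
  shows "dens s \<le> C * unit_ball_vol 3 * sqrt 2 ^ 3 * (1 + s) ^ 3"
proof -
  define r where "r = sqrt (2 * s)"
  have r: "r \<ge> 0" using s by (simp add: r_def)
  have C0: "C \<ge> 0" using C[of 0] nonneg_\<psi>[of 0] by simp
  have "dens s \<le> (\<integral>v. \<psi> s * indicator (cball 0 r) (v::R3) \<partial>lborel)"
    unfolding dens_def
  proof (rule integral_mono[OF vel_integrable integral_const_cball(2)[OF r]])
    fix v :: R3
    show "\<psi> (s - (norm v)\<^sup>2 / 2) \<le> \<psi> s * indicator (cball 0 r) v"
    proof (cases "norm v \<le> r")
      case True
      then show ?thesis using monoD[OF mono_\<psi>, of "s - (norm v)\<^sup>2 / 2" s] by simp
    next
      case False
      then show ?thesis using vel_support[of s v] s by (simp add: r_def)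
    qed
  qed
  also have "\<dots> = \<psi> s * (unit_ball_vol 3 * r ^ 3)" by (rule integral_const_cball(1)[OF r])
  also have "\<dots> \<le> (C * sqrt (1 + s) ^ 3) * (unit_ball_vol 3 * (sqrt 2 * sqrt (1 + s)) ^ 3)"
  proof (intro mult_mono C s power_mono r)
    show "r \<le> sqrt 2 * sqrt (1 + s)" unfolding r_def using s by (simp flip: real_sqrt_mult)
  qed (use s C0 r in \<open>auto simp: nonneg_\<psi>\<close>)
  also have "\<dots> = C * unit_ball_vol 3 * sqrt 2 ^ 3 * (sqrt (1 + s) ^ 3 * sqrt (1 + s) ^ 3)"
    by (simp add: power_mult_distrib)
  also have "sqrt (1 + s) ^ 3 * sqrt (1 + s) ^ 3 = (1 + s) ^ 3"
    using s by (simp flip: power_mult_distrib)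
  finally show ?thesis .
qed

lemma dens_lower:
  assumes s: "s > 0"
  shows "\<psi> (s / 2) * (unit_ball_vol 3 * sqrt s ^ 3) \<le> dens s"
proof -
  define r where "r = sqrt s"
  have r: "r \<ge> 0" using s by (simp add: r_def)
  have "\<psi> (s / 2) * (unit_ball_vol 3 * r ^ 3) = (\<integral>v. \<psi> (s / 2) * indicator (cball 0 r) (v::R3) \<partial>lborel)"
    by (rule integral_const_cball(1)[OF r, symmetric])
  also have "\<dots> \<le> dens s"
    unfolding dens_def
  proof (rule integral_mono[OF integral_const_cball(2)[OF r] vel_integrable])
    fix v :: R3
    show "\<psi> (s / 2) * indicator (cball 0 r) v \<le> \<psi> (s - (norm v)\<^sup>2 / 2)"
    proof (cases "norm v \<le> r")
      case True
      then have "(norm v)\<^sup>2 \<le> r\<^sup>2" by (intro power_mono) auto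
      then have "(norm v)\<^sup>2 \<le> s" using s by (simp add: r_def)
      then show ?thesis using True by (auto intro!: monoD[OF mono_\<psi>])
    next
      case False
      then show ?thesis by (simp add: nonneg_\<psi>)
    qed
  qed
  finally show ?thesis by (simp add: r_def)
qed

lemma antiderivative:
  obtains \<Psi> where "\<And>t. (\<Psi> has_real_derivative \<psi> t) (at t)" "\<And>t. t \<le> 0 \<Longrightarrow> \<Psi> t = 0"
proof -
  have "isCont \<psi> x" for x using cont_\<psi> by (simp add: continuous_on_eq_continuous_at)
  then have "\<exists>F. \<forall>x :: real. -\<infinity> < ereal x \<longrightarrow> ereal x < \<infinity> \<longrightarrow> (F has_vector_derivative \<psi> x) (at x)"
    by (intro einterval_antiderivative) auto
  then obtain F where F: "\<And>x. (F has_real_derivative \<psi> x) (at x)"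
    by (auto simp: has_real_derivative_iff_has_vector_derivative)
  have "F t - F 0 = 0" if "t \<le> 0" for t
  proof (cases "t = 0")
    case False
    then have "t < 0" using that by simp
    then obtain z where "t < z" "z < 0" "F 0 - F t = (0 - t) * \<psi> z" using MVT2[of t 0 F \<psi>] F by blast
    then show ?thesis using zero_\<psi>[of z] by simp
  qed simp
  moreover have "((\<lambda>t. F t - F 0) has_real_derivative \<psi> t) (at t)" for t
    using F by (auto intro!: derivative_eq_intros)
  ultimately show ?thesis using that by blast
qed

text \<open>In polar coordinates \<open>dens s\<close> is a multiple of the integral of \<open>r\<^sup>2 \<psi> (s - r\<^sup>2/2)\<close> over \<open>r \<ge> 0\<close>; one integration by parts
  trades the factor \<open>r\<^sup>2\<close> for an antiderivative of \<open>\<psi>\<close>, which can then be differentiated in \<open>s\<close>.\<close>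
lemma dens_C1:
  obtains G G' where "\<And>s. s \<le> S \<Longrightarrow> dens s = G s" "\<And>s. (G has_real_derivative G' s) (at s)"
    "continuous_on UNIV (G' :: real \<Rightarrow> real)"
proof -
  obtain \<Psi> where \<Psi>: "\<And>t. (\<Psi> has_real_derivative \<psi> t) (at t)" "\<And>t. t \<le> 0 \<Longrightarrow> \<Psi> t = 0"
    by (rule antiderivative, blast)
  have c\<Psi>: "continuous_on UNIV \<Psi>"
    using \<Psi>(1) by (intro continuous_at_imp_continuous_on ballI DERIV_isCont) auto
  define L where "L = sqrt (2 * max S 0)"
  have L: "L \<ge> 0" "L\<^sup>2 / 2 = max S 0" by (auto simp: L_def)
  define G where "G s = ball_const * integral (cbox 0 L) (\<lambda>r. \<Psi> (s - r\<^sup>2 / 2))" for s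
  define G' where "G' s = ball_const * integral (cbox 0 L) (\<lambda>r. \<psi> (s - r\<^sup>2 / 2))" for s
  show ?thesis
  proof
    fix s
    have "((\<lambda>s. integral (cbox 0 L) (\<lambda>r. \<Psi> (s - r\<^sup>2 / 2))) has_field_derivative integral (cbox 0 L) (\<lambda>r. \<psi> (s - r\<^sup>2 / 2))) (at s within UNIV)"
    proof (rule leibniz_rule_field_derivative)
      show "((\<lambda>s. \<Psi> (s - t\<^sup>2 / 2)) has_field_derivative \<psi> (x - t\<^sup>2 / 2)) (at x within UNIV)" for x t
      proof -
        have "((\<lambda>s. s - t\<^sup>2 / 2) has_real_derivative 1) (at x)" by (auto intro!: derivative_eq_intros)
        from DERIV_chain2[OF \<Psi>(1) this] show ?thesis by simp
      qed
      show "(\<lambda>r. \<Psi> (x - r\<^sup>2 / 2)) integrable_on cbox 0 L" for x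
        by (intro integrable_continuous continuous_on_compose2[OF c\<Psi>] continuous_intros) auto
      show "continuous_on (UNIV \<times> cbox 0 L) (\<lambda>(x, t). \<psi> (x - t\<^sup>2 / 2))"
        unfolding split_beta by (intro continuous_on_compose2[OF cont_\<psi>] continuous_intros) auto
    qed auto
    then show "(G has_real_derivative G' s) (at s)"
      unfolding G_def G'_def by (auto intro!: derivative_eq_intros)
  next
    show "continuous_on UNIV G'"
      unfolding G'_def
      by (intro continuous_intros integral_continuous_on_param)
        (auto simp: split_beta intro!: continuous_on_compose2[OF cont_\<psi>] continuous_intros)
  next
    fix s assume s: "s \<le> S"
    have ip: "((\<lambda>r. r\<^sup>2 * \<psi> (s - r\<^sup>2 / 2) - \<Psi> (s - r\<^sup>2 / 2)) has_integral
        (- L * \<Psi> (s - L\<^sup>2 / 2) - (- 0 * \<Psi> (s - 0\<^sup>2 / 2)))) {0..L}"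
    proof (rule fundamental_theorem_of_calculus[OF L(1)])
      fix r assume "r \<in> {0..L}"
      have "((\<lambda>r. \<Psi> (s - r\<^sup>2 / 2)) has_real_derivative \<psi> (s - r\<^sup>2 / 2) * (- r)) (at r)"
        by (rule DERIV_chain2[OF \<Psi>(1)]) (auto intro!: derivative_eq_intros)
      then have "((\<lambda>r. - r * \<Psi> (s - r\<^sup>2 / 2)) has_real_derivative (r\<^sup>2 * \<psi> (s - r\<^sup>2 / 2) - \<Psi> (s - r\<^sup>2 / 2))) (at r)"
        by (auto intro!: derivative_eq_intros simp: power2_eq_square)
      then show "((\<lambda>r. - r * \<Psi> (s - r\<^sup>2 / 2)) has_vector_derivative r\<^sup>2 * \<psi> (s - r\<^sup>2 / 2) - \<Psi> (s - r\<^sup>2 / 2)) (at r within {0..L})"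
        by (simp add: has_real_derivative_iff_has_vector_derivative has_vector_derivative_at_within)
    qed
    have "\<Psi> (s - L\<^sup>2 / 2) = 0" using \<Psi>(2) s L by simp
    with ip have ip: "((\<lambda>r. r\<^sup>2 * \<psi> (s - r\<^sup>2 / 2) - \<Psi> (s - r\<^sup>2 / 2)) has_integral 0) {0..L}" by simp
    have "(\<lambda>r. \<Psi> (s - r\<^sup>2 / 2)) integrable_on {0..L}"
      by (intro integrable_continuous_interval continuous_on_compose2[OF c\<Psi>] continuous_intros) auto
    from has_integral_add[OF ip integrable_integral[OF this]]
    have "((\<lambda>r. r\<^sup>2 * \<psi> (s - r\<^sup>2 / 2)) has_integral integral {0..L} (\<lambda>r. \<Psi> (s - r\<^sup>2 / 2))) {0..L}" by simp
    then have "((\<lambda>r. ball_const * (r\<^sup>2 * \<psi> (s - r\<^sup>2 / 2))) has_integral G s) {0..L}"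
      unfolding G_def by (auto intro: has_integral_mult_right)
    then have nn: "(\<integral>\<^sup>+r. ennreal (ball_const * (r\<^sup>2 * \<psi> (s - r\<^sup>2 / 2))) * indicator {0..L} r \<partial>lborel) = ennreal (G s)"
      using ball_const_pos by (intro nn_integral_has_integral_lebesgue') (auto simp: nonneg_\<psi>)
    have "ennreal (dens s) = (\<integral>\<^sup>+v. ennreal (\<psi> (s - (norm (v::R3))\<^sup>2 / 2)) \<partial>lborel)"
      unfolding dens_def by (intro nn_integral_eq_integral[symmetric] vel_integrable) (simp add: nonneg_\<psi>)
    also have "\<dots> = (\<integral>\<^sup>+r. ennreal (DIM(R3) * unit_ball_vol (DIM(R3)) * r ^ (DIM(R3) - 1)) * indicator {0..} r * ennreal (\<psi> (s - r\<^sup>2 / 2)) \<partial>lborel)"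
      by (rule nn_integral_norm_radial) measurable
    also have "\<dots> = (\<integral>\<^sup>+r. ennreal (ball_const * (r\<^sup>2 * \<psi> (s - r\<^sup>2 / 2))) * indicator {0..L} r \<partial>lborel)"
    proof (rule nn_integral_cong)
      fix r :: real
      have z: "\<psi> (s - r\<^sup>2 / 2) = 0" if "r > L"
      proof (rule zero_\<psi>)
        have "L\<^sup>2 < r\<^sup>2" using that L by (intro power_strict_mono) auto
        then show "s - r\<^sup>2 / 2 \<le> 0" using L s by linarith
      qed
      show "ennreal (DIM(R3) * unit_ball_vol (DIM(R3)) * r ^ (DIM(R3) - 1)) * indicator {0..} r * ennreal (\<psi> (s - r\<^sup>2 / 2))
        = ennreal (ball_const * (r\<^sup>2 * \<psi> (s - r\<^sup>2 / 2))) * indicator {0..L} r"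
        using z nonneg_\<psi> by (cases "r > L") (auto simp: ball_const_def ennreal_mult'[symmetric] mult.assoc split: split_indicator)
    qed
    finally have "ennreal (dens s) = ennreal (G s)" using nn by simp
    moreover have "G s \<ge> 0"
    proof -
      have "0 \<le> \<Psi> t" for t
        using DERIV_nonneg_imp_nondecreasing[of 0 t \<Psi>] \<Psi> nonneg_\<psi> by (cases "t \<le> 0") fastforce+
      then show ?thesis unfolding G_def using ball_const_pos
        by (intro mult_nonneg_nonneg integral_nonneg integrable_continuous continuous_on_compose2[OF c\<Psi>] continuous_intros) auto
    qed
    ultimately show "dens s = G s" using dens_nonneg[of s] by simp
  qed
qed

end

locale casimir =
  fixes Q Q' Q'' :: "real \<Rightarrow> real" and k1 k2 :: real
  assumes std: "standing_Q Q Q' Q'' k1 k2"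
begin

lemma Q_deriv: "s \<ge> 0 \<Longrightarrow> (Q has_real_derivative Q' s) (at s within {0..})"
  and cont_Q': "continuous_on {0..} Q'"
  and Q'_deriv: "s > 0 \<Longrightarrow> (Q' has_real_derivative Q'' s) (at s)"
  and Q_nonneg: "s \<ge> 0 \<Longrightarrow> 0 \<le> Q s"
  and k1: "0 < k1" "k1 < 3/2" and k2: "0 < k2" "k2 < 3/2"
  and Q''_pos: "s > 0 \<Longrightarrow> Q'' s > 0" and Q'_0: "Q' 0 = 0"
  using std unfolding standing_Q_def by auto

lemma growth:
  obtains C1 C2 F0 k3 where "C1 > 0" "F0 > 0" "0 < k3"
    "\<And>s. s \<ge> F0 \<Longrightarrow> Q s \<ge> C1 * s powr (1 + 1 / k1)"
    "\<And>s. 0 \<le> s \<Longrightarrow> s \<le> F0 \<Longrightarrow> Q s \<le> C2 * s powr (1 + 1 / k2)"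
    "\<And>s t. s \<ge> 0 \<Longrightarrow> 0 \<le> t \<Longrightarrow> t \<le> 1 \<Longrightarrow> Q (t * s) \<ge> t powr (1 + 1 / k3) * Q s"
  using std unfolding standing_Q_def
  apply (elim conjE exE)
  subgoal for C1 C2 F0 k3 by (rule that[of C1 F0 k3 C2]) simp_all
  done

lemma Q_0: "Q 0 = 0"
proof -
  obtain C1 C2 F0 k3 where F0: "F0 > 0" and le: "\<And>s. 0 \<le> s \<Longrightarrow> s \<le> F0 \<Longrightarrow> Q s \<le> C2 * s powr (1 + 1 / k2)"
    by (rule growth, rule that; blast)
  have "Q 0 \<le> C2 * 0 powr (1 + 1 / k2)" using le[of 0] F0 by simp
  then show ?thesis using Q_nonneg[of 0] by simp
qed

lemma Q_deriv_at: "s > 0 \<Longrightarrow> (Q has_real_derivative Q' s) (at s)"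
  using Q_deriv[of s] at_within_interior[of s "{0..}"] by simp

lemma cont_Q: "continuous_on {0..} Q"
  using Q_deriv by (meson DERIV_continuous_on atLeast_iff)

lemma Q'_less: "0 \<le> a \<Longrightarrow> a < b \<Longrightarrow> Q' a < Q' b"
proof (rule DERIV_pos_imp_increasing_open[of a b Q'])
  assume a: "0 \<le> a" "a < b"
  show "\<exists>y. DERIV Q' x :> y \<and> y > 0" if "a < x" "x < b" for x
    using Q'_deriv[of x] Q''_pos[of x] a that by auto
  show "continuous_on {a..b} Q'" using a by (intro continuous_on_subset[OF cont_Q']) auto
qed

lemma Q_le: "s > 0 \<Longrightarrow> Q s \<le> s * Q' s"
proof -
  assume s: "s > 0"
  have "\<exists>l z. 0 < z \<and> z < s \<and> DERIV Q z :> l \<and> Q s - Q 0 = (s - 0) * l"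
    by (rule MVT[OF s continuous_on_subset[OF cont_Q]]) (use Q_deriv_at in \<open>auto simp: real_differentiable_def\<close>)
  then obtain l z where z: "0 < z" "z < s" "DERIV Q z :> l" "Q s = s * l" using Q_0 by auto
  have "l = Q' z" using z(3) Q_deriv_at[OF z(1)] by (rule DERIV_unique)
  also have "\<dots> \<le> Q' s" using Q'_less[of z s] z by simp
  finally show ?thesis using z s by (simp add: mult_left_mono)
qed

lemma Q'_unbounded: "\<exists>s\<ge>0. Q' s \<ge> t"
proof -
  obtain C1 C2 F0 k3 where C: "C1 > 0" "F0 > 0" "\<And>s. s \<ge> F0 \<Longrightarrow> Q s \<ge> C1 * s powr (1 + 1 / k1)"
    by (rule growth, rule that; blast)
  define s where "s = max F0 ((max t 0 / C1) powr k1)"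
  have s: "s > 0" "s \<ge> F0" using C by (auto simp: s_def)
  have "C1 * s powr (1 + 1 / k1) \<le> s * Q' s" using C(3)[OF s(2)] Q_le[OF s(1)] by linarith
  then have "s * (C1 * s powr (1 / k1)) \<le> s * Q' s" using s by (simp add: powr_add mult_ac)
  then have 1: "C1 * s powr (1 / k1) \<le> Q' s" using s by simp
  have "t \<le> C1 * (max t 0 / C1)" using C by simp
  also have "max t 0 / C1 = ((max t 0 / C1) powr k1) powr (1 / k1)" using k1 C by (simp add: powr_powr)
  also have "\<dots> \<le> s powr (1 / k1)" using k1 by (intro powr_mono2) (auto simp: s_def)
  finally have "t \<le> C1 * s powr (1 / k1)" using C by simp
  then show ?thesis using 1 s by (intro exI[of _ s]) auto
qed

lemma Q'_surj: "t \<ge> 0 \<Longrightarrow> \<exists>s\<ge>0. Q' s = t"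
proof -
  assume t: "t \<ge> 0"
  obtain b where b: "b \<ge> 0" "Q' b \<ge> t" using Q'_unbounded by blast
  have "\<exists>x\<ge>0. x \<le> b \<and> Q' x = t"
    by (rule IVT') (use b t Q'_0 in \<open>auto intro!: continuous_on_subset[OF cont_Q']\<close>)
  then show ?thesis by auto
qed

lemma Q'_inj: "inj_on Q' {0..}"
  by (rule inj_onI) (metis Q'_less atLeast_iff less_irrefl linorder_neqE_linordered_idom)

definition \<psi> :: "real \<Rightarrow> real" where "\<psi> t = (if t > 0 then inv_into {0..} Q' t else 0)"

lemma phi_eq: "phi Q' E0 E = \<psi> (E0 - E)"
  by (simp add: phi_def \<psi>_def)

lemma \<psi>_Q': "s \<ge> 0 \<Longrightarrow> \<psi> (Q' s) = s"
proof (cases "s = 0")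
  case False
  assume "s \<ge> 0"
  with False have "s > 0" by simp
  then have "Q' s > 0" using Q'_less[of 0 s] Q'_0 by simp
  then show ?thesis using \<open>s \<ge> 0\<close> Q'_inj by (simp add: \<psi>_def)
qed (simp add: \<psi>_def Q'_0)

lemma \<psi>_nonneg: "\<psi> t \<ge> 0" and Q'_\<psi>: "t \<ge> 0 \<Longrightarrow> Q' (\<psi> t) = t"
proof -
  have *: "\<psi> t \<ge> 0 \<and> Q' (\<psi> t) = t" if "t \<ge> 0" for t
    using Q'_surj[OF that] \<psi>_Q' by auto
  then show "t \<ge> 0 \<Longrightarrow> Q' (\<psi> t) = t" by simp
  show "\<psi> t \<ge> 0" using *[of t] by (cases "t \<ge> 0") (auto simp: \<psi>_def)
qed

lemma \<psi>_mono: "mono \<psi>"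
proof (rule monoI)
  fix a b :: real assume ab: "a \<le> b"
  show "\<psi> a \<le> \<psi> b"
  proof (cases "a \<le> 0")
    case True then show ?thesis using \<psi>_nonneg[of b] by (simp add: \<psi>_def)
  next
    case False
    then show ?thesis using Q'_less[OF \<psi>_nonneg, of b "\<psi> a"] Q'_\<psi>[of a] Q'_\<psi>[of b] ab by force
  qed
qed

lemma \<psi>_cont: "continuous_on UNIV \<psi>"
proof -
  have 1: "continuous_on {0..Q' S} \<psi>" if "S \<ge> 0" for S
  proof -
    have "continuous_on (Q' ` {0..S}) \<psi>"
      by (rule continuous_on_inv) (auto intro!: continuous_on_subset[OF cont_Q'] simp: \<psi>_Q')
    moreover have "{0..Q' S} \<subseteq> Q' ` {0..S}"
    proof
      fix t assume t: "t \<in> {0..Q' S}"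
      then obtain s where s: "s \<ge> 0" "Q' s = t" using Q'_surj[of t] by auto
      then have "s \<le> S" using t Q'_less[of S s] that by force
      then show "t \<in> Q' ` {0..S}" using s by auto
    qed
    ultimately show ?thesis by (rule continuous_on_subset)
  qed
  have "isCont \<psi> t" for t
  proof -
    obtain S where S: "S \<ge> 0" "Q' S \<ge> \<bar>t\<bar> + 1" using Q'_unbounded by blast
    have "continuous_on ({..0} \<union> {0..Q' S}) \<psi>"
    proof (rule continuous_on_closed_Un)
      show "continuous_on {..0} \<psi>" by (rule continuous_on_eq[OF continuous_on_const[of _ 0]]) (simp add: \<psi>_def)
    qed (use 1[OF S(1)] in auto)
    then have "continuous_on {..<Q' S} \<psi>" by (rule continuous_on_subset) auto
    then show ?thesis using S by (simp add: continuous_on_eq_continuous_at)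
  qed
  then show ?thesis by (simp add: continuous_at_imp_continuous_on)
qed

sublocale velocity_profile \<psi>
  using \<psi>_cont \<psi>_mono by unfold_locales (auto simp: \<psi>_def)

lemma Q'_mult_le: "\<exists>a\<ge>0. \<forall>s\<ge>0. s * Q' s \<le> a * Q s"
proof -
  obtain C1 C2 F0 k3 where k3: "0 < k3" "\<And>s t. s \<ge> 0 \<Longrightarrow> 0 \<le> t \<Longrightarrow> t \<le> 1 \<Longrightarrow> Q (t * s) \<ge> t powr (1 + 1 / k3) * Q s"
    by (rule growth, rule that; blast)
  define a where "a = 1 + 1 / k3"
  have "s * Q' s \<le> a * Q s" if s: "s \<ge> 0" for s
  proof (cases "s = 0")
    case False
    then have s: "s > 0" using that by simp
    show ?thesis
    proof (rule ccontr)
      assume "\<not> ?thesis"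
      then have pos: "s * Q' s - a * Q s > 0" by simp
      define G where "G t = Q (t * s) - t powr a * Q s" for t
      have "((\<lambda>t. Q (t * s)) has_real_derivative Q' s * s) (at 1)"
        by (rule DERIV_chain2[where g = "\<lambda>t. t * s"]) (use Q_deriv_at[OF s] in \<open>auto intro!: derivative_eq_intros\<close>)
      then have "(G has_real_derivative s * Q' s - a * Q s) (at 1)"
        unfolding G_def by (auto intro!: derivative_eq_intros)
      from DERIV_pos_inc_left[OF this pos] obtain d where d: "d > 0" "\<forall>h>0. h < d \<longrightarrow> G (1 - h) < G 1" by blast
      define h where "h = min (d / 2) (1 / 2)"
      have "G (1 - h) < G 1" using d by (auto simp: h_def)
      moreover have "G 1 = 0" by (simp add: G_def)
      moreover have "0 \<le> 1 - h" "1 - h \<le> 1" using d by (auto simp: h_def)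
      then have "G (1 - h) \<ge> 0" using k3(2)[of s "1 - h"] s unfolding G_def a_def by simp
      ultimately show False by simp
    qed
  qed (simp add: Q_0)
  moreover have "a \<ge> 0" using k3 by (simp add: a_def)
  ultimately show ?thesis by blast
qed

lemma energy_density_bound:
  obtains a where "a \<ge> 0"
    "\<And>s v. s * \<psi> (s - (norm (v::R3))\<^sup>2 / 2) \<le> a * Q (\<psi> (s - (norm v)\<^sup>2 / 2)) + (norm v)\<^sup>2 / 2 * \<psi> (s - (norm v)\<^sup>2 / 2)"
proof -
  obtain a where a: "a \<ge> 0" "\<And>s. s \<ge> 0 \<Longrightarrow> s * Q' s \<le> a * Q s" using Q'_mult_le by blast
  show ?thesis
  proof (rule that[OF a(1)])
    fix s :: real and v :: R3
    let ?t = "s - (norm v)\<^sup>2 / 2"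
    have "\<psi> ?t * ?t \<le> a * Q (\<psi> ?t)"
    proof (cases "?t \<ge> 0")
      case True
      then show ?thesis using a(2)[OF \<psi>_nonneg, of ?t] Q'_\<psi>[of ?t] by simp
    next
      case False
      then show ?thesis by (simp add: \<psi>_def Q_0)
    qed
    then show "s * \<psi> ?t \<le> a * Q (\<psi> ?t) + (norm v)\<^sup>2 / 2 * \<psi> ?t"
      by (simp add: algebra_simps)
  qed
qed

end

section \<open>Steady states\<close>

lemma Upot_eq_newt: "Upot f x = - newt (rho f) x"
  by (simp add: Upot_def newt_def)

lemma gradU_eq_gnewt: "gradU f x = gnewt (rho f) x"
  by (simp add: gradU_def gnewt_def)

lemma nn_integral_inverse_cube_infinite:
  assumes c: "c > 0"
  shows "(\<integral>\<^sup>+x. ennreal (c * (1 / (1 + norm (x::R3))) ^ 3) \<partial>lborel) = \<infinity>"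
proof (rule ccontr)
  let ?I = "\<integral>\<^sup>+x. ennreal (c * (1 / (1 + norm (x::R3))) ^ 3) \<partial>lborel"
  assume "?I \<noteq> \<infinity>"
  then obtain K where K: "?I = ennreal K" "K \<ge> 0" by (cases ?I) auto
  have le: "ball_const / \<epsilon> \<le> 8 / c * K" if \<epsilon>: "\<epsilon> > 0" for \<epsilon> :: real
  proof -
    have "ennreal (ball_const / \<epsilon>) = (\<integral>\<^sup>+w. ennreal (norm w powr (-(3 + \<epsilon>))) * indicator {w. norm w \<ge> 1} (w::R3) \<partial>lborel)"
      using \<epsilon> by (subst nn_integral_powr_outside_ball) auto
    also have "\<dots> \<le> (\<integral>\<^sup>+w. ennreal (8 / c) * ennreal (c * (1 / (1 + norm (w::R3))) ^ 3) \<partial>lborel)"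
    proof (intro nn_integral_mono)
      fix w :: R3
      show "ennreal (norm w powr (-(3 + \<epsilon>))) * indicator {w. norm w \<ge> 1} w \<le> ennreal (8 / c) * ennreal (c * (1 / (1 + norm w)) ^ 3)"
      proof (cases "norm w \<ge> 1")
        case True
        then have w: "norm w > 0" by linarith
        have "norm w powr (-(3 + \<epsilon>)) \<le> norm w powr (-3)" using True \<epsilon> by (intro powr_mono) auto
        also have "\<dots> = (1 / norm w) ^ 3" using w by (simp add: powr_minus_divide power_divide)
        also have "\<dots> \<le> (2 / (1 + norm w)) ^ 3"
        proof (rule power_mono)
          show "1 / norm w \<le> 2 / (1 + norm w)" using True w by (simp add: field_simps)
        qed simp
        also have "\<dots> = 8 / c * (c * (1 / (1 + norm w)) ^ 3)" using c by (simp add: power_divide)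
        finally have "ennreal (norm w powr (-(3 + \<epsilon>))) \<le> ennreal (8 / c * (c * (1 / (1 + norm w)) ^ 3))"
          by (rule ennreal_leI)
        also have "\<dots> = ennreal (8 / c) * ennreal (c * (1 / (1 + norm w)) ^ 3)"
          using c by (intro ennreal_mult) auto
        finally show ?thesis using True by simp
      qed simp
    qed
    also have "\<dots> = ennreal (8 / c) * ?I" by (rule nn_integral_cmult) measurable
    also have "\<dots> = ennreal (8 / c * K)" unfolding K using c K(2) by (intro ennreal_mult[symmetric]) auto
    finally show ?thesis using c K(2) by (simp add: ennreal_le_iff)
  qed
  define \<epsilon> where "\<epsilon> = ball_const / (8 / c * K + 1)"
  have p: "8 / c * K + 1 > 0" using c K(2) by (simp add: add_nonneg_pos)
  then have "\<epsilon> > 0" using ball_const_pos by (simp add: \<epsilon>_def)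
  moreover have "ball_const / \<epsilon> = 8 / c * K + 1" using p ball_const_pos by (simp add: \<epsilon>_def)
  ultimately show False using le[of \<epsilon>] by simp
qed

locale steady_state = casimir Q Q' Q'' k1 k2
  for Q Q' Q'' :: "real \<Rightarrow> real" and k1 k2 :: real +
  fixes M E0 C1' C2' :: real and f0 :: "R3 \<Rightarrow> R3 \<Rightarrow> real"
  assumes hM: "M > 0" and hf0: "f0 \<in> FM Q M"
    and hform: "f0 x v = phi Q' E0 (norm v ^ 2 / 2 + Upot f0 x)"
    and hC: "C1' > 0" "C2' > 0"
    and hupper: "\<forall>\<^sub>F E in at_bot. phi Q' E0 E \<le> C1' * (E0 - E) powr k1"
    and hlower: "\<forall>\<^sub>F E in at_left E0. phi Q' E0 E \<ge> C2' * (E0 - E) powr k2"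
begin

abbreviation \<rho> :: "R3 \<Rightarrow> real" where "\<rho> \<equiv> rho f0"

definition s :: "R3 \<Rightarrow> real" where "s x = E0 + newt \<rho> x"

lemma f0_eq: "f0 x v = \<psi> (s x - (norm v)\<^sup>2 / 2)"
  unfolding hform[of x v] phi_eq Upot_eq_newt s_def by (simp add: algebra_simps)

lemma \<rho>_eq: "\<rho> x = dens (s x)"
  unfolding rho_def dens_def by (rule Bochner_Integration.integral_cong) (simp_all only: f0_eq)

lemma f0_v_integrable: "integrable lborel (\<lambda>v. f0 x v)"
  using vel_integrable[of "s x"] by (simp only: f0_eq[symmetric])

lemma \<rho>_nonneg: "0 \<le> \<rho> x" by (simp add: \<rho>_eq dens_nonneg)

lemma f0_nonneg: "0 \<le> f0 x v" by (simp add: f0_eq nonneg_\<psi>)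

lemma f0_integrable: "integrable lborel (\<lambda>z. f0 (fst z) (snd z))"
  and f0_mass: "(\<integral>z. f0 (fst z) (snd z) \<partial>(lborel :: (R3 \<times> R3) measure)) = M"
  and f0_Pcal: "Pcal Q f0 < \<infinity>"
  using hf0 unfolding FM_def by simp_all

lemma f0_measurable[measurable]: "(\<lambda>z. f0 (fst z) (snd z)) \<in> borel_measurable borel"
  using borel_measurable_integrable[OF f0_integrable] by simp

lemma f0_nn_mass: "(\<integral>\<^sup>+z. ennreal (f0 (fst z) (snd z)) \<partial>lborel) = ennreal M"
  unfolding f0_mass[symmetric] by (rule nn_integral_eq_integral[OF f0_integrable]) (simp add: f0_nonneg)

lemma \<rho>_measurable[measurable]: "\<rho> \<in> borel_measurable borel"
  using borel_measurable_integrable[OF integral_lborel_pair(3)[OF f0_integrable]] by (simp add: rho_def[abs_def])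

lemma f0_v_nn: "(\<integral>\<^sup>+v. ennreal (f0 x v) \<partial>lborel) = ennreal (\<rho> x)"
  unfolding rho_def by (rule nn_integral_eq_integral[OF f0_v_integrable]) (simp add: f0_nonneg)

lemma \<rho>_nn_mass: "(\<integral>\<^sup>+x. ennreal (\<rho> x) \<partial>lborel) = ennreal M"
proof -
  have "(\<integral>\<^sup>+z. ennreal (f0 (fst z) (snd z)) \<partial>lborel) = (\<integral>\<^sup>+x. \<integral>\<^sup>+v. ennreal (f0 x v) \<partial>lborel \<partial>lborel)"
    by (subst nn_integral_lborel_pair(1)) auto
  then show ?thesis unfolding f0_nn_mass f0_v_nn by simp
qed

lemma \<rho>_integrable: "integrable lborel \<rho>"
  by (rule integrableI_nonneg) (auto simp: \<rho>_nonneg \<rho>_nn_mass)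

lemma \<rho>_mass: "(\<integral>x. \<rho> x \<partial>lborel) = M"
  using \<rho>_nn_mass hM by (subst integral_eq_nn_integral) (auto simp: \<rho>_nonneg)

lemma \<psi>_upper: "\<exists>C\<ge>0. \<forall>t\<ge>0. \<psi> t \<le> C * sqrt (1 + t) ^ 3"
proof -
  obtain N where N: "\<And>E. E \<le> N \<Longrightarrow> \<psi> (E0 - E) \<le> C1' * (E0 - E) powr k1"
    using hupper unfolding phi_eq eventually_at_bot_linorder by blast
  define T where "T = max (E0 - N) 1"
  define C where "C = max C1' (\<psi> T)"
  have "\<psi> t \<le> C * sqrt (1 + t) ^ 3" if t: "t \<ge> 0" for t
  proof (cases "t \<ge> T")
    case True
    then have t1: "t \<ge> 1" "E0 - t \<le> N" by (auto simp: T_def)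
    have "\<psi> t \<le> C1' * t powr k1" using N[OF t1(2)] by simp
    also have "\<dots> \<le> C1' * t powr (3/2)" using t1 k1 hC by (intro mult_left_mono powr_mono) auto
    also have "t powr (3/2) = sqrt t ^ 3"
      using t1 powr_power[of t "1/2" 3] by (simp add: powr_half_sqrt)
    also have "C1' * sqrt t ^ 3 \<le> C * sqrt (1 + t) ^ 3"
      using t hC by (intro mult_mono power_mono) (auto simp: C_def le_max_iff_disj)
    finally show ?thesis .
  next
    case False
    then have "\<psi> t \<le> \<psi> T" by (intro monoD[OF mono_\<psi>]) simp
    also have "\<dots> \<le> C * 1" by (simp add: C_def)
    also have "\<dots> \<le> C * sqrt (1 + t) ^ 3"
      using t hC by (intro mult_left_mono one_le_power) (auto simp: C_def le_max_iff_disj)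
    finally show ?thesis .
  qed
  moreover have "C \<ge> 0" using hC by (simp add: C_def le_max_iff_disj)
  ultimately show ?thesis by blast
qed

lemma dens_third_upper: "\<exists>C\<ge>0. \<forall>t\<ge>0. dens t powr (1/3) \<le> C * (1 + t)"
proof -
  obtain C where C: "C \<ge> 0" "\<And>t. t \<ge> 0 \<Longrightarrow> \<psi> t \<le> C * sqrt (1 + t) ^ 3" using \<psi>_upper by blast
  define K where "K = C * unit_ball_vol 3 * sqrt 2 ^ 3"
  have K: "K \<ge> 0" using C(1) by (simp add: K_def)
  have "dens t powr (1/3) \<le> K powr (1/3) * (1 + t)" if t: "t \<ge> 0" for t
  proof -
    have "dens t \<le> K * (1 + t) ^ 3" unfolding K_def by (rule dens_upper[OF C(2) t])
    then have "dens t powr (1/3) \<le> (K * (1 + t) ^ 3) powr (1/3)"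
      by (intro powr_mono2) (auto simp: dens_nonneg)
    also have "\<dots> = K powr (1/3) * ((1 + t) ^ 3) powr (1/3)" using K t by (simp add: powr_mult)
    also have "((1 + t) ^ 3) powr (1/3) = 1 + t"
    proof -
      have e: "(1 + t) ^ 3 = (1 + t) powr 3" using t by simp
      show ?thesis unfolding e powr_powr using t by simp
    qed
    finally show ?thesis .
  qed
  then show ?thesis by (intro exI[of _ "K powr (1/3)"]) simp
qed

lemma dens_cube_lower: "\<exists>c>0. \<exists>\<delta>>0. \<forall>t. 0 < t \<and> t < \<delta> \<longrightarrow> c * t ^ 3 \<le> dens t"
proof -
  obtain b where b: "b < E0" "\<And>E. b < E \<Longrightarrow> E < E0 \<Longrightarrow> C2' * (E0 - E) powr k2 \<le> \<psi> (E0 - E)"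
    using hlower unfolding phi_eq eventually_at_left_field by blast
  define \<delta> where "\<delta> = min (E0 - b) 1"
  have \<delta>: "\<delta> > 0" using b(1) by (simp add: \<delta>_def)
  define c where "c = C2' * (1/2) powr (3/2) * unit_ball_vol 3"
  have c: "c > 0" using hC unit_ball_vol_pos[of 3] by (simp add: c_def)
  have "c * t ^ 3 \<le> dens t" if t: "0 < t" "t < \<delta>" for t
  proof -
    have "C2' * (t/2) powr (3/2) \<le> C2' * (t/2) powr k2"
      using t k2 hC by (intro mult_left_mono powr_mono') (auto simp: \<delta>_def)
    also have "\<dots> \<le> \<psi> (t/2)" using b(2)[of "E0 - t/2"] t by (simp add: \<delta>_def)
    finally have "C2' * (t/2) powr (3/2) * (unit_ball_vol 3 * sqrt t ^ 3) \<le> \<psi> (t/2) * (unit_ball_vol 3 * sqrt t ^ 3)"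
      using t by (intro mult_right_mono) auto
    also have "\<dots> \<le> dens t" using t by (intro dens_lower) auto
    also have "(t/2) powr (3/2) = (1/2) powr (3/2) * sqrt t ^ 3"
      using t powr_power[of t "1/2" 3] powr_mult[of t "1/2" "3/2"] by (simp add: powr_half_sqrt)
    also have "C2' * ((1/2) powr (3/2) * sqrt t ^ 3) * (unit_ball_vol 3 * sqrt t ^ 3) = c * (sqrt t ^ 3 * sqrt t ^ 3)"
      by (simp add: c_def mult_ac)
    also have "sqrt t ^ 3 * sqrt t ^ 3 = t ^ 3" using t by (simp flip: power_mult_distrib)
    finally show ?thesis .
  qed
  then show ?thesis using c \<delta> by blast
qed

lemma Q_max_measurable[measurable]: "(\<lambda>t. Q (max 0 t)) \<in> borel_measurable borel"
  by (intro borel_measurable_continuous_onI continuous_on_compose2[OF cont_Q] continuous_intros) auto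

lemma Q_comp_measurable:
  assumes [measurable]: "h \<in> borel_measurable M'" and nn: "\<And>z. 0 \<le> h z"
  shows "(\<lambda>z. Q (h z)) \<in> borel_measurable M'"
proof -
  have "(\<lambda>z. Q (max 0 (h z))) \<in> borel_measurable M'" by measurable
  then show ?thesis by (simp add: nn max_absorb2)
qed

lemma Q_f0_measurable[measurable]: "(\<lambda>z. Q (f0 (fst z) (snd z))) \<in> borel_measurable borel"
  by (rule Q_comp_measurable[OF f0_measurable f0_nonneg])

lemma \<rho>_four_thirds: "(\<integral>\<^sup>+x. ennreal (\<rho> x powr (4/3)) \<partial>lborel) < \<infinity>"
proof -
  obtain C where C: "C \<ge> 0" "\<And>t. t \<ge> 0 \<Longrightarrow> dens t powr (1/3) \<le> C * (1 + t)" using dens_third_upper by blast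
  obtain a where a: "a \<ge> 0"
    "\<And>s v. s * \<psi> (s - (norm (v::R3))\<^sup>2 / 2) \<le> a * Q (\<psi> (s - (norm v)\<^sup>2 / 2)) + (norm v)\<^sup>2 / 2 * \<psi> (s - (norm v)\<^sup>2 / 2)"
    by (rule energy_density_bound, rule that; blast)
  let ?F = "\<lambda>z::R3\<times>R3. ennreal C * (ennreal (f0 (fst z) (snd z)) + (ennreal a * ennreal (Q (f0 (fst z) (snd z))) +
      ennreal ((norm (snd z))\<^sup>2 / 2 * f0 (fst z) (snd z))))"
  have pt: "ennreal (\<rho> x powr (4/3)) \<le> (\<integral>\<^sup>+v. ?F (x, v) \<partial>lborel)" for x
  proof (cases "s x \<ge> 0")
    case True
    have "\<rho> x powr (4/3) = \<rho> x * \<rho> x powr (1/3)"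
      using powr_add[of "\<rho> x" 1 "1/3"] \<rho>_nonneg[of x] by simp
    also have "\<dots> \<le> \<rho> x * (C * (1 + s x))"
      using C(2)[OF True] by (intro mult_left_mono) (auto simp: \<rho>_eq dens_nonneg)
    also have "\<dots> = (C * (1 + s x)) * \<rho> x" by (simp add: mult.commute)
    finally have "ennreal (\<rho> x powr (4/3)) \<le> ennreal (C * (1 + s x)) * ennreal (\<rho> x)"
      using C(1) True by (simp add: ennreal_mult'[symmetric] ennreal_leI)
    also have "\<dots> = (\<integral>\<^sup>+v. ennreal (C * (1 + s x)) * ennreal (f0 x v) \<partial>lborel)"
      unfolding f0_v_nn[symmetric] by (rule nn_integral_cmult[symmetric]) (simp add: f0_eq)
    also have "\<dots> \<le> (\<integral>\<^sup>+v. ?F (x, v) \<partial>lborel)"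
    proof (intro nn_integral_mono)
      fix v
      have "(C * (1 + s x)) * f0 x v = C * (f0 x v + s x * f0 x v)" by (simp add: algebra_simps)
      also have "\<dots> \<le> C * (f0 x v + (a * Q (f0 x v) + (norm v)\<^sup>2 / 2 * f0 x v))"
        using C(1) a(2)[of "s x" v] by (intro mult_left_mono add_left_mono) (auto simp: f0_eq)
      finally show "ennreal (C * (1 + s x)) * ennreal (f0 x v) \<le> ?F (x, v)"
        using C(1) a(1) Q_nonneg[OF f0_nonneg, of x v] f0_nonneg[of x v] True
        by (simp add: ennreal_mult'[symmetric] ennreal_leI flip: ennreal_plus)
    qed
    finally show ?thesis .
  next
    case False
    then have "\<rho> x = 0" by (simp add: \<rho>_eq dens_zero)
    then show ?thesis by simp
  qed
  have "(\<integral>\<^sup>+x. ennreal (\<rho> x powr (4/3)) \<partial>lborel) \<le> (\<integral>\<^sup>+x. \<integral>\<^sup>+v. ?F (x, v) \<partial>lborel \<partial>lborel)"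
    by (intro nn_integral_mono pt)
  also have "\<dots> = (\<integral>\<^sup>+z. ?F z \<partial>lborel)" by (rule nn_integral_lborel_pair(1)[symmetric]) measurable
  also have "\<dots> = ennreal C * (ennreal M + (ennreal a * Ccal Q f0 + Ekin f0))"
    unfolding f0_nn_mass[symmetric] Ccal_def Ekin_def
    by (subst nn_integral_cmult, measurable, subst nn_integral_add, measurable, subst nn_integral_add, measurable,
        subst nn_integral_cmult, measurable)
  also have "\<dots> < \<infinity>"
    using f0_Pcal unfolding Pcal_def by (auto simp: ennreal_mult_less_top)
  finally show ?thesis .
qed

lemma newt_le_nn: "ennreal (newt \<rho> x) \<le> (\<integral>\<^sup>+y. ennreal (\<rho> y * norm (x - y) powr (-1)) \<partial>lborel)"
proof (cases "integrable lborel (\<lambda>y. \<rho> y / norm (x - y))")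
  case True
  then have "ennreal (newt \<rho> x) = (\<integral>\<^sup>+y. ennreal (\<rho> y / norm (x - y)) \<partial>lborel)"
    unfolding newt_def by (intro nn_integral_eq_integral[symmetric]) (auto simp: \<rho>_nonneg)
  then show ?thesis by (simp add: powr_minus_divide)
next
  case False
  then show ?thesis by (simp add: newt_def not_integrable_integral_eq)
qed

lemma newt_nonneg: "0 \<le> newt \<rho> x"
  unfolding newt_def by (intro integral_nonneg_AE) (simp add: \<rho>_nonneg)

lemma density_bounded: "\<exists>B. bounded_density \<rho> B"
proof -
  obtain C where C: "C \<ge> 0" "\<And>t. t \<ge> 0 \<Longrightarrow> dens t powr (1/3) \<le> C * (1 + t)" using dens_third_upper by blast
  let ?V = "\<lambda>x. \<integral>\<^sup>+y. ennreal (\<rho> y * norm (x - y) powr (-1)) \<partial>lborel"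
  have "\<exists>B\<ge>0. \<forall>x. ?V x \<le> ennreal B"
  proof (rule newton_potential_bounded)
    show "ennreal (\<rho> y powr (1/3)) \<le> ennreal (C * (1 + \<bar>E0\<bar>)) * (1 + ?V y)" for y
    proof (cases "s y \<ge> 0")
      case True
      have "\<rho> y powr (1/3) \<le> C * (1 + s y)" using C(2)[OF True] by (simp add: \<rho>_eq)
      also have "\<dots> \<le> C * ((1 + \<bar>E0\<bar>) * (1 + newt \<rho> y))"
      proof (intro mult_left_mono C)
        have "0 \<le> \<bar>E0\<bar> * newt \<rho> y" using newt_nonneg by simp
        then show "1 + s y \<le> (1 + \<bar>E0\<bar>) * (1 + newt \<rho> y)" by (simp add: s_def algebra_simps)
      qed
      finally have "ennreal (\<rho> y powr (1/3)) \<le> ennreal (C * (1 + \<bar>E0\<bar>) * (1 + newt \<rho> y))"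
        by (intro ennreal_leI) (simp add: mult_ac)
      also have "\<dots> = ennreal (C * (1 + \<bar>E0\<bar>)) * (1 + ennreal (newt \<rho> y))"
        using C(1) newt_nonneg[of y] by (simp add: ennreal_mult' ennreal_plus[symmetric] del: ennreal_plus flip: ennreal_1)
      also have "\<dots> \<le> ennreal (C * (1 + \<bar>E0\<bar>)) * (1 + ?V y)"
        by (intro mult_left_mono add_left_mono newt_le_nn) auto
      finally show ?thesis .
    next
      case False
      then have "\<rho> y = 0" by (simp add: \<rho>_eq dens_zero)
      then show ?thesis by simp
    qed
  qed (use C(1) \<rho>_four_thirds in \<open>auto simp: \<rho>_nonneg \<rho>_nn_mass\<close>)
  then obtain B where B: "B \<ge> 0" "\<And>x. ?V x \<le> ennreal B" by blast
  have "newt \<rho> x \<le> B" for x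
    using order_trans[OF newt_le_nn B(2)] B(1) by (simp add: ennreal_le_iff)
  then have "s x \<le> E0 + B" for x by (simp add: s_def)
  then have "\<rho> x \<le> dens (E0 + B)" for x unfolding \<rho>_eq by (rule dens_mono)
  then have "bounded_density \<rho> (dens (E0 + B))"
    using \<rho>_integrable \<rho>_nonneg by unfold_locales auto
  then show ?thesis ..
qed

lemma E0_neg: "E0 < 0"
proof (rule ccontr)
  assume "\<not> E0 < 0"
  then have E0: "E0 \<ge> 0" by simp
  obtain B where "bounded_density \<rho> B" using density_bounded ..
  then interpret bounded_density \<rho> B .
  let ?w = "\<lambda>y::R3. \<rho> y / (1 + norm y)"
  have wle: "?w y \<le> \<rho> y" for y
  proof -
    have "?w y \<le> \<rho> y / 1" using \<rho>_nonneg by (intro divide_left_mono) (auto simp: add_pos_nonneg)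
    then show ?thesis by simp
  qed
  have iw: "integrable lborel ?w"
    using \<rho>_integrable by (rule Bochner_Integration.integrable_bound) (auto simp: \<rho>_nonneg intro!: order_trans[OF wle])
  define c0 where "c0 = (\<integral>y. ?w y \<partial>lborel)"
  have "c0 \<noteq> 0"
  proof
    assume "c0 = 0"
    then have "AE y in lborel. ?w y = 0"
      using integral_nonneg_eq_0_iff_AE[OF iw] \<rho>_nonneg unfolding c0_def by simp
    moreover have "?w y = 0 \<Longrightarrow> \<rho> y = 0" for y
      using norm_ge_zero[of y] by (auto simp: add_nonneg_eq_0_iff)
    ultimately have "AE y in lborel. \<rho> y = 0" by (auto elim: eventually_mono)
    then have "(\<integral>y. \<rho> y \<partial>lborel) = integral\<^sup>L lborel (\<lambda>y::R3. 0::real)" by (intro integral_cong_AE) auto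
    then show False using \<rho>_mass hM by simp
  qed
  moreover have "c0 \<ge> 0" unfolding c0_def by (intro integral_nonneg_AE) (simp add: \<rho>_nonneg)
  ultimately have c0: "c0 > 0" by simp
  have lower: "c0 / (1 + norm x) \<le> newt \<rho> x" for x
  proof -
    have "c0 / (1 + norm x) = (\<integral>y. ?w y / (1 + norm x) \<partial>lborel)"
      unfolding c0_def by (rule integral_divide_zero[symmetric])
    also have "\<dots> \<le> newt \<rho> x"
      unfolding newt_def
    proof (rule integral_mono_AE[OF integrable_divide_zero[OF iw] integrable_newt], rule AE_mp[OF AE_lborel_singleton[of x]], intro AE_I2 impI)
      fix y assume "y \<noteq> x"
      then have p: "norm (x - y) > 0" by simp
      have "0 \<le> norm x * norm y" by simp
      moreover have "(1 + norm y) * (1 + norm x) = 1 + norm x + norm y + norm x * norm y"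
        by (simp add: algebra_simps)
      ultimately have "norm (x - y) \<le> (1 + norm y) * (1 + norm x)"
        using norm_triangle_ineq4[of x y] by linarith
      then show "?w y / (1 + norm x) \<le> \<rho> y / norm (x - y)"
        using p \<rho>_nonneg[of y] by (simp add: frac_le)
    qed
    finally show ?thesis .
  qed
  obtain c \<delta> where c: "c > 0" "\<delta> > 0" "\<And>t. 0 < t \<Longrightarrow> t < \<delta> \<Longrightarrow> c * t ^ 3 \<le> dens t"
    using dens_cube_lower by blast
  define c1 where "c1 = min c0 (\<delta> / 2)"
  have c1: "c1 > 0" "c1 \<le> c0" "c1 < \<delta>" using c0 c(2) by (auto simp: c1_def)
  have "(\<integral>\<^sup>+x. ennreal (c * c1 ^ 3 * (1 / (1 + norm (x::R3))) ^ 3) \<partial>lborel) \<le> (\<integral>\<^sup>+x. ennreal (\<rho> x) \<partial>lborel)"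
  proof (intro nn_integral_mono ennreal_leI)
    fix x :: R3
    define t where "t = c1 / (1 + norm x)"
    have n: "1 + norm x > 0" by (simp add: add_pos_nonneg)
    have t0: "t > 0" using c1 n by (simp add: t_def)
    have "t \<le> c1" using c1 n by (simp add: t_def divide_le_eq algebra_simps)
    then have "t < \<delta>" using c1 by simp
    have "t \<le> c0 / (1 + norm x)" unfolding t_def using c1 n by (intro divide_right_mono) auto
    also have "\<dots> \<le> s x" using lower[of x] E0 by (simp add: s_def)
    finally have "dens t \<le> \<rho> x" unfolding \<rho>_eq by (rule dens_mono)
    moreover have "c * t ^ 3 \<le> dens t" using c(3) t0 \<open>t < \<delta>\<close> by simp
    ultimately show "c * c1 ^ 3 * (1 / (1 + norm x)) ^ 3 \<le> \<rho> x"
      by (simp add: t_def power_divide)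
  qed
  moreover have "(\<integral>\<^sup>+x. ennreal (c * c1 ^ 3 * (1 / (1 + norm (x::R3))) ^ 3) \<partial>lborel) = \<infinity>"
    using c c1 by (intro nn_integral_inverse_cube_infinite) simp
  ultimately show False unfolding \<rho>_nn_mass by (simp add: top_unique)
qed

lemma Upot_tendsto_0: "(Upot f0 \<longlongrightarrow> 0) at_infinity"
proof -
  obtain B where "bounded_density \<rho> B" using density_bounded ..
  then interpret bounded_density \<rho> B .
  show ?thesis using tendsto_minus[OF newt_tendsto_0] by (simp add: Upot_eq_newt[abs_def])
qed

lemma density_support: "\<exists>R. \<forall>x. norm x > R \<longrightarrow> \<rho> x = 0"
proof -
  obtain B where "bounded_density \<rho> B" using density_bounded ..
  then interpret bounded_density \<rho> B .
  have "\<forall>\<^sub>F x in at_infinity. dist (newt \<rho> x) 0 < - E0"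
    using newt_tendsto_0 E0_neg by (intro tendstoD) auto
  then obtain R where R: "\<And>x. norm x \<ge> R \<Longrightarrow> \<bar>newt \<rho> x\<bar> < - E0"
    unfolding eventually_at_infinity by auto
  have "\<rho> x = 0" if "norm x > R" for x
    unfolding \<rho>_eq using R[of x] that by (intro dens_zero) (simp add: s_def)
  then show ?thesis by blast
qed

lemma density_C1: "\<exists>D R. C1_compact_density \<rho> D R"
proof -
  obtain B where "bounded_density \<rho> B" using density_bounded ..
  then interpret bounded_density \<rho> B .
  obtain R where R: "\<And>x. norm x > R \<Longrightarrow> \<rho> x = 0" using density_support by blast
  define S where "S = E0 + (B * ball_const / 2 + mass)"
  have sS: "s x \<le> S" for x using newt_bound[of x] by (simp add: s_def S_def)
  obtain G G' where G: "\<And>t. t \<le> S \<Longrightarrow> dens t = G t" "\<And>t. (G has_real_derivative G' t) (at t)"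
    "continuous_on UNIV G'"
    by (rule dens_C1[of S], rule that; blast)
  have \<rho>G: "\<rho> = (\<lambda>x. G (s x))" using G(1)[OF sS] by (simp add: \<rho>_eq fun_eq_iff)
  define D where "D x = (- G' (s x)) *\<^sub>R blinfun_inner_right (gnewt \<rho> x)" for x
  have sd: "(s has_derivative (\<lambda>h. - (gnewt \<rho> x \<bullet> h))) (at x)" for x
    unfolding s_def by (auto intro!: derivative_eq_intros newt_has_derivative)
  have "(\<rho> has_derivative blinfun_apply (D x)) (at x)" for x
  proof -
    have "((\<lambda>x. G (s x)) has_derivative (\<lambda>h. - (gnewt \<rho> x \<bullet> h) * G' (s x))) (at x)"
      by (rule DERIV_compose_FDERIV[OF G(2) sd])
    moreover have "(\<lambda>h. - (gnewt \<rho> x \<bullet> h) * G' (s x)) = blinfun_apply (D x)"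
      by (auto simp: D_def scaleR_blinfun.rep_eq uminus_blinfun.rep_eq blinfun.scaleR_left)
    ultimately show ?thesis unfolding \<rho>G[symmetric] by simp
  qed
  moreover have "continuous_on UNIV s"
    by (intro continuous_at_imp_continuous_on ballI has_derivative_continuous[OF sd])
  then have "continuous_on UNIV D"
    unfolding D_def
    by (intro continuous_intros continuous_on_compose2[OF G(3)] bounded_linear.continuous_on[OF bounded_linear_blinfun_inner_right] gnewt_continuous) auto
  ultimately have "C1_compact_density \<rho> D R" using R by unfold_locales auto
  then show ?thesis by blast
qed

lemma Upot_C2:
  "\<exists>(DU :: R3 \<Rightarrow> R3 \<Rightarrow>\<^sub>L real) (D2U :: R3 \<Rightarrow> R3 \<Rightarrow>\<^sub>L (R3 \<Rightarrow>\<^sub>L real)).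
          (\<forall>x. (Upot f0 has_derivative blinfun_apply (DU x)) (at x)) \<and>
          (\<forall>x. (DU has_derivative blinfun_apply (D2U x)) (at x)) \<and>
          continuous_on UNIV D2U \<and>
          bounded (range (Upot f0)) \<and> bounded (range DU) \<and> bounded (range D2U)"
proof -
  obtain B where "bounded_density \<rho> B" using density_bounded ..
  then interpret bounded_density \<rho> B .
  obtain D R where "C1_compact_density \<rho> D R" using density_C1 by blast
  then interpret C: C1_compact_density \<rho> D R .
  define q where "q i y = D y i" for i y
  have "\<forall>i. \<exists>Bi. bounded_density (q i) Bi" unfolding q_def using C.bounded_density_Dq by blast
  then obtain Bq where "\<And>i. bounded_density (q i) (Bq i)" by metis
  then interpret qi: bounded_density "q i" "Bq i" for i .
  define DU where "DU x = blinfun_inner_right (gnewt \<rho> x)" for x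
  define A where "A i v = blinfun_scaleR_left (blinfun_inner_right i) o\<^sub>L blinfun_inner_right v" for i v :: R3
  define D2U where "D2U x = (\<Sum>i\<in>Basis. A i (gnewt (q i) x))" for x
  have "gnewt \<rho> x = (\<Sum>i\<in>Basis. (- newt (q i) x) *\<^sub>R i)" for x
  proof -
    have q: "q i = (\<lambda>y. D y i)" for i by (simp add: q_def fun_eq_iff)
    show ?thesis using euclidean_representation[of "gnewt \<rho> x"] by (simp only: C.gnewt_inner_eq q)
  qed
  then have DUsum: "DU x = (\<Sum>i\<in>Basis. (- newt (q i) x) *\<^sub>R blinfun_inner_right i)" for x
    by (simp add: DU_def linear_sum[OF bounded_linear.linear[OF bounded_linear_blinfun_inner_right]]
        linear_cmul[OF bounded_linear.linear[OF bounded_linear_blinfun_inner_right]]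
        linear_neg[OF bounded_linear.linear[OF bounded_linear_blinfun_inner_right]])
  have d1: "(Upot f0 has_derivative blinfun_apply (DU x)) (at x)" for x
  proof -
    have "(Upot f0 has_derivative (\<lambda>h. - (- (gnewt \<rho> x \<bullet> h)))) (at x)"
      unfolding Upot_eq_newt[abs_def] by (rule has_derivative_minus[OF newt_has_derivative])
    then show ?thesis by (simp add: DU_def)
  qed
  have d2: "(DU has_derivative blinfun_apply (D2U x)) (at x)" for x
  proof -
    have "((\<lambda>x. \<Sum>i\<in>Basis. (- newt (q i) x) *\<^sub>R blinfun_inner_right i) has_derivative
        (\<lambda>h. \<Sum>i\<in>Basis. (- (- (gnewt (q i) x \<bullet> h))) *\<^sub>R blinfun_inner_right i)) (at x)"
      by (intro has_derivative_sum has_derivative_scaleR_left has_derivative_minus qi.newt_has_derivative)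
    moreover have "(\<lambda>h. \<Sum>i\<in>Basis. (- (- (gnewt (q i) x \<bullet> h))) *\<^sub>R blinfun_inner_right i) = blinfun_apply (D2U x)"
      by (auto simp: D2U_def A_def blinfun.sum_left)
    ultimately show ?thesis unfolding DUsum[abs_def] by simp
  qed
  have cA: "bounded_linear (A i)" for i
    unfolding A_def
    by (intro bounded_linear_compose[OF bounded_bilinear.bounded_linear_right[OF bounded_bilinear_blinfun_compose] bounded_linear_blinfun_inner_right])
  have c2: "continuous_on UNIV D2U"
    unfolding D2U_def by (intro continuous_intros bounded_linear.continuous_on[OF cA] qi.gnewt_continuous)
  have bU: "bounded (range (Upot f0))"
    unfolding bounded_iff using newt_bound by (auto simp: Upot_eq_newt)
  have bg: "bounded (range (gnewt \<rho>))" unfolding bounded_iff using gnewt_bound by auto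
  have bDU: "bounded (range DU)"
    using bounded_linear_image[OF bg bounded_linear_blinfun_inner_right] unfolding DU_def image_image .
  have bA: "bounded (range (\<lambda>x. A i (gnewt (q i) x)))" for i
  proof -
    have "bounded (range (gnewt (q i)))" unfolding bounded_iff using qi.gnewt_bound by auto
    from bounded_linear_image[OF this cA[of i]] show ?thesis unfolding image_image .
  qed
  have "\<forall>i. \<exists>K. \<forall>x. norm (A i (gnewt (q i) x)) \<le> K" using bA unfolding bounded_iff by blast
  then obtain K where K: "\<And>i x. norm (A i (gnewt (q i) x)) \<le> K i" by metis
  have "norm (D2U x) \<le> (\<Sum>i\<in>Basis. K i)" for x
    unfolding D2U_def by (intro sum_norm_le K)
  then have bD2: "bounded (range D2U)" unfolding bounded_iff by auto
  show ?thesis using d1 d2 c2 bU bDU bD2 by blast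
qed

lemma energy_const_pos: "energy_const > 0"
proof (rule ccontr)
  assume "\<not> energy_const > 0"
  then have e: "energy_const \<le> 0" by simp
  obtain B where "bounded_density \<rho> B" using density_bounded ..
  then interpret bounded_density \<rho> B .
  have "coulomb \<rho> \<ge> 0"
    unfolding coulomb_def by (intro integral_nonneg_AE) (simp add: \<rho>_nonneg)
  then have "(\<integral>x. (norm (gnewt \<rho> x))\<^sup>2 \<partial>lborel) \<le> 0"
    unfolding energy_identity using e by (simp add: mult_nonpos_nonneg)
  moreover have "(\<integral>x. (norm (gnewt \<rho> x))\<^sup>2 \<partial>lborel) \<ge> 0" by simp
  ultimately have "(\<integral>x. (norm (gnewt \<rho> x))\<^sup>2 \<partial>lborel) = 0" by simp
  then have "AE x in lborel. (norm (gnewt \<rho> x))\<^sup>2 = 0"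
    using integral_nonneg_eq_0_iff_AE[OF energy_integrable] by simp
  then have "AE x in lborel. x \<in> {x. gnewt \<rho> x = 0}" by simp
  then have "AE x in lebesgue. x \<in> {x. gnewt \<rho> x = 0}" by (rule AE_completion)
  moreover have "closed {x. gnewt \<rho> x = 0}" by (intro closed_Collect_eq gnewt_continuous continuous_on_const)
  ultimately have "x \<in> {x. gnewt \<rho> x = 0}" for x using mem_closed_if_AE_lebesgue by blast
  then have z: "gnewt \<rho> x = 0" for x by simp
  have "\<exists>c. \<forall>x\<in>UNIV. newt \<rho> x = c"
    by (rule has_derivative_zero_constant) (use newt_has_derivative in \<open>auto simp: z\<close>)
  then obtain c where c: "\<And>x. newt \<rho> x = c" by auto
  have "newt \<rho> = (\<lambda>x. c)" using c by auto
  then have "((\<lambda>x::R3. c) \<longlongrightarrow> 0) at_infinity" using newt_tendsto_0 by simp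
  then have "c = 0" using tendsto_unique[OF trivial_limit_at_infinity tendsto_const] by blast
  then have "\<rho> x = 0" for x unfolding \<rho>_eq using E0_neg c by (intro dens_zero) (simp add: s_def)
  then show False using \<rho>_mass hM by simp
qed

end

section \<open>Spherical symmetry\<close>

lemma Epot_eq:
  assumes "bounded_density (rho f) B"
  shows "Epot f = - (1 / (8 * pi)) * (energy_const * coulomb (rho f))"
proof -
  interpret bounded_density "rho f" B by (rule assms)
  have "(\<integral>\<^sup>+x. ennreal (norm (gradU f x) ^ 2) \<partial>lborel) = ennreal (\<integral>x. (norm (gnewt (rho f) x))\<^sup>2 \<partial>lborel)"
    unfolding gradU_eq_gnewt by (intro nn_integral_eq_integral energy_integrable) simp
  moreover have "0 \<le> (\<integral>x. (norm (gnewt (rho f) x))\<^sup>2 \<partial>lborel)" by simp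
  ultimately show ?thesis unfolding Epot_def by (simp only: enn2real_ennreal energy_identity)
qed

lemma continuous_nonneg_integral_0:
  fixes w :: "R3 \<Rightarrow> real"
  assumes c: "continuous_on UNIV w" and nn: "\<And>y. w y \<ge> 0" and i: "integrable lborel w" "(\<integral>y. w y \<partial>lborel) = 0"
  shows "w y = 0"
proof -
  have "AE y in lborel. w y = 0" using integral_nonneg_eq_0_iff_AE[OF i(1)] nn i(2) by simp
  then have "AE y in lborel. y \<in> {y. w y = 0}" by simp
  then have "AE y in lebesgue. y \<in> {y. w y = 0}" by (rule AE_completion)
  moreover have "closed {y. w y = 0}" by (intro closed_Collect_eq c continuous_on_const)
  ultimately have "y \<in> {y. w y = 0}" using mem_closed_if_AE_lebesgue by blast
  then show ?thesis by simp
qed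

context reflection
begin

lemma polarize_nn_integral:
  fixes f :: "R3 \<Rightarrow> R3 \<Rightarrow> real" and F :: "R3 \<Rightarrow> real \<Rightarrow> ennreal"
  assumes mf[measurable]: "(\<lambda>z. F (snd z) (f (fst z) (snd z))) \<in> borel_measurable borel"
    and mg[measurable]: "(\<lambda>z. F (snd z) (polarize (\<lambda>x. f x (snd z)) (fst z))) \<in> borel_measurable borel"
  shows "(\<integral>\<^sup>+z. F (snd z) (polarize (\<lambda>x. f x (snd z)) (fst z)) \<partial>lborel)
    = (\<integral>\<^sup>+z. F (snd z) (f (fst z) (snd z)) \<partial>lborel)"
proof -
  define T where "T = (\<lambda>z::R3\<times>R3. (\<sigma> (fst z), snd z))"
  have mT[measurable]: "T \<in> borel_measurable borel" unfolding T_def by measurable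
  have dT: "distr lborel borel T = lborel" unfolding T_def by (rule distr_lborel_pair(1)[OF \<sigma>_measurable distr_\<sigma>])
  have inv: "(\<integral>\<^sup>+z. h (T z) \<partial>lborel) = (\<integral>\<^sup>+z. h z \<partial>lborel)" if [measurable]: "h \<in> borel_measurable borel" for h :: "R3 \<times> R3 \<Rightarrow> ennreal"
  proof -
    have "(\<integral>\<^sup>+z. h z \<partial>lborel) = integral\<^sup>N (distr lborel borel T) h" by (simp only: dT)
    also have "\<dots> = (\<integral>\<^sup>+z. h (T z) \<partial>lborel)" by (rule nn_integral_distr) measurable
    finally show ?thesis by simp
  qed
  define hf hg where "hf = (\<lambda>z. F (snd z) (f (fst z) (snd z)))"
    and "hg = (\<lambda>z. F (snd z) (polarize (\<lambda>x. f x (snd z)) (fst z)))"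
  have m[measurable]: "hf \<in> borel_measurable borel" "hg \<in> borel_measurable borel"
    unfolding hf_def hg_def by measurable
  have "2 * (\<integral>\<^sup>+z. hg z \<partial>lborel) = (\<integral>\<^sup>+z. hg z \<partial>lborel) + (\<integral>\<^sup>+z. hg (T z) \<partial>lborel)"
    by (simp add: inv mult_2)
  also have "\<dots> = (\<integral>\<^sup>+z. hg z + hg (T z) \<partial>lborel)" by (rule nn_integral_add[symmetric]) measurable
  also have "\<dots> = (\<integral>\<^sup>+z. hf z + hf (T z) \<partial>lborel)"
    unfolding hf_def hg_def T_def by (intro nn_integral_cong) (simp add: polarize_apply_sum[where F = "F _"])
  also have "\<dots> = (\<integral>\<^sup>+z. hf z \<partial>lborel) + (\<integral>\<^sup>+z. hf (T z) \<partial>lborel)" by (rule nn_integral_add) measurable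
  also have "\<dots> = 2 * (\<integral>\<^sup>+z. hf z \<partial>lborel)" by (simp add: inv mult_2)
  finally show ?thesis by (simp add: ennreal_mult_cancel_left hf_def hg_def)
qed

end

context steady_state
begin

lemma \<rho>_continuous: "continuous_on UNIV \<rho>"
  using density_C1 C1_compact_density.cont_q by blast

lemma reflection_sign:
  assumes hmin: "\<forall>g \<in> FM Q M. HC Q f0 \<le> HC Q g" and r: "reflection n"
    and y: "reflection.side p n y > 0" and z: "reflection.side p n z > 0"
  shows "0 \<le> (\<rho> y - \<rho> (reflection.\<sigma> p n y)) * (\<rho> z - \<rho> (reflection.\<sigma> p n z))"
proof -
  interpret reflection p n by (rule r)
  obtain B where "bounded_density \<rho> B" using density_bounded ..
  then interpret bounded_density \<rho> B .
  define g where "g = (\<lambda>x v. polarize (\<lambda>x. f0 x v) x)"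
  have [measurable]: "(\<lambda>z. f0 (\<sigma> (fst z)) (snd z)) \<in> borel_measurable borel"
  proof -
    have "(\<lambda>z::R3\<times>R3. (\<sigma> (fst z), snd z)) \<in> borel_measurable borel" by measurable
    from measurable_compose[OF this f0_measurable] show ?thesis by simp
  qed
  have mg[measurable]: "(\<lambda>z. g (fst z) (snd z)) \<in> borel_measurable borel"
    unfolding g_def polarize_def by measurable
  have g_nonneg: "0 \<le> g x v" for x v unfolding g_def polarize_def using f0_nonneg by (auto simp: le_max_iff_disj)
  have mQg[measurable]: "(\<lambda>z. Q (g (fst z) (snd z))) \<in> borel_measurable borel"
    by (rule Q_comp_measurable[OF mg g_nonneg])
  have 1: "(\<integral>\<^sup>+z. ennreal (g (fst z) (snd z)) \<partial>lborel) = ennreal M"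
    unfolding f0_nn_mass[symmetric] g_def
    by (rule polarize_nn_integral[where F = "\<lambda>v t. ennreal t"]) (use mg in \<open>auto simp: g_def\<close>)
  have 2: "Ccal Q g = Ccal Q f0"
    unfolding Ccal_def g_def
    by (rule polarize_nn_integral[where F = "\<lambda>v t. ennreal (Q t)"]) (use mQg in \<open>auto simp: g_def\<close>)
  have 3: "Ekin g = Ekin f0"
    unfolding Ekin_def g_def
    by (rule polarize_nn_integral[where F = "\<lambda>v t. ennreal (norm v ^ 2 / 2 * t)"]) (use mg in \<open>auto simp: g_def\<close>)
  have P: "Pcal Q g = Pcal Q f0" by (simp add: Pcal_def 2 3)
  have ig: "integrable lborel (\<lambda>z. g (fst z) (snd z))"
    by (rule integrableI_nonneg) (auto simp: 1 g_nonneg)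
  have "(\<integral>z. g (fst z) (snd z) \<partial>(lborel :: (R3 \<times> R3) measure)) = M"
    using 1 hM by (subst integral_eq_nn_integral) (auto simp: g_nonneg)
  then have gFM: "g \<in> FM Q M" unfolding FM_def using ig g_nonneg P f0_Pcal by simp
  have rg: "rho g = polarize \<rho>"
  proof
    fix x
    have ord: "(\<forall>v. f0 a v \<le> f0 b v) \<and> \<rho> a \<le> \<rho> b" if "s a \<le> s b" for a b
    proof (intro conjI allI)
      show "f0 a v \<le> f0 b v" for v
      proof -
        have "\<psi> (s a - (norm v)\<^sup>2 / 2) \<le> \<psi> (s b - (norm v)\<^sup>2 / 2)" by (rule monoD[OF mono_\<psi>]) (use that in simp)
        then show ?thesis by (simp only: f0_eq)
      qed
      show "\<rho> a \<le> \<rho> b" unfolding \<rho>_eq by (rule dens_mono[OF that])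
    qed
    consider "s x \<le> s (\<sigma> x)" | "s (\<sigma> x) \<le> s x" by linarith
    then show "rho g x = polarize \<rho> x"
    proof cases
      case 1
      from ord[OF 1] have "g x = (if side x > 0 then f0 (\<sigma> x) else f0 x)"
        "polarize \<rho> x = (if side x > 0 then \<rho> (\<sigma> x) else \<rho> x)"
        by (auto simp: g_def polarize_def fun_eq_iff max_absorb2 min_absorb1)
      then show ?thesis by (simp add: rho_def)
    next
      case 2
      from ord[OF 2] have "g x = (if side x > 0 then f0 x else f0 (\<sigma> x))"
        "polarize \<rho> x = (if side x > 0 then \<rho> x else \<rho> (\<sigma> x))"
        by (auto simp: g_def polarize_def fun_eq_iff max_absorb1 min_absorb2)
      then show ?thesis by (simp add: rho_def)
    qed
  qed
  have bp: "bounded_density (polarize \<rho>) B"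
  proof
    show "\<bar>polarize \<rho> y\<bar> \<le> B" for y
      unfolding polarize_def using bound_q[of y] bound_q[of "\<sigma> y"] by (auto simp: max_def min_def)
    have "integrable lborel (\<lambda>x. \<rho> x + \<rho> (\<sigma> x))"
      by (intro Bochner_Integration.integrable_add \<rho>_integrable integrable_measure_preserving[OF distr_\<sigma> \<sigma>_measurable])
    then show "integrable lborel (polarize \<rho>)"
      by (rule Bochner_Integration.integrable_bound) (auto simp: polarize_def max_def min_def \<rho>_nonneg)
  qed
  have "HC Q f0 \<le> HC Q g" using hmin gFM by blast
  then have "Epot f0 \<le> Epot g" by (simp add: HC_def P)
  then have "energy_const * coulomb (polarize \<rho>) \<le> energy_const * coulomb \<rho>"
    using Epot_eq[OF bounded_density_axioms] Epot_eq[of g B] bp rg by (simp add: divide_le_cancel)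
  then have "coulomb (polarize \<rho>) \<le> coulomb \<rho>" using energy_const_pos by simp
  then show ?thesis by (rule polarization_rigidity[OF bounded_density_axioms \<rho>_continuous bp _ y z])
qed

definition x0 :: R3 where "x0 = (1 / M) *\<^sub>R (\<integral>y. \<rho> y *\<^sub>R y \<partial>lborel)"

lemma first_moment: "integrable lborel (\<lambda>y. \<rho> y *\<^sub>R y)"
proof -
  obtain R where R: "\<And>x. norm x > R \<Longrightarrow> \<rho> x = 0" using density_support by blast
  have "integrable lborel (\<lambda>y. \<bar>R\<bar> * \<rho> y)" using \<rho>_integrable by simp
  then show ?thesis
  proof (rule Bochner_Integration.integrable_bound)
    show "AE y in lborel. norm (\<rho> y *\<^sub>R y) \<le> norm (\<bar>R\<bar> * \<rho> y)"
    proof (intro AE_I2)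
      fix y
      show "norm (\<rho> y *\<^sub>R y) \<le> norm (\<bar>R\<bar> * \<rho> y)"
      proof (cases "norm y > R")
        case False
        then have "norm y * \<rho> y \<le> \<bar>R\<bar> * \<rho> y" using \<rho>_nonneg[of y] by (intro mult_right_mono) auto
        then show ?thesis using \<rho>_nonneg[of y] by (simp add: mult.commute abs_mult)
      qed (simp add: R)
    qed
  qed simp
qed

lemma reflection_invariant:
  assumes hmin: "\<forall>g \<in> FM Q M. HC Q f0 \<le> HC Q g" and r: "reflection n"
  shows "\<rho> (reflection.\<sigma> x0 n y) = \<rho> y"
proof -
  interpret reflection x0 n by (rule r)
  define \<delta> where "\<delta> y = \<rho> y - \<rho> (\<sigma> y)" for y
  define w where "w y = side y * \<delta> y" for y
  have sgn: "0 \<le> \<delta> y * \<delta> z" if "side y > 0" "side z > 0" for y z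
    unfolding \<delta>_def using reflection_sign[OF hmin r that] .
  have \<delta>\<sigma>: "\<delta> (\<sigma> y) = - \<delta> y" for y by (simp add: \<delta>_def \<sigma>_\<sigma>)
  have w\<sigma>: "w (\<sigma> y) = w y" for y by (simp add: w_def side_\<sigma> \<delta>\<sigma>)
  have c\<delta>: "continuous_on UNIV \<delta>"
    unfolding \<delta>_def by (intro continuous_intros \<rho>_continuous continuous_on_compose2[OF \<rho>_continuous \<sigma>_continuous]) auto
  have cw: "continuous_on UNIV w" unfolding w_def by (intro continuous_intros side_continuous c\<delta>)
  have ism: "integrable lborel (\<lambda>y. side y * \<rho> y)" and vsm: "(\<integral>y. side y * \<rho> y \<partial>lborel) = 0"
  proof -
    have e: "side y * \<rho> y = (\<rho> y *\<^sub>R y) \<bullet> n - (x0 \<bullet> n) * \<rho> y" for y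
      by (simp add: side_def inner_diff_left algebra_simps)
    have i1: "integrable lborel (\<lambda>y. (\<rho> y *\<^sub>R y) \<bullet> n)" by (rule integrable_inner_left[OF first_moment])
    have i2: "integrable lborel (\<lambda>y. (x0 \<bullet> n) * \<rho> y)" by (rule integrable_mult_right[OF \<rho>_integrable])
    show "integrable lborel (\<lambda>y. side y * \<rho> y)" unfolding e by (rule Bochner_Integration.integrable_diff[OF i1 i2])
    have "(\<integral>y. side y * \<rho> y \<partial>lborel) = (\<integral>y. (\<rho> y *\<^sub>R y) \<bullet> n \<partial>lborel) - (\<integral>y. (x0 \<bullet> n) * \<rho> y \<partial>lborel)"
      unfolding e by (rule Bochner_Integration.integral_diff[OF i1 i2])
    also have "(\<integral>y. (\<rho> y *\<^sub>R y) \<bullet> n \<partial>lborel) = (M *\<^sub>R x0) \<bullet> n"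
      unfolding integral_inner_left[OF first_moment] using hM by (simp add: x0_def)
    also have "(\<integral>y. (x0 \<bullet> n) * \<rho> y \<partial>lborel) = (x0 \<bullet> n) * M" by (simp add: \<rho>_mass)
    finally show "(\<integral>y. side y * \<rho> y \<partial>lborel) = 0" by simp
  qed
  have wdec: "w y = side y * \<rho> y + side (\<sigma> y) * \<rho> (\<sigma> y)" for y
    by (simp add: w_def \<delta>_def side_\<sigma> algebra_simps)
  note i\<sigma> = integrable_measure_preserving[OF distr_\<sigma> \<sigma>_measurable ism]
  have iw: "integrable lborel w"
    unfolding wdec by (rule Bochner_Integration.integrable_add[OF ism i\<sigma>])
  have vw: "(\<integral>y. w y \<partial>lborel) = 0"
    unfolding wdec Bochner_Integration.integral_add[OF ism i\<sigma>]
      integral_measure_preserving[OF distr_\<sigma> \<sigma>_measurable ism] vsm by simp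
  have no_diff: False if y0: "side y0 > 0" "\<delta> y0 \<noteq> 0" for y0
  proof -
    define e :: real where "e = (if \<delta> y0 > 0 then 1 else -1)"
    have nnp: "0 \<le> e * w z" if "side z > 0" for z
    proof -
      have "0 \<le> \<delta> y0 * \<delta> z" using sgn y0(1) that by blast
      then have "0 \<le> e * \<delta> z" using y0(2) by (auto simp: e_def zero_le_mult_iff)
      then have "0 \<le> side z * (e * \<delta> z)" using that by simp
      then show ?thesis by (simp add: w_def mult_ac)
    qed
    have nn: "0 \<le> e * w z" for z
    proof (cases "side z" "0::real" rule: linorder_cases)
      case less
      then show ?thesis using nnp[of "\<sigma> z"] by (simp add: side_\<sigma> w\<sigma>)
    next
      case equal
      then show ?thesis by (simp add: w_def)
    qed (rule nnp)
    have "e * w y0 = 0"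
    proof (rule continuous_nonneg_integral_0[of "\<lambda>y. e * w y"])
      show "continuous_on UNIV (\<lambda>y. e * w y)" by (intro continuous_intros cw)
      show "integrable lborel (\<lambda>y. e * w y)" by (rule integrable_mult_right[OF iw])
      show "(\<integral>y. e * w y \<partial>lborel) = 0" by (simp add: vw)
    qed (rule nn)
    then show False using y0 by (auto simp: w_def e_def split: if_splits)
  qed
  show ?thesis
  proof (cases "side y" "0::real" rule: linorder_cases)
    case less
    then have "\<delta> (\<sigma> y) = 0" using no_diff[of "\<sigma> y"] by (auto simp: side_\<sigma>)
    then show ?thesis by (simp add: \<delta>_def \<sigma>_\<sigma>)
  next
    case equal
    then show ?thesis by (simp add: \<sigma>_fixed)
  next
    case greater
    then have "\<delta> y = 0" using no_diff[of y] by auto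
    then show ?thesis by (simp add: \<delta>_def)
  qed
qed

lemma spherical_symmetry:
  assumes hmin: "\<forall>g \<in> FM Q M. HC Q f0 \<le> HC Q g" and A: "orthogonal_transformation A"
  shows "\<rho> (x0 + A (x - x0)) = \<rho> x" and "Upot f0 (x0 + A (x - x0)) = Upot f0 x"
    and "f0 (x0 + A (x - x0)) (A v) = f0 x v"
proof -
  have lin: "linear A" using A by (rule orthogonal_transformation_linear)
  have nA: "norm (A y) = norm y" for y using A by (simp add: orthogonal_transformation)
  show rho: "\<rho> (x0 + A (x - x0)) = \<rho> x" for x
  proof (cases "A (x - x0) = x - x0")
    case True
    then show ?thesis by simp
  next
    case False
    define y where "y = x - x0"
    define d where "d = y - A y"
    have d: "norm d > 0" using False by (simp add: d_def y_def)
    define n where "n = (1 / norm d) *\<^sub>R d"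
    have r: "reflection n" by unfold_locales (use d in \<open>simp add: n_def\<close>)
    interpret reflection x0 n by (rule r)
    have "A y \<bullet> A y = y \<bullet> y" using nA[of y] by (simp add: dot_square_norm)
    then have dd: "d \<bullet> d = 2 * (y \<bullet> d)"
      by (simp add: d_def inner_diff_left inner_diff_right inner_commute)
    have "(2 * (y \<bullet> n)) *\<^sub>R n = ((2 * (y \<bullet> d)) / (norm d)\<^sup>2) *\<^sub>R d"
      by (simp add: n_def power2_eq_square)
    also have "\<dots> = d" using d unfolding dd[symmetric] by (simp add: dot_square_norm)
    finally have "\<sigma> x = x - d" by (simp add: \<sigma>_def y_def)
    also have "\<dots> = x0 + A (x - x0)" by (simp add: d_def y_def)
    finally show ?thesis using reflection_invariant[OF hmin r, of x] by simp
  qed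
  show U: "Upot f0 (x0 + A (x - x0)) = Upot f0 x" for x
  proof -
    define p where "p = x0 - A x0"
    have aff: "x0 + A (z - x0) = p + 1 *\<^sub>R A z" for z by (simp add: p_def linear_diff[OF lin])
    have "newt \<rho> (p + 1 *\<^sub>R A x) = 1 ^ 3 * (\<integral>z. \<rho> (p + 1 *\<^sub>R A z) / norm (p + 1 *\<^sub>R A x - (p + 1 *\<^sub>R A z)) \<partial>lborel)"
      unfolding newt_def by (rule lebesgue_integral_similarity[OF A zero_less_one]) measurable
    also have "\<dots> = newt \<rho> x"
    proof -
      have "\<rho> (p + 1 *\<^sub>R A z) = \<rho> z" for z using rho[of z] by (simp only: aff)
      moreover have "norm (p + 1 *\<^sub>R A x - (p + 1 *\<^sub>R A z)) = norm (x - z)" for z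
        using nA[of "x - z"] by (simp add: linear_diff[OF lin])
      ultimately show ?thesis unfolding newt_def by simp
    qed
    finally show ?thesis unfolding aff Upot_eq_newt by simp
  qed
  show "f0 (x0 + A (x - x0)) (A v) = f0 x v"
    unfolding hform[of x v] hform[of "x0 + A (x - x0)" "A v"] by (simp add: U nA)
qed

end

theorem theorem3:
  fixes Q Q' Q'' :: "real \<Rightarrow> real" and k1 k2 M C1' C2' :: real
    and f0 :: "R3 \<Rightarrow> R3 \<Rightarrow> real"
  assumes hQ: "standing_Q Q Q' Q'' k1 k2"
    and hM: "M > 0"
    and hf0: "f0 \<in> FM Q M"
    and hmin: "\<forall>g \<in> FM Q M. HC Q f0 \<le> HC Q g"
    and hform: "\<forall>x v. f0 x v = phi Q' (cutoff_energy Q' M f0) (norm v ^ 2 / 2 + Upot f0 x)"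
    and hC1': "C1' > 0" and hC2': "C2' > 0"
    and hupper: "\<forall>\<^sub>F E in at_bot.
        phi Q' (cutoff_energy Q' M f0) E \<le> C1' * (cutoff_energy Q' M f0 - E) powr k1"
    and hlower: "\<forall>\<^sub>F E in at_left (cutoff_energy Q' M f0).
        phi Q' (cutoff_energy Q' M f0) E \<ge> C2' * (cutoff_energy Q' M f0 - E) powr k2"
  shows "cutoff_energy Q' M f0 < 0
    \<and> (\<exists>D :: R3 \<Rightarrow> R3 \<Rightarrow>\<^sub>L real.
          (\<forall>x. (rho f0 has_derivative blinfun_apply (D x)) (at x)) \<and> continuous_on UNIV D)
    \<and> bounded {x. rho f0 x \<noteq> 0}
    \<and> (\<exists>(DU :: R3 \<Rightarrow> R3 \<Rightarrow>\<^sub>L real) (D2U :: R3 \<Rightarrow> R3 \<Rightarrow>\<^sub>L (R3 \<Rightarrow>\<^sub>L real)).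
          (\<forall>x. (Upot f0 has_derivative blinfun_apply (DU x)) (at x)) \<and>
          (\<forall>x. (DU has_derivative blinfun_apply (D2U x)) (at x)) \<and>
          continuous_on UNIV D2U \<and>
          bounded (range (Upot f0)) \<and> bounded (range DU) \<and> bounded (range D2U))
    \<and> ((Upot f0 \<longlongrightarrow> 0) at_infinity)
    \<and> (\<exists>x0 :: R3. \<forall>A. orthogonal_transformation A \<longrightarrow>
          (\<forall>x v. f0 (x0 + A (x - x0)) (A v) = f0 x v) \<and>
          (\<forall>x. rho f0 (x0 + A (x - x0)) = rho f0 x) \<and>
          (\<forall>x. Upot f0 (x0 + A (x - x0)) = Upot f0 x))"
proof -
  interpret steady_state Q Q' Q'' k1 k2 M "cutoff_energy Q' M f0" C1' C2' f0
    by unfold_locales (fact hQ hM hf0 hC1' hC2' hupper hlower | rule hform[rule_format])+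
  obtain D R where "C1_compact_density (rho f0) D R" using density_C1 by blast
  then interpret C: C1_compact_density "rho f0" D R .
  have "{x. rho f0 x \<noteq> 0} \<subseteq> cball 0 R"
    using C.supp_q by (auto simp: not_less[symmetric])
  then have "bounded {x. rho f0 x \<noteq> 0}" by (rule bounded_subset[OF bounded_cball])
  moreover have "\<exists>D :: R3 \<Rightarrow> R3 \<Rightarrow>\<^sub>L real.
      (\<forall>x. (rho f0 has_derivative blinfun_apply (D x)) (at x)) \<and> continuous_on UNIV D"
    using C.Dq C.cont_Dq by blast
  moreover have "\<exists>x0 :: R3. \<forall>A. orthogonal_transformation A \<longrightarrow>
          (\<forall>x v. f0 (x0 + A (x - x0)) (A v) = f0 x v) \<and>
          (\<forall>x. rho f0 (x0 + A (x - x0)) = rho f0 x) \<and>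
          (\<forall>x. Upot f0 (x0 + A (x - x0)) = Upot f0 x)"
    using spherical_symmetry[OF hmin] by blast
  ultimately show ?thesis using E0_neg Upot_C2 Upot_tendsto_0 by (intro conjI)
qed

end
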